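(* Let $A,B,C\ge 0$ be constants with $A+B+C=1$ and $C>0$. Let $\{(X_n,Y_n)\}_{n=0}^\infty$ be the discrete-time Markov chain on $\mathbb{Z}\times\{+,-\}$ with transition probabilities $P((i,+),(i+1,+))=A$, $P((i,+),(i-1,+))=B$, $P((i,+),(i,-))=C$, $P((i,-),(i-1,-))=A$, $P((i,-),(i+1,-))=B$, $P((i,-),(i,+))=C$ for all $i\in\mathbb{Z}$. For $M>0$ and $t\ge 0$ let $Z_{M,t}:=\frac{1}{\sqrt M}X_{\lfloor Mt\rfloor}$. Then, as $M\to\infty$, the process $(Z_{M,t})_{t\ge0}$ converges weakly to Brownian motion with zero drift and volatility parameter $$v=\frac{(A-B)^2}{C}+(A+B).$$ In particular, for each fixed $t>0$, as $M\to\infty$ the random variable $Z_{M,t}$ converges weakly to the normal distribution $N(0,vt)$.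
   Context: $X_n\in\mathbb{Z}$ and $Y_n\in\{+,-\}$ denote the two coordinates of the chain at time $n$. Brownian motion with zero drift and volatility parameter $v$ means the process $(\sqrt v\,W_t)_{t\ge0}$ with $W$ standard Brownian motion started at $0$ (so its value at time $t$ has law $N(0,vt)$). Weak convergence of processes is in the sense of Donsker's invariance principle (functional central limit theorem), i.e. convergence in distribution in the Skorokhod space $D[0,\infty)$ of right-continuous paths with left limits. *)

theory Defs
  imports "HOL-Probability.Probability"
begin

definition borel_of :: "'a topology \<Rightarrow> 'a measure" where
  "borel_of T = sigma (topspace T) {U. openin T U}"

text \<open>
  Convergence in distribution of random elements of a topological space. Measurability is part of
  the notion, since the integral of a non-measurable function is 0 by convention.
\<close>

definition converges_in_distribution ::
  "'d topology \<Rightarrow> 'a measure \<Rightarrow> ('i \<Rightarrow> 'a \<Rightarrow> 'd) \<Rightarrow> 'b measure \<Rightarrow> ('b \<Rightarrow> 'd) \<Rightarrow> 'i filter \<Rightarrow> bool" where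
  "converges_in_distribution T P Z Q W F \<longleftrightarrow>
     (\<forall>\<^sub>F m in F. Z m \<in> measurable P (borel_of T)) \<and>
     W \<in> measurable Q (borel_of T) \<and>
     (\<forall>f. continuous_map T euclideanreal f \<and> bounded (f ` topspace T) \<longrightarrow>
        ((\<lambda>m. \<integral>\<omega>. f (Z m \<omega>) \<partial>P) \<longlongrightarrow> (\<integral>\<omega>. f (W \<omega>) \<partial>Q)) F)"


section \<open>The Skorokhod space of cadlag paths on the half-line\<close>

text \<open>Paths are functions on \<open>{0..}\<close>, hence extensional outside that set.\<close>

definition cadlag :: "(real \<Rightarrow> real) set" where
  "cadlag = {x \<in> extensional {0..}.
     (\<forall>t\<ge>0. (x \<longlongrightarrow> x t) (at_right t)) \<and> (\<forall>t>0. \<exists>l. (x \<longlongrightarrow> l) (at_left t))}"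

definition time_change :: "(real \<Rightarrow> real) \<Rightarrow> bool" where
  "time_change \<phi> \<longleftrightarrow> strict_mono_on {0..} \<phi> \<and> \<phi> ` {0..} = {0..}"

definition skorokhod_ball :: "(real \<Rightarrow> real) \<Rightarrow> real \<Rightarrow> real \<Rightarrow> (real \<Rightarrow> real) set" where
  "skorokhod_ball x T \<epsilon> = {y \<in> cadlag. \<exists>\<phi> \<delta>. time_change \<phi> \<and> \<delta> < \<epsilon> \<and>
     (\<forall>t\<ge>0. \<bar>\<phi> t - t\<bar> \<le> \<delta>) \<and> (\<forall>t\<in>{0..T}. \<bar>y (\<phi> t) - x t\<bar> \<le> \<delta>)}"

text \<open>
  The $J_1$ topology on $D[0,\infty)$; \<open>limitin_skorokhod_iff\<close> below shows that its
  convergent sequences are the usual ones.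
\<close>

definition skorokhod :: "(real \<Rightarrow> real) topology" where
  "skorokhod = topology (\<lambda>U. U \<subseteq> cadlag \<and> (\<forall>x\<in>U. \<exists>T \<epsilon>. \<epsilon> > 0 \<and> skorokhod_ball x T \<epsilon> \<subseteq> U))"

lemma skorokhod_ball_mono:
  assumes "T' \<le> T" "\<epsilon> \<le> \<epsilon>'"
  shows "skorokhod_ball x T \<epsilon> \<subseteq> skorokhod_ball x T' \<epsilon>'"
proof
  fix y assume "y \<in> skorokhod_ball x T \<epsilon>"
  then obtain l d where "y \<in> cadlag" "time_change l" "d < \<epsilon>" "\<forall>t\<ge>0. \<bar>l t - t\<bar> \<le> d"
      "\<forall>t\<in>{0..T}. \<bar>y (l t) - x t\<bar> \<le> d"
    unfolding skorokhod_ball_def by blast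
  then show "y \<in> skorokhod_ball x T' \<epsilon>'"
    unfolding skorokhod_ball_def using assms
    by (intro CollectI conjI exI[of _ l] exI[of _ d]) auto
qed

lemma time_change_id: "time_change (\<lambda>t. t)"
  by (auto simp: time_change_def strict_mono_on_def)

lemma time_change_nonneg: "time_change \<phi> \<Longrightarrow> 0 \<le> t \<Longrightarrow> 0 \<le> \<phi> t"
  by (auto simp: time_change_def)

lemma time_change_comp:
  assumes "time_change \<phi>" "time_change \<psi>"
  shows "time_change (\<lambda>t. \<psi> (\<phi> t))"
proof -
  have "(\<lambda>t. \<psi> (\<phi> t)) ` {0..} = \<psi> ` \<phi> ` {0..}"
    by (simp add: image_image)
  then show ?thesis
    using assms time_change_nonneg[OF assms(1)]
    by (auto simp: time_change_def strict_mono_on_def)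
qed

lemma openin_skorokhod:
  "openin skorokhod U \<longleftrightarrow>
     U \<subseteq> cadlag \<and> (\<forall>x\<in>U. \<exists>T \<epsilon>. \<epsilon> > 0 \<and> skorokhod_ball x T \<epsilon> \<subseteq> U)"
proof -
  let ?O = "\<lambda>U. U \<subseteq> cadlag \<and> (\<forall>x\<in>U. \<exists>T \<epsilon>. \<epsilon> > 0 \<and> skorokhod_ball x T \<epsilon> \<subseteq> U)"
  have "istopology ?O"
    unfolding istopology_def
  proof (intro conjI allI impI)
    fix U V assume U: "?O U" and V: "?O V"
    then show "U \<inter> V \<subseteq> cadlag" by auto
    show "\<forall>x\<in>U \<inter> V. \<exists>T \<epsilon>. \<epsilon> > 0 \<and> skorokhod_ball x T \<epsilon> \<subseteq> U \<inter> V"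
    proof
      fix x assume "x \<in> U \<inter> V"
      then obtain T e T' e' where *: "e > 0" "skorokhod_ball x T e \<subseteq> U"
          "e' > 0" "skorokhod_ball x T' e' \<subseteq> V"
        using U V by (metis IntE)
      have "skorokhod_ball x (max T T') (min e e') \<subseteq> skorokhod_ball x T e"
           "skorokhod_ball x (max T T') (min e e') \<subseteq> skorokhod_ball x T' e'"
        by (rule skorokhod_ball_mono; simp)+
      then show "\<exists>T \<epsilon>. \<epsilon> > 0 \<and> skorokhod_ball x T \<epsilon> \<subseteq> U \<inter> V"
        using * by (intro exI[of _ "max T T'"] exI[of _ "min e e'"]) auto
    qed
  next
    fix K assume K: "\<forall>U\<in>K. ?O U"
    then show "\<Union>K \<subseteq> cadlag" by auto
    show "\<forall>x\<in>\<Union>K. \<exists>T \<epsilon>. \<epsilon> > 0 \<and> skorokhod_ball x T \<epsilon> \<subseteq> \<Union>K"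
    proof
      fix x assume "x \<in> \<Union>K"
      then obtain U where "U \<in> K" "x \<in> U" by auto
      then obtain T e where "e > 0" "skorokhod_ball x T e \<subseteq> U" using K by metis
      then show "\<exists>T \<epsilon>. \<epsilon> > 0 \<and> skorokhod_ball x T \<epsilon> \<subseteq> \<Union>K"
        using \<open>U \<in> K\<close> by blast
    qed
  qed
  then show ?thesis
    by (simp add: skorokhod_def topology_inverse')
qed

lemma topspace_skorokhod [simp]: "topspace skorokhod = cadlag"
proof -
  have "openin skorokhod cadlag"
    by (auto simp: openin_skorokhod skorokhod_ball_def intro!: exI[of _ "1::real"])
  then show ?thesis
    by (metis openin_skorokhod openin_subset openin_topspace subset_antisym)
qed

lemma skorokhod_ball_self: "x \<in> cadlag \<Longrightarrow> 0 < \<epsilon> \<Longrightarrow> x \<in> skorokhod_ball x T \<epsilon>"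
  unfolding skorokhod_ball_def
  by (intro CollectI conjI exI[of _ "\<lambda>t. t"] exI[of _ "0::real"]) (auto simp: time_change_id)

lemma openin_skorokhod_ball: "openin skorokhod (skorokhod_ball x T \<epsilon>)"
  unfolding openin_skorokhod
proof (intro conjI ballI)
  show "skorokhod_ball x T \<epsilon> \<subseteq> cadlag" by (auto simp: skorokhod_ball_def)
  fix y assume "y \<in> skorokhod_ball x T \<epsilon>"
  then obtain l d where l: "time_change l" "d < \<epsilon>" "\<And>t. t \<ge> 0 \<Longrightarrow> \<bar>l t - t\<bar> \<le> d"
      "\<And>t. t \<in> {0..T} \<Longrightarrow> \<bar>y (l t) - x t\<bar> \<le> d"
    by (auto simp: skorokhod_ball_def)
  have "skorokhod_ball y (T + d) (\<epsilon> - d) \<subseteq> skorokhod_ball x T \<epsilon>"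
  proof
    fix z assume "z \<in> skorokhod_ball y (T + d) (\<epsilon> - d)"
    then obtain m e where m: "z \<in> cadlag" "time_change m" "e < \<epsilon> - d" "\<And>t. t \<ge> 0 \<Longrightarrow> \<bar>m t - t\<bar> \<le> e"
        "\<And>t. t \<in> {0..T+d} \<Longrightarrow> \<bar>z (m t) - y t\<bar> \<le> e"
      by (auto simp: skorokhod_ball_def)
    have 1: "\<bar>m (l t) - t\<bar> \<le> d + e" if "t \<ge> 0" for t
      using l(3)[OF that] m(4)[OF time_change_nonneg[OF l(1) that]] by linarith
    have 2: "\<bar>z (m (l t)) - x t\<bar> \<le> d + e" if "t \<in> {0..T}" for t
    proof -
      have "l t \<in> {0..T+d}"
        using l(3)[of t] that time_change_nonneg[OF l(1), of t] by (auto simp: abs_le_iff)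
      from m(5)[OF this] l(4)[OF that] show ?thesis by linarith
    qed
    show "z \<in> skorokhod_ball x T \<epsilon>"
      unfolding skorokhod_ball_def
      using m(1,3) 1 2 time_change_comp[OF l(1) m(2)]
      by (intro CollectI conjI exI[of _ "\<lambda>t. m (l t)"] exI[of _ "d + e"]) auto
  qed
  then show "\<exists>T' \<epsilon>'. \<epsilon>' > 0 \<and> skorokhod_ball y T' \<epsilon>' \<subseteq> skorokhod_ball x T \<epsilon>"
    using l(2) by (intro exI[of _ "T + d"] exI[of _ "\<epsilon> - d"]) auto
qed

lemma limitin_skorokhod_ball:
  "limitin skorokhod xs x F \<longleftrightarrow>
     x \<in> cadlag \<and> (\<forall>T. \<forall>\<epsilon>>0. \<forall>\<^sub>F n in F. xs n \<in> skorokhod_ball x T \<epsilon>)"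
  (is "?L \<longleftrightarrow> ?R")
proof
  assume L: ?L
  then have "x \<in> cadlag" by (metis limitin_topspace topspace_skorokhod)
  moreover have "\<forall>\<^sub>F n in F. xs n \<in> skorokhod_ball x T \<epsilon>" if "\<epsilon> > 0" for T \<epsilon>
    using L openin_skorokhod_ball[of x T \<epsilon>] skorokhod_ball_self[OF \<open>x \<in> cadlag\<close> that, of T]
    by (simp add: limitin_def)
  ultimately show ?R by simp
next
  assume R: ?R
  show ?L
    unfolding limitin_def
  proof (intro conjI allI impI)
    show "x \<in> topspace skorokhod" using R by simp
    fix U assume "openin skorokhod U \<and> x \<in> U"
    then obtain T e where "e > 0" "skorokhod_ball x T e \<subseteq> U"
      by (metis openin_skorokhod)
    then show "\<forall>\<^sub>F n in F. xs n \<in> U"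
      using R by (metis (mono_tags, lifting) eventually_mono subsetD)
  qed
qed

lemma limitin_skorokhod_iff:
  "limitin skorokhod xs x sequentially \<longleftrightarrow>
     x \<in> cadlag \<and> (\<forall>\<^sub>F n in sequentially. xs n \<in> cadlag) \<and>
     (\<exists>\<phi>. (\<forall>n. time_change (\<phi> n)) \<and>
        uniform_limit {0..} \<phi> (\<lambda>t. t) sequentially \<and>
        (\<forall>T. uniform_limit {0..T} (\<lambda>n t. xs n (\<phi> n t)) x sequentially))"
  (is "?L \<longleftrightarrow> ?R")
proof
  assume ?R
  then obtain l where x: "x \<in> cadlag" and c: "\<forall>\<^sub>F n in sequentially. xs n \<in> cadlag"
    and l: "\<And>n. time_change (l n)" "uniform_limit {0..} l (\<lambda>t. t) sequentially"
      "\<And>T. uniform_limit {0..T} (\<lambda>n t. xs n (l n t)) x sequentially"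
    by blast
  show ?L
    unfolding limitin_skorokhod_ball
  proof (intro conjI allI impI x)
    fix T e :: real assume "e > 0"
    then have "e / 2 > 0" by simp
    from c uniform_limitD[OF l(2) this] uniform_limitD[OF l(3)[of T] this]
    show "\<forall>\<^sub>F n in sequentially. xs n \<in> skorokhod_ball x T e"
    proof eventually_elim
      case (elim n)
      then show ?case
        using l(1)[of n] \<open>e > 0\<close> unfolding skorokhod_ball_def
        by (intro CollectI conjI exI[of _ "l n"] exI[of _ "e / 2"])
           (auto simp: dist_real_def intro: less_imp_le)
    qed
  qed
next
  assume L: ?L
  define B where "B k = skorokhod_ball x (real k) (1 / (real k + 1))" for k
  have x: "x \<in> cadlag" and ev: "\<forall>\<^sub>F n in sequentially. xs n \<in> B k" for k
    using L by (auto simp: limitin_skorokhod_ball B_def)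
  have B_mono: "B j \<subseteq> B i" if "i \<le> j" for i j
    unfolding B_def using that by (intro skorokhod_ball_mono) (auto simp: field_simps)
  define k where "k n = Max {i. i \<le> n \<and> (i = 0 \<or> xs n \<in> B i)}" for n
  have k_mem: "k n \<in> {i. i \<le> n \<and> (i = 0 \<or> xs n \<in> B i)}" for n
    unfolding k_def by (rule Max_in) (auto intro: exI[of _ 0])
  have k_ge: "i \<le> k n" if "i \<le> n" "xs n \<in> B i" for i n
    unfolding k_def by (rule Max_ge) (use that in auto)
  have ex: "\<exists>l. time_change l \<and> (xs n \<in> B 0 \<longrightarrow>
      (\<forall>t\<ge>0. \<bar>l t - t\<bar> < 1 / (real (k n) + 1)) \<and>
      (\<forall>t\<in>{0..real (k n)}. \<bar>xs n (l t) - x t\<bar> < 1 / (real (k n) + 1)))" for n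
  proof (cases "xs n \<in> B 0")
    case True
    then have "xs n \<in> B (k n)" using k_mem[of n] by auto
    then obtain l d where "time_change l" "d < 1 / (real (k n) + 1)"
        "\<forall>t\<ge>0. \<bar>l t - t\<bar> \<le> d" "\<forall>t\<in>{0..real (k n)}. \<bar>xs n (l t) - x t\<bar> \<le> d"
      unfolding B_def skorokhod_ball_def by blast
    then show ?thesis by (intro exI[of _ l]) force
  qed (use time_change_id in auto)
  then obtain l where l: "\<And>n. time_change (l n)"
      "\<And>n t. xs n \<in> B 0 \<Longrightarrow> t \<ge> 0 \<Longrightarrow> \<bar>l n t - t\<bar> < 1 / (real (k n) + 1)"
      "\<And>n t. xs n \<in> B 0 \<Longrightarrow> t \<in> {0..real (k n)} \<Longrightarrow> \<bar>xs n (l n t) - x t\<bar> < 1 / (real (k n) + 1)"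
    by metis
  have k_ev: "\<forall>\<^sub>F n in sequentially. xs n \<in> B 0 \<and> i \<le> k n" for i
    using ev[of i] eventually_ge_at_top[of i]
    by eventually_elim (use k_ge B_mono[of 0 i] in auto)
  have small: "1 / (real j + 1) < e" if "i \<le> j" "1 / (real i + 1) < e" for i j and e :: real
  proof -
    have "1 / (real j + 1) \<le> 1 / (real i + 1)" using that(1) by (simp add: field_simps)
    then show ?thesis using that(2) by linarith
  qed
  have arch: "\<exists>i::nat. 1 / (real i + 1) < e \<and> T \<le> real i" if "e > 0" for e T :: real
  proof -
    obtain i :: nat where i: "max (1 / e) T \<le> real i" using real_arch_simple by blast
    then have "1 / e < real i + 1" by simp
    then have "1 / (real i + 1) < e" using that by (simp add: field_simps)
    then show ?thesis using i by auto
  qed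
  have 1: "uniform_limit {0..} l (\<lambda>t. t) sequentially"
  proof (rule uniform_limitI)
    fix e :: real assume "e > 0"
    then obtain i :: nat where i: "1 / (real i + 1) < e" using arch by blast
    show "\<forall>\<^sub>F n in sequentially. \<forall>t\<in>{0..}. dist (l n t) t < e"
      using k_ev[of i]
    proof eventually_elim
      case (elim n)
      then show ?case using l(2)[of n] small[OF _ i, of "k n"] by (force simp: dist_real_def)
    qed
  qed
  have 2: "uniform_limit {0..T} (\<lambda>n t. xs n (l n t)) x sequentially" for T
  proof (rule uniform_limitI)
    fix e :: real assume "e > 0"
    then obtain i :: nat where i: "1 / (real i + 1) < e" "T \<le> real i" using arch by blast
    show "\<forall>\<^sub>F n in sequentially. \<forall>t\<in>{0..T}. dist (xs n (l n t)) (x t) < e"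
      using k_ev[of i]
    proof eventually_elim
      case (elim n)
      then have "T \<le> real (k n)" using i(2) by linarith
      then show ?case using elim l(3)[of n] small[OF _ i(1), of "k n"] by (force simp: dist_real_def)
    qed
  qed
  have "\<forall>\<^sub>F n in sequentially. xs n \<in> cadlag"
    using ev[of 0] by eventually_elim (auto simp: B_def skorokhod_ball_def)
  then show ?R using x l(1) 1 2 by blast
qed


section \<open>Brownian motion and the normal law\<close>

definition standard_brownian_motion :: "'b measure \<Rightarrow> (real \<Rightarrow> 'b \<Rightarrow> real) \<Rightarrow> bool" where
  "standard_brownian_motion Q W \<longleftrightarrow>
     prob_space Q \<and>
     (\<forall>t\<ge>0. W t \<in> borel_measurable Q) \<and>
     (\<forall>\<omega>\<in>space Q. W 0 \<omega> = 0 \<and> continuous_on {0..} (\<lambda>t. W t \<omega>)) \<and>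
     (\<forall>s t. 0 \<le> s \<and> s < t \<longrightarrow>
        distributed Q lborel (\<lambda>\<omega>. W t \<omega> - W s \<omega>) (normal_density 0 (sqrt (t - s)))) \<and>
     (\<forall>(n::nat) \<tau>. 0 \<le> \<tau> 0 \<and> (\<forall>k<n. \<tau> k < \<tau> (Suc k)) \<longrightarrow>
        prob_space.indep_vars Q (\<lambda>_. borel) (\<lambda>k \<omega>. W (\<tau> (Suc k)) \<omega> - W (\<tau> k) \<omega>) {..<n})"

text \<open>The second parameter is the variance, and variance 0 gives the point mass.\<close>

definition normal_law :: "real \<Rightarrow> real \<Rightarrow> real measure" where
  "normal_law \<mu> s = (if s = 0 then return borel \<mu> else density lborel (normal_density \<mu> (sqrt s)))"


section \<open>The chain\<close>

definition markov_chain :: "'a measure \<Rightarrow> (nat \<Rightarrow> 'a \<Rightarrow> 's) \<Rightarrow> ('s \<Rightarrow> 's \<Rightarrow> real) \<Rightarrow> bool" where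
  "markov_chain P S p \<longleftrightarrow>
     prob_space P \<and>
     (\<forall>n. S n \<in> measurable P (count_space UNIV)) \<and>
     (\<forall>n s j. \<P>(\<omega> in P. \<forall>k\<le>n. S k \<omega> = s k) > 0 \<longrightarrow>
        \<P>(\<omega> in P. S (Suc n) \<omega> = j \<bar> \<forall>k\<le>n. S k \<omega> = s k) = p (s n) j)"

datatype sign = Plus | Minus

fun transition :: "real \<Rightarrow> real \<Rightarrow> real \<Rightarrow> int \<times> sign \<Rightarrow> int \<times> sign \<Rightarrow> real" where
  "transition A B C (i, Plus) (j, Plus) = (if j = i + 1 then A else if j = i - 1 then B else 0)"
| "transition A B C (i, Minus) (j, Minus) = (if j = i - 1 then A else if j = i + 1 then B else 0)"
| "transition A B C (i, Plus) (j, Minus) = (if j = i then C else 0)"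
| "transition A B C (i, Minus) (j, Plus) = (if j = i then C else 0)"

definition rescaled :: "(nat \<Rightarrow> 'a \<Rightarrow> int) \<Rightarrow> real \<Rightarrow> real \<Rightarrow> 'a \<Rightarrow> real" where
  "rescaled X M t \<omega> = real_of_int (X (nat \<lfloor>M * t\<rfloor>) \<omega>) / sqrt M"

end

theory Submission
  imports Defs
begin

text \<open>
  Write \<open>\<epsilon>\<^sub>n = \<plusminus>1\<close> for the sign \<open>Y\<^sub>n\<close> and \<open>a = (A - B) / (2 C)\<close>. Then \<open>X\<^sub>n + a \<epsilon>\<^sub>n\<close> is a martingale with
  bounded increments, and the conditional variance of each increment is exactly \<open>v\<close>. It stays within
  bounded distance of \<open>X\<^sub>n\<close>, so it suffices to prove the invariance principle for such martingales.

  Finite-dimensional distributions: conditionally on any atom of the past, the characteristic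
  function of a block increment is close to a Gaussian one, with an error that does not depend on the
  atom. Hence bounded Lipschitz functions of the block increments converge, one block after the other.
  A fourth moment bound and a maximal inequality control the oscillation inside the blocks.

  Since the limit has continuous paths and \<open>J\<^sub>1\<close>-continuous functionals are continuous for the
  locally uniform topology, neither Prokhorov's theorem nor a Skorokhod metric is needed: a
  bounded continuous functional \<open>f\<close> is the increasing limit of the functionals
  \<open>x \<mapsto> inf\<^sub>y (f y + n sup\<^bsub>t \<le> n\<^esub> \<bar>x t - y t\<bar>)\<close>, which are Lipschitz for the uniform distance on \<open>[0, n]\<close>.
\<close>

section \<open>The locally uniform topology on cadlag paths\<close>

text \<open>Given the sign \<epsilon>, the mean step of the walk is (A - B) \<epsilon> and the mean
  change of the sign is - 2 C \<epsilon>, so a has to solve A - B = 2 C a. The increments of X + a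
  \<epsilon> are then \<epsilon>, - \<epsilon> and - 2 a \<epsilon> with probabilities A, B and C,
  and their second moment A + B + 4 a^2 C equals v in either sign state. This is why the Gaussian
  factor of a block is the same on every atom of the past. The law of the initial state is
  arbitrary: the distance between the walk and the sum of the martingale increments is bounded in
  time, but only by the random quantity |X 0| + 2 |a|, which becomes small in probability after
  scaling. For A = B = 0 the variance v is 0, so the Gaussian laws have to include the point
  mass.\<close>

definition unif_close :: "real \<Rightarrow> real \<Rightarrow> (real \<Rightarrow> real) \<Rightarrow> (real \<Rightarrow> real) \<Rightarrow> bool" where
  "unif_close T \<delta> x y \<longleftrightarrow> (\<forall>t\<in>{0..T}. \<bar>x t - y t\<bar> \<le> \<delta>)"

definition locally_uniformly_open :: "(real \<Rightarrow> real) set \<Rightarrow> bool" where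
  "locally_uniformly_open U \<longleftrightarrow>
     U \<subseteq> cadlag \<and> (\<forall>x\<in>U. \<exists>T \<delta>. \<delta> > 0 \<and> (\<forall>y\<in>cadlag. unif_close T \<delta> x y \<longrightarrow> y \<in> U))"

definition locally_uniformly_continuous :: "((real \<Rightarrow> real) \<Rightarrow> real) \<Rightarrow> bool" where
  "locally_uniformly_continuous f \<longleftrightarrow>
     (\<forall>x\<in>cadlag. \<forall>e>0. \<exists>T \<delta>. \<delta> > 0 \<and> (\<forall>y\<in>cadlag. unif_close T \<delta> x y \<longrightarrow> \<bar>f x - f y\<bar> < e))"

lemma unif_close_refl: "0 \<le> \<delta> \<Longrightarrow> unif_close T \<delta> x x"
  by (simp add: unif_close_def)

lemma unif_close_sym: "unif_close T \<delta> x y \<Longrightarrow> unif_close T \<delta> y x"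
  by (auto simp: unif_close_def abs_minus_commute)

lemma unif_close_trans:
  assumes "unif_close T \<delta> x y" "unif_close T \<epsilon> y z"
  shows "unif_close T (\<delta> + \<epsilon>) x z"
  unfolding unif_close_def
proof
  fix t assume "t \<in> {0..T}"
  then have "\<bar>x t - y t\<bar> \<le> \<delta>" "\<bar>y t - z t\<bar> \<le> \<epsilon>"
    using assms by (auto simp: unif_close_def)
  then show "\<bar>x t - z t\<bar> \<le> \<delta> + \<epsilon>" by linarith
qed

lemma unif_close_mono:
  "unif_close T \<delta> x y \<Longrightarrow> S \<le> T \<Longrightarrow> \<delta> \<le> \<epsilon> \<Longrightarrow> unif_close S \<epsilon> x y"
  by (force simp: unif_close_def)

text \<open>The identity is a time change, so a path uniformly close to x on [0, T] lies in the
  Skorokhod ball around x. Through this lemma, results on locally uniformly open sets and continuous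
  functionals carry over to \<open>skorokhod\<close>.\<close>

lemma openin_skorokhod_imp_locally_uniformly_open:
  assumes "openin skorokhod U"
  shows "locally_uniformly_open U"
  unfolding locally_uniformly_open_def
proof (intro conjI ballI)
  show "U \<subseteq> cadlag" using assms by (simp add: openin_skorokhod)
  fix x assume "x \<in> U"
  then obtain T e where Te: "e > 0" "skorokhod_ball x T e \<subseteq> U"
    using assms by (meson openin_skorokhod)
  have "y \<in> U" if "y \<in> cadlag" "unif_close T (e/2) x y" for y
  proof -
    have "y \<in> skorokhod_ball x T e"
      unfolding skorokhod_ball_def using that Te(1) time_change_id
      by (intro CollectI conjI exI[of _ "\<lambda>t. t"] exI[of _ "e/2"])
         (auto simp: unif_close_def abs_minus_commute)
    with Te show ?thesis by auto
  qed
  with Te(1) show "\<exists>T \<delta>. \<delta> > 0 \<and> (\<forall>y\<in>cadlag. unif_close T \<delta> x y \<longrightarrow> y \<in> U)"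
    by (intro exI[of _ T] exI[of _ "e/2"]) auto
qed

lemma continuous_map_skorokhod_imp_locally_uniformly_continuous:
  assumes "continuous_map skorokhod euclideanreal f"
  shows "locally_uniformly_continuous f"
  unfolding locally_uniformly_continuous_def
proof (intro ballI allI impI)
  fix x e assume x: "x \<in> cadlag" and e: "(e::real) > 0"
  have "openin skorokhod {y \<in> topspace skorokhod. f y \<in> ball (f x) e}"
    using assms by (rule openin_continuous_map_preimage) simp
  then have "locally_uniformly_open {y \<in> cadlag. f y \<in> ball (f x) e}"
    by (simp add: openin_skorokhod_imp_locally_uniformly_open)
  with x e show "\<exists>T \<delta>. \<delta> > 0 \<and> (\<forall>y\<in>cadlag. unif_close T \<delta> x y \<longrightarrow> \<bar>f x - f y\<bar> < e)"
    by (auto simp: locally_uniformly_open_def dist_real_def)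
qed

lemma locally_uniformly_open_superlevel:
  assumes "locally_uniformly_continuous f"
  shows "locally_uniformly_open {x \<in> cadlag. a < f x}"
  unfolding locally_uniformly_open_def
proof (intro conjI ballI)
  fix x assume x: "x \<in> {x \<in> cadlag. a < f x}"
  then obtain T \<delta> where *: "\<delta> > 0" "\<And>y. y \<in> cadlag \<Longrightarrow> unif_close T \<delta> x y \<Longrightarrow> \<bar>f x - f y\<bar> < f x - a"
    using assms unfolding locally_uniformly_continuous_def
    by (metis (mono_tags, lifting) diff_gt_0_iff_gt mem_Collect_eq)
  have "y \<in> {x \<in> cadlag. a < f x}" if "y \<in> cadlag" "unif_close T \<delta> x y" for y
    using *(2)[OF that] that(1) by (auto simp: abs_less_iff)
  with *(1) show "\<exists>T \<delta>. \<delta> > 0 \<and> (\<forall>y\<in>cadlag. unif_close T \<delta> x y \<longrightarrow> y \<in> {x \<in> cadlag. a < f x})"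
    by blast
qed auto

text \<open>The infimal convolution of f with n times the uniform distance on [0, n]. A radius r
  bounding the distance replaces the supremum, so a path y at infinite distance simply contributes
  nothing to the infimum.\<close>

definition lip_approx :: "((real \<Rightarrow> real) \<Rightarrow> real) \<Rightarrow> nat \<Rightarrow> (real \<Rightarrow> real) \<Rightarrow> real" where
  "lip_approx f n x = Inf {f y + real n * r |y r. y \<in> cadlag \<and> 0 \<le> r \<and> unif_close (real n) r x y}"

context
  fixes f :: "(real \<Rightarrow> real) \<Rightarrow> real"
  assumes f_nonneg: "\<And>x. x \<in> cadlag \<Longrightarrow> 0 \<le> f x"
begin

lemma lip_approx_bdd:
  "bdd_below {f y + real n * r |y r. y \<in> cadlag \<and> 0 \<le> r \<and> unif_close (real n) r x y}"
  by (rule bdd_belowI[of _ 0]) (use f_nonneg in fastforce)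

lemma lip_approx_lower:
  "y \<in> cadlag \<Longrightarrow> 0 \<le> r \<Longrightarrow> unif_close (real n) r x y \<Longrightarrow> lip_approx f n x \<le> f y + real n * r"
  unfolding lip_approx_def by (rule cInf_lower[OF _ lip_approx_bdd]) auto

lemma lip_approx_greatest:
  assumes "x \<in> cadlag"
    and "\<And>y r. y \<in> cadlag \<Longrightarrow> 0 \<le> r \<Longrightarrow> unif_close (real n) r x y \<Longrightarrow> a \<le> f y + real n * r"
  shows "a \<le> lip_approx f n x"
  unfolding lip_approx_def
proof (rule cInf_greatest)
  show "{f y + real n * r |y r. y \<in> cadlag \<and> 0 \<le> r \<and> unif_close (real n) r x y} \<noteq> {}"
    using assms(1) unif_close_refl[of 0 "real n" x] by blast
qed (use assms(2) in auto)

lemma lip_approx_le: "x \<in> cadlag \<Longrightarrow> lip_approx f n x \<le> f x"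
  using lip_approx_lower[of x 0 n x] by (simp add: unif_close_refl)

lemma lip_approx_nonneg: "x \<in> cadlag \<Longrightarrow> 0 \<le> lip_approx f n x"
  by (rule lip_approx_greatest) (use f_nonneg in auto)

text \<open>By the triangle inequality, a competitor (y, r) for x' yields the competitor (y,
  \<delta> + r) for x.\<close>

lemma lip_approx_lipschitz_le:
  assumes "x \<in> cadlag" "x' \<in> cadlag" "0 \<le> \<delta>" "unif_close (real n) \<delta> x x'"
  shows "lip_approx f n x \<le> lip_approx f n x' + real n * \<delta>"
proof -
  have "lip_approx f n x - real n * \<delta> \<le> lip_approx f n x'"
  proof (rule lip_approx_greatest[OF assms(2)])
    fix y r assume y: "y \<in> cadlag" "0 \<le> r" "unif_close (real n) r x' y"
    have "lip_approx f n x \<le> f y + real n * (\<delta> + r)"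
      by (rule lip_approx_lower) (use y assms unif_close_trans in auto)
    then show "lip_approx f n x - real n * \<delta> \<le> f y + real n * r"
      by (simp add: algebra_simps)
  qed
  then show ?thesis by simp
qed

lemma lip_approx_lipschitz:
  assumes "x \<in> cadlag" "x' \<in> cadlag" "0 \<le> \<delta>" "unif_close (real n) \<delta> x x'"
  shows "\<bar>lip_approx f n x - lip_approx f n x'\<bar> \<le> real n * \<delta>"
  using lip_approx_lipschitz_le[OF assms]
    lip_approx_lipschitz_le[OF assms(2,1,3) unif_close_sym[OF assms(4)]]
  by linarith

lemma lip_approx_locally_uniformly_continuous: "locally_uniformly_continuous (lip_approx f n)"
  unfolding locally_uniformly_continuous_def
proof (intro ballI allI impI)
  fix x e assume x: "x \<in> cadlag" and e: "(e::real) > 0"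
  let ?d = "e / (2 * (real n + 1))"
  have d: "?d > 0" "real n * ?d < e"
  proof -
    show "?d > 0" using e by simp
    have "real n * ?d = e * (real n / (2 * (real n + 1)))" by simp
    also have "\<dots> < e * 1" using e by (intro mult_strict_left_mono) (auto simp: field_simps)
    finally show "real n * ?d < e" by simp
  qed
  show "\<exists>T \<delta>. \<delta> > 0 \<and> (\<forall>y\<in>cadlag. unif_close T \<delta> x y \<longrightarrow> \<bar>lip_approx f n x - lip_approx f n y\<bar> < e)"
  proof (rule exI[of _ "real n"], rule exI[of _ ?d], intro conjI ballI impI)
    fix y assume "y \<in> cadlag" "unif_close (real n) ?d x y"
    then have "\<bar>lip_approx f n x - lip_approx f n y\<bar> \<le> real n * ?d"
      using x d by (intro lip_approx_lipschitz) auto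
    with d show "\<bar>lip_approx f n x - lip_approx f n y\<bar> < e" by linarith
  qed (use d in auto)
qed

text \<open>Competitors within radius \<delta> are controlled by the continuity of f at x. For the
  others f y is at least 0 and the penalty n r alone already reaches f x.\<close>

lemma lip_approx_tendsto:
  assumes "locally_uniformly_continuous f" "x \<in> cadlag"
  shows "(\<lambda>n. lip_approx f n x) \<longlonglongrightarrow> f x"
proof (rule LIMSEQ_I)
  fix e :: real assume "e > 0"
  then have "e / 2 > 0" by simp
  then obtain T \<delta> where *: "\<delta> > 0"
    "\<And>y. y \<in> cadlag \<Longrightarrow> unif_close T \<delta> x y \<Longrightarrow> \<bar>f x - f y\<bar> < e/2"
    using assms unfolding locally_uniformly_continuous_def by metis
  \<comment> \<open>Beyond T, closeness on [0, n] implies closeness on [0, T]; beyond f x /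
    \<delta>, the penalty n \<delta> is at least f x.\<close>
  obtain n0 :: nat where n0: "max T (f x / \<delta>) \<le> real n0" using real_arch_simple by blast
  have "norm (lip_approx f n x - f x) < e" if n: "n0 \<le> n" for n
  proof -
    have "f x - e/2 \<le> lip_approx f n x"
    proof (rule lip_approx_greatest[OF assms(2)])
      fix y r assume y: "y \<in> cadlag" "0 \<le> r" "unif_close (real n) r x y"
      show "f x - e/2 \<le> f y + real n * r"
      proof (cases "r \<le> \<delta>")
        case True
        then have "unif_close T \<delta> x y" using y(3) n n0 by (auto elim!: unif_close_mono)
        with *(2)[OF y(1)] have "f x - e/2 \<le> f y" by linarith
        then show ?thesis using y(2) by (smt (verit) mult_nonneg_nonneg of_nat_0_le_iff)
      next
        case False
        have "f x / \<delta> \<le> real n" using n n0 by simp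
        then have "f x \<le> real n * \<delta>" using *(1) by (simp add: field_simps)
        also have "\<dots> \<le> real n * r" using False by (intro mult_left_mono) auto
        finally show ?thesis using f_nonneg[OF y(1)] \<open>e > 0\<close> by linarith
      qed
    qed
    with lip_approx_le[OF assms(2), of n] \<open>e > 0\<close> show ?thesis by auto
  qed
  then show "\<exists>no. \<forall>n\<ge>no. norm (lip_approx f n x - f x) < e" by blast
qed

end

section \<open>Step paths, continuous paths and the measurability of their preimages\<close>

definition step_path :: "real \<Rightarrow> (nat \<Rightarrow> real) \<Rightarrow> real \<Rightarrow> real" where
  "step_path \<kappa> c = (\<lambda>t\<in>{0..}. c (nat \<lfloor>\<kappa> * t\<rfloor>))"

lemma step_path_eq: "0 \<le> t \<Longrightarrow> step_path \<kappa> c t = c (nat \<lfloor>\<kappa> * t\<rfloor>)"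
  by (simp add: step_path_def)

lemma step_path_cadlag:
  assumes "\<kappa> > 0"
  shows "step_path \<kappa> c \<in> cadlag"
  unfolding cadlag_def
proof (intro CollectI conjI allI impI)
  show "step_path \<kappa> c \<in> extensional {0..}" by (simp add: step_path_def)
next
  fix t :: real assume t: "t \<ge> 0"
  have "t < (of_int \<lfloor>\<kappa> * t\<rfloor> + 1) / \<kappa>"
    using assms by (simp add: field_simps) linarith
  then have "\<forall>\<^sub>F s in at_right t. step_path \<kappa> c s = step_path \<kappa> c t"
    unfolding eventually_at_right_field
  proof (intro exI[of _ "(of_int \<lfloor>\<kappa> * t\<rfloor> + 1) / \<kappa>"] conjI allI impI)
    fix s assume s: "t < s" "s < (of_int \<lfloor>\<kappa> * t\<rfloor> + 1) / \<kappa>"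
    have "\<kappa> * t \<le> \<kappa> * s" using s assms by simp
    moreover have "\<kappa> * s < of_int \<lfloor>\<kappa> * t\<rfloor> + 1" using s assms by (simp add: field_simps)
    ultimately have "\<lfloor>\<kappa> * s\<rfloor> = \<lfloor>\<kappa> * t\<rfloor>" by linarith
    then show "step_path \<kappa> c s = step_path \<kappa> c t" using s t by (simp add: step_path_eq)
  qed
  then show "(step_path \<kappa> c \<longlongrightarrow> step_path \<kappa> c t) (at_right t)"
    by (rule tendsto_eventually)
next
  fix t :: real assume t: "t > 0"
  \<comment> \<open>If \<kappa> * t is an integer, t is a jump time and the left limit carries the
    preceding index; the ceiling covers this case together with the others.\<close>
  let ?k = "\<lceil>\<kappa> * t\<rceil> - 1"
  have k: "of_int ?k / \<kappa> < t" using assms by (simp add: field_simps) linarith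
  have "\<forall>\<^sub>F s in at_left t. step_path \<kappa> c s = c (nat ?k)"
    unfolding eventually_at_left_field
  proof (intro exI[of _ "max 0 (of_int ?k / \<kappa>)"] conjI allI impI)
    show "max 0 (of_int ?k / \<kappa>) < t" using k t by simp
    fix s assume s: "max 0 (of_int ?k / \<kappa>) < s" "s < t"
    have "\<kappa> * s < \<kappa> * t" using s assms by simp
    moreover have "of_int ?k < \<kappa> * s" using s assms by (simp add: field_simps)
    ultimately have "\<lfloor>\<kappa> * s\<rfloor> = ?k" by linarith
    then show "step_path \<kappa> c s = c (nat ?k)" using s by (simp add: step_path_eq)
  qed
  then show "\<exists>l. (step_path \<kappa> c \<longlongrightarrow> l) (at_left t)"
    using tendsto_eventually by blast
qed

lemma continuous_path_cadlag:
  assumes "continuous_on {0..} w"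
  shows "(\<lambda>t\<in>{0..}. w t) \<in> cadlag"
  unfolding cadlag_def
proof (intro CollectI conjI allI impI)
  fix t :: real assume t: "t \<ge> 0"
  have "(w \<longlongrightarrow> w t) (at t within {0..})"
    using assms t by (auto simp: continuous_on_def)
  then have "(w \<longlongrightarrow> w t) (at_right t)"
    by (rule tendsto_within_subset) (use t in auto)
  moreover have "\<forall>\<^sub>F s in at_right t. w s = (\<lambda>t\<in>{0..}. w t) s"
    unfolding eventually_at_right_field using t by (auto intro!: exI[of _ "t+1"])
  ultimately show "((\<lambda>t\<in>{0..}. w t) \<longlongrightarrow> (\<lambda>t\<in>{0..}. w t) t) (at_right t)"
    using t by (auto intro: Lim_transform_eventually)
next
  fix t :: real assume t: "t > 0"
  have "(w \<longlongrightarrow> w t) (at t within {0..})"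
    using assms t by (auto simp: continuous_on_def)
  then have "(w \<longlongrightarrow> w t) (at t within {0..<t})"
    by (rule tendsto_within_subset) auto
  then have "(w \<longlongrightarrow> w t) (at_left t)"
    using at_within_nhd[of t "{0<..}" "{0..<t}" "{..<t}"] t by fastforce
  moreover have "\<forall>\<^sub>F s in at_left t. w s = (\<lambda>t\<in>{0..}. w t) s"
    unfolding eventually_at_left_field using t by (auto intro!: exI[of _ 0])
  ultimately have "((\<lambda>t\<in>{0..}. w t) \<longlongrightarrow> w t) (at_left t)"
    by (rule Lim_transform_eventually)
  then show "\<exists>l. ((\<lambda>t\<in>{0..}. w t) \<longlongrightarrow> l) (at_left t)" ..
qed auto

text \<open>Membership in U is already decided by finitely many coordinates: a neighbourhood of the
  path inside U contains every step path that agrees with it up to the horizon T. So the preimage is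
  a union of cylinder events, and there are only countably many cylinders because X takes values in
  a countable type.\<close>

lemma measurable_step_path_preimage:
  fixes X :: "nat \<Rightarrow> 'a \<Rightarrow> 'b::countable"
  assumes X: "\<And>n. X n \<in> measurable P (count_space UNIV)" and "\<kappa> > 0"
    and U: "locally_uniformly_open U"
  shows "{\<omega> \<in> space P. step_path \<kappa> (\<lambda>n. c (X n \<omega>)) \<in> U} \<in> sets P"
proof -
  define cyl where "cyl s = {\<omega> \<in> space P. \<forall>n<length s. X n \<omega> = s ! n}" for s :: "'b list"
  define G where "G = {s. \<forall>\<omega>\<in>cyl s. step_path \<kappa> (\<lambda>n. c (X n \<omega>)) \<in> U}"
  have "cyl s \<in> sets P" for s
  proof -
    have "{\<omega> \<in> space P. X n \<omega> = s ! n} \<in> sets P" for n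
      using measurable_sets[OF X, of "{s ! n}" n] by (simp add: vimage_def Int_def conj_commute)
    then have "{\<omega> \<in> space P. \<forall>n\<in>{..<length s}. X n \<omega> = s ! n} \<in> sets P"
      by (intro sets.sets_Collect_finite_All) auto
    then show ?thesis unfolding cyl_def by (simp only: Ball_def lessThan_iff)
  qed
  then have "(\<Union>s\<in>G. cyl s) \<in> sets P"
    by (intro sets.countable_UN''[OF countableI_type])
  moreover have "(\<Union>s\<in>G. cyl s) = {\<omega> \<in> space P. step_path \<kappa> (\<lambda>n. c (X n \<omega>)) \<in> U}"
  proof (intro equalityI subsetI)
    fix \<omega> assume \<omega>: "\<omega> \<in> {\<omega> \<in> space P. step_path \<kappa> (\<lambda>n. c (X n \<omega>)) \<in> U}"
    then obtain T \<delta> where *: "\<delta> > 0"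
      "\<And>y. y \<in> cadlag \<Longrightarrow> unif_close T \<delta> (step_path \<kappa> (\<lambda>n. c (X n \<omega>))) y \<Longrightarrow> y \<in> U"
      using U unfolding locally_uniformly_open_def by blast
    \<comment> \<open>The index of the cell containing T is still seen at t = T, hence the
      successor.\<close>
    define m where "m = Suc (nat \<lfloor>\<kappa> * T\<rfloor>)"
    define s where "s = map (\<lambda>n. X n \<omega>) [0..<m]"
    have "s \<in> G"
      unfolding G_def
    proof (intro CollectI ballI)
      fix \<omega>' assume \<omega>': "\<omega>' \<in> cyl s"
      have "unif_close T \<delta> (step_path \<kappa> (\<lambda>n. c (X n \<omega>))) (step_path \<kappa> (\<lambda>n. c (X n \<omega>')))"
        unfolding unif_close_def
      proof
        fix t assume t: "t \<in> {0..T}"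
        have "\<kappa> * t \<le> \<kappa> * T" using t \<open>\<kappa> > 0\<close> by simp
        then have "nat \<lfloor>\<kappa> * t\<rfloor> < m" unfolding m_def by (meson floor_mono le_imp_less_Suc nat_mono)
        then have "X (nat \<lfloor>\<kappa> * t\<rfloor>) \<omega>' = X (nat \<lfloor>\<kappa> * t\<rfloor>) \<omega>"
          using \<omega>' by (auto simp: cyl_def s_def)
        then show "\<bar>step_path \<kappa> (\<lambda>n. c (X n \<omega>)) t - step_path \<kappa> (\<lambda>n. c (X n \<omega>')) t\<bar> \<le> \<delta>"
          using t *(1) by (simp add: step_path_eq)
      qed
      then show "step_path \<kappa> (\<lambda>n. c (X n \<omega>')) \<in> U"
        using *(2) step_path_cadlag[OF \<open>\<kappa> > 0\<close>] by blast
    qed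
    moreover have "\<omega> \<in> cyl s" using \<omega> by (auto simp: cyl_def s_def)
    ultimately show "\<omega> \<in> (\<Union>s\<in>G. cyl s)" by blast
  qed (auto simp: G_def cyl_def)
  ultimately show ?thesis by simp
qed

text \<open>
  The locally uniform topology on continuous paths is second countable: step paths with rational
  values and rational mesh serve as centres of a countable base, so no separability of the whole
  path space is needed.
\<close>
lemma measurable_continuous_path_preimage:
  assumes W: "\<And>t. t \<ge> 0 \<Longrightarrow> W t \<in> borel_measurable Q"
    and cont: "\<And>\<omega>. \<omega> \<in> space Q \<Longrightarrow> continuous_on {0..} (\<lambda>t. W t \<omega>)"
    and U: "locally_uniformly_open U"
  shows "{\<omega> \<in> space Q. (\<lambda>t\<in>{0..}. W t \<omega>) \<in> U} \<in> sets Q"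
proof -
  define B :: "nat \<times> nat \<times> nat \<times> rat list \<Rightarrow> 'a set" where
    "B = (\<lambda>(k, T, j, s). {\<omega> \<in> space Q. \<forall>t\<in>{0..real T}.
        \<bar>W t \<omega> - of_rat (s ! nat \<lfloor>real k * t\<rfloor>)\<bar> \<le> 1 / real (Suc j)})"
  define G where "G = {b. \<forall>\<omega>\<in>B b. (\<lambda>t\<in>{0..}. W t \<omega>) \<in> U}"
  have Bm: "{\<omega> \<in> space Q. \<forall>t\<in>{0..real T}. \<bar>W t \<omega> - g (nat \<lfloor>real k * t\<rfloor>)\<bar> \<le> e} \<in> sets Q"
    if "e > 0" for k T :: nat and g :: "nat \<Rightarrow> real" and e :: real
  proof -
    \<comment> \<open>W and the step function are both right-continuous, so the inequality at a time
      t < T follows from rational times to the right of t. The endpoint has no such times inside the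
      interval and is listed separately.\<close>
    let ?D = "{0..real T} \<inter> (\<rat> \<union> {real T})"
    have "{\<omega> \<in> space Q. \<forall>t\<in>?D. \<bar>W t \<omega> - g (nat \<lfloor>real k * t\<rfloor>)\<bar> \<le> e} \<in> sets Q"
    proof (rule sets.sets_Collect_countable_All')
      fix t assume "t \<in> ?D"
      then have [measurable]: "W t \<in> borel_measurable Q" using W by auto
      show "{x \<in> space Q. \<bar>W t x - g (nat \<lfloor>real k * t\<rfloor>)\<bar> \<le> e} \<in> sets Q" by measurable
    qed (auto intro: countable_Int2 simp: countable_rat)
    moreover have "{\<omega> \<in> space Q. \<forall>t\<in>?D. \<bar>W t \<omega> - g (nat \<lfloor>real k * t\<rfloor>)\<bar> \<le> e} =
        {\<omega> \<in> space Q. \<forall>t\<in>{0..real T}. \<bar>W t \<omega> - g (nat \<lfloor>real k * t\<rfloor>)\<bar> \<le> e}"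
    proof (intro equalityI subsetI CollectI conjI ballI)
      fix \<omega> t assume \<omega>: "\<omega> \<in> {\<omega> \<in> space Q. \<forall>t\<in>?D. \<bar>W t \<omega> - g (nat \<lfloor>real k * t\<rfloor>)\<bar> \<le> e}"
        and t: "t \<in> {0..real T}"
      show "\<bar>W t \<omega> - g (nat \<lfloor>real k * t\<rfloor>)\<bar> \<le> e"
      proof (cases "t = real T")
        case True then show ?thesis using \<omega> by auto
      next
        case False
        with t have t: "0 \<le> t" "t < real T" by auto
        let ?x = "\<lambda>s. step_path (real k) g s"
        have lim1: "((\<lambda>s. W s \<omega>) \<longlongrightarrow> W t \<omega>) (at_right t)"
        proof -
          have "((\<lambda>s. W s \<omega>) \<longlongrightarrow> W t \<omega>) (at t within {0..})"
            using cont[of \<omega>] \<omega> t by (auto simp: continuous_on_def)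
          then show ?thesis by (rule tendsto_within_subset) (use t in auto)
        qed
        have ev: "\<forall>\<^sub>F s in at_right t. nat \<lfloor>real k * s\<rfloor> = nat \<lfloor>real k * t\<rfloor>"
        proof (cases "k = 0")
          case True then show ?thesis by simp
        next
          case False
          let ?u = "(of_int \<lfloor>real k * t\<rfloor> + 1) / real k"
          have "t < ?u" using False by (simp add: field_simps) linarith
          then show ?thesis
            unfolding eventually_at_right_field
          proof (intro exI[of _ ?u] conjI allI impI)
            fix s assume s: "t < s" "s < ?u"
            have "real k * t \<le> real k * s" using s by (simp add: mult_left_mono)
            moreover have "real k * s < of_int \<lfloor>real k * t\<rfloor> + 1" using s False by (simp add: field_simps)
            ultimately show "nat \<lfloor>real k * s\<rfloor> = nat \<lfloor>real k * t\<rfloor>" by (metis floor_unique floor_correct order_trans)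
          qed
        qed
        show ?thesis
        proof (rule ccontr)
          assume "\<not> ?thesis"
          then have "e < \<bar>W t \<omega> - g (nat \<lfloor>real k * t\<rfloor>)\<bar>" by simp
          moreover have "((\<lambda>s. \<bar>W s \<omega> - g (nat \<lfloor>real k * t\<rfloor>)\<bar>) \<longlongrightarrow>
              \<bar>W t \<omega> - g (nat \<lfloor>real k * t\<rfloor>)\<bar>) (at_right t)"
            by (intro tendsto_intros lim1)
          ultimately have "\<forall>\<^sub>F s in at_right t. e < \<bar>W s \<omega> - g (nat \<lfloor>real k * t\<rfloor>)\<bar>"
            by (simp add: order_tendstoD)
          with ev have "\<forall>\<^sub>F s in at_right t. e < \<bar>W s \<omega> - g (nat \<lfloor>real k * s\<rfloor>)\<bar>"
            by eventually_elim simp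
          then obtain b where b: "b > t" "\<And>s. t < s \<Longrightarrow> s < b \<Longrightarrow> e < \<bar>W s \<omega> - g (nat \<lfloor>real k * s\<rfloor>)\<bar>"
            unfolding eventually_at_right_field by blast
          obtain q where q: "q \<in> \<rat>" "t < q" "q < min b (real T)"
            using Rats_dense_in_real[of t "min b (real T)"] b(1) t by auto
          then have "q \<in> ?D" using t by auto
          then have "\<bar>W q \<omega> - g (nat \<lfloor>real k * q\<rfloor>)\<bar> \<le> e" using \<omega> by blast
          with b(2)[of q] q show False by auto
        qed
      qed
    qed auto
    ultimately show ?thesis by simp
  qed
  have "B b \<in> sets Q" for b
    unfolding B_def by (cases b) (auto intro!: Bm)
  then have "(\<Union>b\<in>G. B b) \<in> sets Q"
    by (intro sets.countable_UN''[OF countableI_type])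
  moreover have "(\<Union>b\<in>G. B b) = {\<omega> \<in> space Q. (\<lambda>t\<in>{0..}. W t \<omega>) \<in> U}"
  proof (intro equalityI subsetI)
    fix \<omega> assume "\<omega> \<in> {\<omega> \<in> space Q. (\<lambda>t\<in>{0..}. W t \<omega>) \<in> U}"
    then have \<omega>: "\<omega> \<in> space Q" "(\<lambda>t\<in>{0..}. W t \<omega>) \<in> U" by auto
    then obtain T' \<delta> where *: "\<delta> > 0"
      "\<And>y. y \<in> cadlag \<Longrightarrow> unif_close T' \<delta> (\<lambda>t\<in>{0..}. W t \<omega>) y \<Longrightarrow> y \<in> U"
      using U unfolding locally_uniformly_open_def by blast
    obtain T :: nat where T: "T' \<le> real T" using real_arch_simple by blast
    obtain j :: nat where j: "2 / real (Suc j) < \<delta>"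
      using reals_Archimedean[of "\<delta>/2"] *(1) by (auto simp: field_simps)
    \<comment> \<open>The tolerance of \<open>B\<close> is 2 * e: one e for the oscillation of W
      inside a cell of the mesh, one for the rational approximation at the left grid point. Two
      paths in the same basic set then differ by at most 4 * e, which must stay below
      \<delta>.\<close>
    define e where "e = 1 / real (Suc j) / 2"
    have e: "e > 0" "4 * e < \<delta>" "1 / real (Suc j) = 2 * e"
    proof -
      show "e > 0" "1 / real (Suc j) = 2 * e" by (simp_all add: e_def field_simps)
      have "4 * e = 2 / real (Suc j)" by (simp add: e_def field_simps)
      then show "4 * e < \<delta>" using j by simp
    qed
    have "uniformly_continuous_on {0..real T} (\<lambda>t. W t \<omega>)"
      by (rule compact_uniformly_continuous) (auto intro: continuous_on_subset[OF cont[OF \<omega>(1)]])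
    then obtain d where d: "d > 0" "\<And>s t. s \<in> {0..real T} \<Longrightarrow> t \<in> {0..real T} \<Longrightarrow> \<bar>s - t\<bar> < d \<Longrightarrow>
        \<bar>W s \<omega> - W t \<omega>\<bar> < e"
      unfolding uniformly_continuous_on_def dist_real_def using e(1) by metis
    obtain k0 where k0: "1 / real (Suc k0) < d"
      using reals_Archimedean[OF d(1)] by (auto simp: inverse_eq_divide)
    define k where "k = Suc k0"
    have k: "k > 0" "1 / real k < d" using k0 by (auto simp: k_def)
    have "\<exists>q::rat. \<bar>W (real i / real k) \<omega> - of_rat q\<bar> < e" for i
    proof -
      obtain q where "q \<in> \<rat>" "W (real i / real k) \<omega> < q" "q < W (real i / real k) \<omega> + e"
        using Rats_dense_in_real[of "W (real i / real k) \<omega>" "W (real i / real k) \<omega> + e"] e(1) by auto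
      then obtain r where "q = of_rat r" by (auto elim: Rats_cases)
      then show ?thesis using \<open>W _ \<omega> < q\<close> \<open>q < _\<close> by (intro exI[of _ r]) (auto simp: abs_less_iff)
    qed
    then obtain q :: "nat \<Rightarrow> rat" where q: "\<And>i. \<bar>W (real i / real k) \<omega> - of_rat (q i)\<bar> < e"
      by metis
    \<comment> \<open>At t = T the index k * T occurs, so the list needs one more entry than there
      are cells in [0, T].\<close>
    define s where "s = map q [0..<Suc (k * T)]"
    have mem: "\<omega> \<in> B (k, T, j, s)"
      unfolding B_def prod.case e(3)
    proof (intro CollectI conjI \<omega> ballI)
      fix t assume t: "t \<in> {0..real T}"
      define i where "i = nat \<lfloor>real k * t\<rfloor>"
      have i: "real i \<le> real k * t" "real k * t < real i + 1"
        using t by (auto simp: i_def)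
      have "real k * t \<le> real k * real T" using t by (intro mult_left_mono) auto
      then have "i \<le> k * T" using i by (metis of_nat_le_iff of_nat_mult order_trans)
      have "real i / real k \<le> t" "t - real i / real k < d"
      proof -
        show "real i / real k \<le> t" using i(1) k by (simp add: field_simps)
        have "t < (real i + 1) / real k" using i(2) k by (simp add: field_simps)
        then show "t - real i / real k < d" using k by (simp add: add_divide_distrib)
      qed
      then have "\<bar>W t \<omega> - W (real i / real k) \<omega>\<bar> < e"
        using t by (intro d(2)) auto
      with q[of i] have "\<bar>W t \<omega> - of_rat (q i)\<bar> \<le> 2 * e" by linarith
      with \<open>i \<le> k * T\<close> show "\<bar>W t \<omega> - of_rat (s ! nat \<lfloor>real k * t\<rfloor>)\<bar> \<le> 2 * e"
        unfolding s_def i_def[symmetric] by (auto simp: nth_append)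
    qed
    moreover have "(k, T, j, s) \<in> G"
      unfolding G_def
    proof (intro CollectI ballI)
      fix \<omega>' assume \<omega>': "\<omega>' \<in> B (k, T, j, s)"
      have "unif_close T' \<delta> (\<lambda>t\<in>{0..}. W t \<omega>) (\<lambda>t\<in>{0..}. W t \<omega>')"
        unfolding unif_close_def
      proof
        fix t assume t: "t \<in> {0..T'}"
        then have "\<bar>W t \<omega> - of_rat (s ! nat \<lfloor>real k * t\<rfloor>)\<bar> \<le> 2 * e"
          "\<bar>W t \<omega>' - of_rat (s ! nat \<lfloor>real k * t\<rfloor>)\<bar> \<le> 2 * e"
          using mem \<omega>' T unfolding B_def e(3)[symmetric] by auto
        then have "\<bar>W t \<omega> - W t \<omega>'\<bar> \<le> 4 * e" by linarith
        with e t show "\<bar>(\<lambda>t\<in>{0..}. W t \<omega>) t - (\<lambda>t\<in>{0..}. W t \<omega>') t\<bar> \<le> \<delta>" by auto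
      qed
      moreover have "\<omega>' \<in> space Q" using \<omega>' by (auto simp: B_def)
      ultimately show "(\<lambda>t\<in>{0..}. W t \<omega>') \<in> U"
        using *(2) continuous_path_cadlag[OF cont] by blast
    qed
    ultimately show "\<omega> \<in> (\<Union>b\<in>G. B b)" by blast
  qed (auto simp: G_def B_def)
  ultimately show ?thesis by simp
qed

lemma measurable_borel_of_skorokhodI:
  assumes "\<And>\<omega>. \<omega> \<in> space P \<Longrightarrow> Z \<omega> \<in> cadlag"
    and "\<And>U. locally_uniformly_open U \<Longrightarrow> {\<omega> \<in> space P. Z \<omega> \<in> U} \<in> sets P"
  shows "Z \<in> measurable P (borel_of skorokhod)"
  unfolding borel_of_def
proof (rule measurable_measure_of)
  show "{U. openin skorokhod U} \<subseteq> Pow (topspace skorokhod)"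
    by (auto simp: openin_skorokhod)
  show "Z \<in> space P \<rightarrow> topspace skorokhod" using assms(1) by simp
  fix U assume "U \<in> {U. openin skorokhod U}"
  then have "{\<omega> \<in> space P. Z \<omega> \<in> U} \<in> sets P"
    using assms(2) openin_skorokhod_imp_locally_uniformly_open by blast
  then show "Z -` U \<inter> space P \<in> sets P"
    by (simp add: vimage_def Int_def conj_commute)
qed

lemma borel_measurable_locally_uniformly_continuous:
  assumes "\<And>\<omega>. \<omega> \<in> space P \<Longrightarrow> Z \<omega> \<in> cadlag"
    and "\<And>U. locally_uniformly_open U \<Longrightarrow> {\<omega> \<in> space P. Z \<omega> \<in> U} \<in> sets P"
    and "locally_uniformly_continuous f"
  shows "(\<lambda>\<omega>. f (Z \<omega>)) \<in> borel_measurable P"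
  unfolding borel_measurable_iff_greater
proof
  fix a
  have "{\<omega> \<in> space P. a < f (Z \<omega>)} = {\<omega> \<in> space P. Z \<omega> \<in> {x \<in> cadlag. a < f x}}"
    using assms(1) by auto
  then show "{\<omega> \<in> space P. a < f (Z \<omega>)} \<in> sets P"
    using assms(2)[OF locally_uniformly_open_superlevel[OF assms(3)]] by simp
qed

section \<open>Gaussian laws and weak convergence\<close>

text \<open>As an image of the standard normal law this covers \<sigma> = 0, where it is the point
  mass at 0, and its characteristic function has one formula for all \<sigma>.\<close>

definition centred_gaussian :: "real \<Rightarrow> real measure" where
  "centred_gaussian \<sigma> = distr std_normal_distribution borel (\<lambda>x. \<sigma> * x)"

lemma real_distribution_centred_gaussian: "real_distribution (centred_gaussian \<sigma>)"
proof -
  interpret real_distribution std_normal_distribution by (rule real_dist_normal_dist)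
  show ?thesis
    unfolding centred_gaussian_def by (rule real_distribution_distr) simp
qed

lemma char_centred_gaussian:
  "char (centred_gaussian \<sigma>) \<theta> = complex_of_real (exp (- (\<sigma>\<^sup>2 * \<theta>\<^sup>2) / 2))"
proof -
  have "char (centred_gaussian \<sigma>) \<theta> = char std_normal_distribution (\<sigma> * \<theta>)"
    unfolding char_def centred_gaussian_def by (subst integral_distr) (auto simp: mult_ac)
  then show ?thesis
    unfolding char_std_normal_distribution by (simp add: power_mult_distrib)
qed

lemma centred_gaussian_eq_density:
  assumes "\<sigma> > 0"
  shows "centred_gaussian \<sigma> = density lborel (normal_density 0 \<sigma>)"
proof -
  interpret real_distribution std_normal_distribution by (rule real_dist_normal_dist)
  have "distributed std_normal_distribution lborel (\<lambda>x. x) std_normal_density"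
    unfolding distributed_def by (auto simp: distr_id2)
  then have "distributed std_normal_distribution lborel (\<lambda>x. ((\<sigma> * x) - 0) / \<sigma>) std_normal_density"
    using assms by simp
  then have "distributed std_normal_distribution lborel (\<lambda>x. \<sigma> * x) (normal_density 0 \<sigma>)"
    using normal_standard_normal_convert[OF assms, of "\<lambda>x. \<sigma> * x" 0] by simp
  then have "distr std_normal_distribution lborel (\<lambda>x. \<sigma> * x) = density lborel (normal_density 0 \<sigma>)"
    by (simp add: distributed_def)
  moreover have "distr std_normal_distribution lborel (\<lambda>x. \<sigma> * x) = centred_gaussian \<sigma>"
    unfolding centred_gaussian_def by (rule distr_cong) auto
  ultimately show ?thesis by simp
qed

lemma normal_law_eq_centred_gaussian:
  assumes "s \<ge> 0"
  shows "normal_law 0 s = centred_gaussian (sqrt s)"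
proof (cases "s = 0")
  case True
  interpret real_distribution std_normal_distribution by (rule real_dist_normal_dist)
  have "centred_gaussian 0 = return borel 0"
    unfolding centred_gaussian_def mult_zero_left by (rule distr_const) simp
  then show ?thesis by (simp add: normal_law_def True)
qed (use assms in \<open>simp add: normal_law_def centred_gaussian_eq_density\<close>)

lemma lipschitz_imp_borel_measurable:
  fixes f :: "real \<Rightarrow> real"
  assumes lip: "\<And>x y. \<bar>f x - f y\<bar> \<le> L * \<bar>x - y\<bar>"
  shows "f \<in> borel_measurable borel"
proof (rule borel_measurable_continuous_onI, rule continuous_at_imp_continuous_on, intro ballI)
  fix x
  have "((\<lambda>y. f y - f x) \<longlongrightarrow> 0) (at x)"
  proof (rule Lim_null_comparison)
    show "\<forall>\<^sub>F y in at x. norm (f y - f x) \<le> L * \<bar>y - x\<bar>" using lip by simp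
    have "((\<lambda>y. L * \<bar>y - x\<bar>) \<longlongrightarrow> L * \<bar>x - x\<bar>) (at x)"
      by (intro tendsto_mult tendsto_const tendsto_rabs tendsto_diff tendsto_ident_at)
    then show "((\<lambda>y. L * \<bar>y - x\<bar>) \<longlongrightarrow> 0) (at x)" by simp
  qed
  then show "isCont f x" unfolding isCont_def by (rule LIM_zero_cancel)
qed

text \<open>
  Weak convergence is uniform over bounded Lipschitz functions: on a Skorohod coupling the
  integrands differ by at most the Lipschitz constant times the distance of the coupled points.
\<close>
lemma char_tendsto_imp_bounded_lipschitz_tendsto:
  fixes \<mu> :: "nat \<Rightarrow> real measure" and \<phi> :: "nat \<Rightarrow> real \<Rightarrow> real"
  assumes \<mu>: "\<And>n. real_distribution (\<mu> n)" and M: "real_distribution M"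
    and char: "\<And>\<theta>. (\<lambda>n. char (\<mu> n) \<theta>) \<longlonglongrightarrow> char M \<theta>"
    and bound: "\<And>n x. \<bar>\<phi> n x\<bar> \<le> B"
    and lip: "\<And>n x y. \<bar>\<phi> n x - \<phi> n y\<bar> \<le> L * \<bar>x - y\<bar>"
  shows "(\<lambda>n. (\<integral>x. \<phi> n x \<partial>\<mu> n) - (\<integral>x. \<phi> n x \<partial>M)) \<longlonglongrightarrow> 0"
proof -
  have "weak_conv_m \<mu> M" by (rule levy_continuity) fact+
  from Skorohod[OF \<mu> M this] obtain \<Omega> :: "real measure" and Y_seq :: "nat \<Rightarrow> real \<Rightarrow> real" and Y :: "real \<Rightarrow> real"
    where sk: "prob_space \<Omega>" "\<forall>n. Y_seq n \<in> measurable \<Omega> borel" "\<forall>n. distr \<Omega> borel (Y_seq n) = \<mu> n"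
      "Y \<in> measurable \<Omega> lborel" "distr \<Omega> borel Y = M"
      "\<forall>x\<in>space \<Omega>. (\<lambda>n. Y_seq n x) \<longlonglongrightarrow> Y x"
    by blast
  then have Yn: "\<And>n. Y_seq n \<in> measurable \<Omega> borel" "\<And>n. distr \<Omega> borel (Y_seq n) = \<mu> n"
      and Y: "Y \<in> measurable \<Omega> borel" "distr \<Omega> borel Y = M"
      and lim: "\<And>x. x \<in> space \<Omega> \<Longrightarrow> (\<lambda>n. Y_seq n x) \<longlonglongrightarrow> Y x"
    by simp_all
  interpret prob_space \<Omega> by (rule sk(1))
  have [measurable]: "\<phi> n \<in> borel_measurable borel" for n
    by (rule lipschitz_imp_borel_measurable[OF lip])
  note [measurable] = Yn(1) Y(1)
  have int: "integrable \<Omega> (\<lambda>x. \<phi> n (Y_seq n x))" "integrable \<Omega> (\<lambda>x. \<phi> n (Y x))" for n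
    using bound by (auto intro!: integrable_const_bound[of _ B])
  have "(\<lambda>n. \<integral>x. \<phi> n (Y_seq n x) - \<phi> n (Y x) \<partial>\<Omega>) \<longlonglongrightarrow> (\<integral>x. 0 \<partial>\<Omega>)"
  proof (rule integral_dominated_convergence[where w="\<lambda>_. 2 * B"])
    show "AE x in \<Omega>. (\<lambda>n. \<phi> n (Y_seq n x) - \<phi> n (Y x)) \<longlonglongrightarrow> 0"
    proof (rule AE_I2)
      fix x assume x: "x \<in> space \<Omega>"
      show "(\<lambda>n. \<phi> n (Y_seq n x) - \<phi> n (Y x)) \<longlonglongrightarrow> 0"
      proof (rule Lim_null_comparison)
        show "\<forall>\<^sub>F n in sequentially. norm (\<phi> n (Y_seq n x) - \<phi> n (Y x)) \<le> L * \<bar>Y_seq n x - Y x\<bar>"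
          using lip by simp
        have "(\<lambda>n. L * \<bar>Y_seq n x - Y x\<bar>) \<longlonglongrightarrow> L * \<bar>Y x - Y x\<bar>"
          using lim[OF x] by (intro tendsto_intros)
        then show "(\<lambda>n. L * \<bar>Y_seq n x - Y x\<bar>) \<longlonglongrightarrow> 0" by simp
      qed
    qed
    show "AE x in \<Omega>. norm (\<phi> n (Y_seq n x) - \<phi> n (Y x)) \<le> 2 * B" for n
    proof (rule AE_I2)
      fix x show "norm (\<phi> n (Y_seq n x) - \<phi> n (Y x)) \<le> 2 * B"
        using bound[of n "Y_seq n x"] bound[of n "Y x"] by (simp add: abs_le_iff)
    qed
  qed auto
  moreover have "(\<integral>x. \<phi> n (Y_seq n x) - \<phi> n (Y x) \<partial>\<Omega>) = (\<integral>x. \<phi> n x \<partial>\<mu> n) - (\<integral>x. \<phi> n x \<partial>M)" for n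
    using int Yn(2)[of n] Y(2) by (simp add: integral_distr flip: Yn(2) Y(2))
  ultimately show ?thesis by simp
qed

lemma (in prob_space) integral_uniform_measure:
  fixes f :: "'a \<Rightarrow> 'b::{banach, second_countable_topology}"
  assumes A: "A \<in> events" "prob A > 0" and f: "f \<in> borel_measurable M"
  shows "(\<integral>x. f x \<partial>uniform_measure M A) = (1 / prob A) *\<^sub>R (\<integral>x. indicator A x *\<^sub>R f x \<partial>M)"
proof -
  have "uniform_measure M A = density M (\<lambda>x. ennreal (indicator A x / prob A))"
    unfolding uniform_measure_def
  proof (rule density_cong)
    show "AE x in M. indicator A x / emeasure M A = ennreal (indicator A x / prob A)"
      using A by (auto simp: emeasure_eq_measure divide_ennreal ennreal_indicator[symmetric])
  qed (use A in auto)
  then have "(\<integral>x. f x \<partial>uniform_measure M A) = (\<integral>x. (indicator A x / prob A) *\<^sub>R f x \<partial>M)"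
    using A f by (simp add: integral_density)
  also have "(\<lambda>x. (indicator A x / prob A) *\<^sub>R f x) = (\<lambda>x. (1 / prob A) *\<^sub>R indicator A x *\<^sub>R f x)"
    by simp
  finally show ?thesis by (simp only: integral_scaleR_right)
qed

text \<open>The atoms of K have total mass 1, so estimates proportional to the mass of each atom add
  up to \<epsilon>. The atoms are numbered by \<open>to_nat\<close> to apply countable additivity
  over the naturals; a number that codes no value gives the empty set.\<close>

lemma (in prob_space) norm_integral_le_of_atoms:
  fixes K :: "'a \<Rightarrow> 'h::countable" and G :: "'a \<Rightarrow> real"
  assumes K: "K \<in> measurable M (count_space UNIV)" and G: "integrable M G"
    and le: "\<And>h. \<bar>\<integral>x. indicator {x \<in> space M. K x = h} x * G x \<partial>M\<bar> \<le> \<epsilon> * prob {x \<in> space M. K x = h}"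
  shows "\<bar>\<integral>x. G x \<partial>M\<bar> \<le> \<epsilon>"
proof -
  define A where "A i = {x \<in> space M. to_nat (K x) = i}" for i
  have A: "A i \<in> events" for i
  proof -
    have "A i = K -` {h. to_nat h = i} \<inter> space M" by (auto simp: A_def)
    then show ?thesis using measurable_sets[OF K, of "{h. to_nat h = i}"] by simp
  qed
  have UA: "(\<Union>i. A i) = space M" by (auto simp: A_def)
  have "set_integrable M (\<Union>i. A i) G"
    unfolding UA set_integrable_def by (intro integrable_mult_indicator G sets.top)
  then have "(LINT x:(\<Union>i. A i)|M. G x) = (\<Sum>i. (LINT x:(A i)|M. G x))"
    by (intro lebesgue_integral_countable_add A) (auto simp: A_def)
  moreover have "(LINT x:(\<Union>i. A i)|M. G x) = (\<integral>x. G x \<partial>M)"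
    unfolding UA set_lebesgue_integral_def by (rule Bochner_Integration.integral_cong) auto
  moreover have "(\<lambda>i. prob (A i)) sums prob (\<Union>i. A i)"
    by (rule finite_measure_UNION) (use A in \<open>auto simp: A_def disjoint_family_on_def\<close>)
  then have s: "(\<lambda>i. \<epsilon> * prob (A i)) sums \<epsilon>"
    unfolding UA using sums_mult[of "\<lambda>i. prob (A i)" 1 \<epsilon>] by (simp add: prob_space)
  have "norm (LINT x:(A i)|M. G x) \<le> \<epsilon> * prob (A i)" for i
  proof (cases "\<exists>h::'h. to_nat h = i")
    case True
    then obtain h :: 'h where "to_nat h = i" by blast
    then have "A i = {x \<in> space M. K x = h}" by (auto simp: A_def)
    with le[of h] show ?thesis by (simp add: set_lebesgue_integral_def)
  next
    case False
    then have "A i = {}" by (auto simp: A_def)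
    then show ?thesis by (simp add: set_lebesgue_integral_def)
  qed
  then have "norm (\<Sum>i. (LINT x:(A i)|M. G x)) \<le> (\<Sum>i. \<epsilon> * prob (A i))"
    by (rule norm_suminf_le) (use s in \<open>simp add: sums_iff\<close>)
  ultimately show ?thesis using s by (simp add: sums_iff)
qed

section \<open>Martingales with bounded increments and constant conditional variance\<close>

text \<open>For h with countably many values this plays the part of measurability with respect to
  the sigma-algebra generated by h. The codomain of Z carries no structure, so Z may itself be
  function-valued, as in \<open>martingale_step\<close>.\<close>

definition determined_by :: "'a measure \<Rightarrow> ('a \<Rightarrow> 'h) \<Rightarrow> ('a \<Rightarrow> 'b) \<Rightarrow> bool" where
  "determined_by P h Z \<longleftrightarrow> (\<forall>\<omega>\<in>space P. \<forall>\<omega>'\<in>space P. h \<omega> = h \<omega>' \<longrightarrow> Z \<omega> = Z \<omega>')"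

lemma determined_byD:
  "determined_by P h Z \<Longrightarrow> \<omega> \<in> space P \<Longrightarrow> \<omega>' \<in> space P \<Longrightarrow> h \<omega> = h \<omega>' \<Longrightarrow> Z \<omega> = Z \<omega>'"
  unfolding determined_by_def by blast

lemma determined_by_const: "determined_by P h (\<lambda>_. c)"
  by (simp add: determined_by_def)

lemma determined_by_compose:
  assumes "determined_by P h X"
  shows "determined_by P h (\<lambda>\<omega>. f (X \<omega>))"
  unfolding determined_by_def by (metis determined_byD[OF assms])

lemma determined_by_compose2:
  assumes "determined_by P h X" "determined_by P h Y"
  shows "determined_by P h (\<lambda>\<omega>. f (X \<omega>) (Y \<omega>))"
  unfolding determined_by_def by (metis determined_byD[OF assms(1)] determined_byD[OF assms(2)])

lemma determined_by_fun:
  assumes "\<And>i. determined_by P h (\<lambda>\<omega>. X \<omega> i)"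
  shows "determined_by P h X"
  unfolding determined_by_def
proof (intro ballI impI ext)
  fix \<omega> \<omega>' i assume "\<omega> \<in> space P" "\<omega>' \<in> space P" "h \<omega> = h \<omega>'"
  then show "X \<omega> i = X \<omega>' i" using determined_byD[OF assms] by blast
qed

lemma determined_by_factor:
  assumes "determined_by P h Z"
  obtains g where "\<And>\<omega>. \<omega> \<in> space P \<Longrightarrow> Z \<omega> = g (h \<omega>)"
proof
  fix \<omega> assume \<omega>: "\<omega> \<in> space P"
  let ?w = "SOME \<omega>'. \<omega>' \<in> space P \<and> h \<omega>' = h \<omega>"
  have "?w \<in> space P \<and> h ?w = h \<omega>"
    by (rule someI[of _ \<omega>]) (use \<omega> in simp)
  then show "Z \<omega> = (\<lambda>y. Z (SOME \<omega>'. \<omega>' \<in> space P \<and> h \<omega>' = y)) (h \<omega>)"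
    using determined_byD[OF assms \<omega>] by simp
qed

lemma determined_by_measurable:
  assumes "determined_by P h Z" and h: "h \<in> measurable P (count_space UNIV)"
  shows "Z \<in> borel_measurable P"
proof -
  obtain g where g: "\<And>\<omega>. \<omega> \<in> space P \<Longrightarrow> Z \<omega> = g (h \<omega>)"
    using determined_by_factor[OF assms(1)] by metis
  have "(\<lambda>\<omega>. g (h \<omega>)) \<in> borel_measurable P"
    by (rule measurable_compose[OF h]) simp
  then show ?thesis using measurable_cong[of P Z "\<lambda>\<omega>. g (h \<omega>)"] g by simp
qed

text \<open>The upper half comes from exp (- x) <= 1 / (1 + x) <= 1 - x + x^2. The estimate serves
  \<open>char_incr\<close> with x = u^2 v / 2, for arbitrary u.\<close>

lemma abs_exp_minus_linear_le:
  fixes x :: real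
  assumes "0 \<le> x"
  shows "\<bar>exp (- x) - (1 - x)\<bar> \<le> x\<^sup>2"
proof -
  have "exp (- x) = 1 / exp x" by (simp add: exp_minus inverse_eq_divide)
  also have "\<dots> \<le> 1 / (1 + x)"
    using assms exp_ge_add_one_self[of x] by (intro divide_left_mono) auto
  also have "\<dots> \<le> 1 - x + x\<^sup>2"
  proof -
    have "(1 - x + x\<^sup>2) * (1 + x) = 1 + x ^ 3" by (simp add: power2_eq_square power3_eq_cube algebra_simps)
    then show ?thesis using assms by (simp add: divide_le_eq)
  qed
  finally have "exp (- x) \<le> 1 - x + x\<^sup>2" .
  moreover have "1 - x \<le> exp (- x)" using exp_ge_add_one_self[of "-x"] by simp
  ultimately show ?thesis by simp
qed

lemma cmod_iexp_second_order:
  "cmod (iexp x - (1 + \<i> * x - x\<^sup>2 / 2)) \<le> \<bar>x\<bar> ^ 3 / 6"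
proof -
  have "(\<Sum>k \<le> 2. (\<i> * x)^k / fact k) = 1 + \<i> * x - x\<^sup>2 / 2"
  proof -
    have "{..2::nat} = {0, 1, 2}" by auto
    then show ?thesis by (simp add: power_mult_distrib)
  qed
  then show ?thesis using iexp_approx1[of x 2] by (simp add: eval_nat_numeral)
qed

text \<open>\<open>H n\<close> is the past up to time n. The assumptions \<open>\<xi>_mean\<close>
  and \<open>\<xi>_variance\<close> say that the conditional mean of \<open>\<xi> n\<close> given
  the past is 0 and its conditional second moment is v, expressed by testing against bounded
  variables of the past. The test variables are complex because they will contain factors
  \<open>iexp\<close>.\<close>

locale bounded_martingale = prob_space P for P :: "'a measure" +
  fixes H :: "nat \<Rightarrow> 'a \<Rightarrow> 'h::countable" and \<xi> :: "nat \<Rightarrow> 'a \<Rightarrow> real" and c v :: real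
  assumes H_measurable: "\<And>n. H n \<in> measurable P (count_space UNIV)"
    and H_mono: "\<And>m n. m \<le> n \<Longrightarrow> determined_by P (H n) (H m)"
    and \<xi>_determined: "\<And>n. determined_by P (H (Suc n)) (\<xi> n)"
    and \<xi>_bound: "\<And>n \<omega>. \<omega> \<in> space P \<Longrightarrow> \<bar>\<xi> n \<omega>\<bar> \<le> c"
    and \<xi>_mean: "\<And>n (Z :: 'a \<Rightarrow> complex) b. determined_by P (H n) Z \<Longrightarrow>
        (\<And>\<omega>. \<omega> \<in> space P \<Longrightarrow> cmod (Z \<omega>) \<le> b) \<Longrightarrow> (\<integral>\<omega>. Z \<omega> * \<xi> n \<omega> \<partial>P) = 0"
    and \<xi>_variance: "\<And>n (Z :: 'a \<Rightarrow> complex) b. determined_by P (H n) Z \<Longrightarrow>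
        (\<And>\<omega>. \<omega> \<in> space P \<Longrightarrow> cmod (Z \<omega>) \<le> b) \<Longrightarrow>
        (\<integral>\<omega>. Z \<omega> * (\<xi> n \<omega>)\<^sup>2 \<partial>P) = v * (\<integral>\<omega>. Z \<omega> \<partial>P)"
begin

lemma determined_mono:
  assumes "m \<le> n" "determined_by P (H m) Z"
  shows "determined_by P (H n) Z"
  using H_mono[OF assms(1)] assms(2) unfolding determined_by_def by blast

lemma measurable_determined: "determined_by P (H n) Z \<Longrightarrow> Z \<in> borel_measurable P"
  using determined_by_measurable H_measurable by blast

lemma integrable_bounded:
  fixes Z :: "'a \<Rightarrow> 'b::{banach, second_countable_topology}"
  assumes "Z \<in> borel_measurable P" "\<And>\<omega>. \<omega> \<in> space P \<Longrightarrow> norm (Z \<omega>) \<le> b"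
  shows "integrable P Z"
  using assms by (intro integrable_const_bound[of _ b]) auto

lemma \<xi>_measurable [measurable]: "\<xi> n \<in> borel_measurable P"
  by (rule measurable_determined[OF \<xi>_determined])

lemma c_nonneg: "0 \<le> c"
proof -
  obtain \<omega> where "\<omega> \<in> space P" using not_empty by blast
  then show ?thesis using \<xi>_bound[of \<omega> 0] by linarith
qed

lemma \<xi>_mean_real:
  fixes Z :: "'a \<Rightarrow> real"
  assumes "determined_by P (H n) Z" "\<And>\<omega>. \<omega> \<in> space P \<Longrightarrow> \<bar>Z \<omega>\<bar> \<le> b"
  shows "(\<integral>\<omega>. Z \<omega> * \<xi> n \<omega> \<partial>P) = 0"
proof -
  have "complex_of_real (\<integral>\<omega>. Z \<omega> * \<xi> n \<omega> \<partial>P) = (\<integral>\<omega>. complex_of_real (Z \<omega>) * \<xi> n \<omega> \<partial>P)"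
    by (simp flip: integral_complex_of_real)
  also have "\<dots> = 0"
    by (rule \<xi>_mean[where b=b]) (use assms in \<open>auto intro: determined_by_compose\<close>)
  finally show ?thesis by simp
qed

lemma \<xi>_variance_real:
  fixes Z :: "'a \<Rightarrow> real"
  assumes "determined_by P (H n) Z" "\<And>\<omega>. \<omega> \<in> space P \<Longrightarrow> \<bar>Z \<omega>\<bar> \<le> b"
  shows "(\<integral>\<omega>. Z \<omega> * (\<xi> n \<omega>)\<^sup>2 \<partial>P) = v * (\<integral>\<omega>. Z \<omega> \<partial>P)"
proof -
  have "complex_of_real (\<integral>\<omega>. Z \<omega> * (\<xi> n \<omega>)\<^sup>2 \<partial>P) = (\<integral>\<omega>. complex_of_real (Z \<omega>) * (\<xi> n \<omega>)\<^sup>2 \<partial>P)"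
    by (simp flip: integral_complex_of_real)
  also have "\<dots> = v * (\<integral>\<omega>. complex_of_real (Z \<omega>) \<partial>P)"
    by (rule \<xi>_variance[where b=b]) (use assms in \<open>auto intro: determined_by_compose\<close>)
  also have "\<dots> = complex_of_real (v * (\<integral>\<omega>. Z \<omega> \<partial>P))" by simp
  finally show ?thesis by (simp only: of_real_eq_iff)
qed

lemma integral_\<xi>_sq: "(\<integral>\<omega>. (\<xi> n \<omega>)\<^sup>2 \<partial>P) = v"
  using \<xi>_variance_real[of n "\<lambda>_. 1" 1] by (simp add: determined_by_const prob_space)

lemma v_nonneg: "0 \<le> v"
  using integral_\<xi>_sq[of 0] by (metis integral_nonneg_AE AE_I2 zero_le_power2)

lemma \<xi>_sq_bound: "\<omega> \<in> space P \<Longrightarrow> (\<xi> n \<omega>)\<^sup>2 \<le> c\<^sup>2"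
  using \<xi>_bound[of \<omega> n] by (metis abs_ge_zero power2_abs power_mono)

lemma v_le: "v \<le> c\<^sup>2"
proof -
  have "(\<integral>\<omega>. (\<xi> 0 \<omega>)\<^sup>2 \<partial>P) \<le> (\<integral>\<omega>. c\<^sup>2 \<partial>P)"
    by (intro integral_mono integrable_bounded[where b="c\<^sup>2"]) (auto simp: \<xi>_sq_bound)
  then show ?thesis by (simp add: integral_\<xi>_sq prob_space)
qed

section \<open>Partial sums: moments and a maximal inequality\<close>

definition S :: "nat \<Rightarrow> 'a \<Rightarrow> real" where
  "S n \<omega> = (\<Sum>k<n. \<xi> k \<omega>)"

definition incr :: "nat \<Rightarrow> nat \<Rightarrow> 'a \<Rightarrow> real" where
  "incr n m \<omega> = S (n + m) \<omega> - S n \<omega>"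

lemma S_determined: "determined_by P (H n) (S n)"
proof (induction n)
  case (Suc n)
  have "determined_by P (H (Suc n)) (\<lambda>\<omega>. S n \<omega> + \<xi> n \<omega>)"
    by (rule determined_by_compose2[OF determined_mono[OF _ Suc] \<xi>_determined]) simp
  then show ?case by (simp add: S_def[abs_def])
qed (simp add: S_def[abs_def] determined_by_const)

lemma incr_determined: "determined_by P (H (n + m)) (incr n m)"
proof -
  have "determined_by P (H (n + m)) (\<lambda>\<omega>. S (n + m) \<omega> - S n \<omega>)"
    by (rule determined_by_compose2[OF S_determined determined_mono[OF _ S_determined]]) simp
  then show ?thesis by (simp add: incr_def[abs_def])
qed

lemma S_measurable [measurable]: "S n \<in> borel_measurable P"
  by (rule measurable_determined[OF S_determined])

lemma incr_measurable [measurable]: "incr n m \<in> borel_measurable P"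
  by (rule measurable_determined[OF incr_determined])

lemma incr_0 [simp]: "incr n 0 \<omega> = 0"
  by (simp add: incr_def)

lemma incr_Suc: "incr n (Suc m) \<omega> = incr n m \<omega> + \<xi> (n + m) \<omega>"
  by (simp add: incr_def S_def)

lemma incr_bound: "\<omega> \<in> space P \<Longrightarrow> \<bar>incr n m \<omega>\<bar> \<le> c * real m"
proof (induction m)
  case (Suc m)
  then show ?case using \<xi>_bound[of \<omega> "n + m"] by (simp add: incr_Suc algebra_simps)
qed simp

lemma incr_power_bound: "\<omega> \<in> space P \<Longrightarrow> \<bar>incr n m \<omega> ^ k\<bar> \<le> (c * real m) ^ k"
  using incr_bound[of \<omega> n m] by (simp add: power_abs power_mono)

lemma incr_power_le: "\<omega> \<in> space P \<Longrightarrow> incr n m \<omega> ^ k \<le> (c * real m) ^ k"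
  by (rule abs_le_D1[OF incr_power_bound])

lemma integral_incr_sq: "(\<integral>\<omega>. (incr n m \<omega>)\<^sup>2 \<partial>P) = v * real m"
proof (induction m)
  case (Suc m)
  let ?D = "incr n m" and ?x = "\<xi> (n + m)"
  have D: "determined_by P (H (n + m)) ?D" by (rule incr_determined)
  have i1: "integrable P (\<lambda>\<omega>. (?D \<omega>)\<^sup>2)"
    by (rule integrable_bounded[where b="(c * real m)\<^sup>2"]) (use incr_power_bound incr_power_le in auto)
  have i2: "integrable P (\<lambda>\<omega>. (2 * ?D \<omega>) * ?x \<omega>)"
  proof (rule integrable_bounded[where b="2 * (c * real m) * c"])
    fix \<omega> assume "\<omega> \<in> space P"
    then show "norm ((2 * ?D \<omega>) * ?x \<omega>) \<le> 2 * (c * real m) * c"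
      unfolding real_norm_def abs_mult using incr_bound \<xi>_bound c_nonneg by (intro mult_mono) auto
  qed measurable
  have i3: "integrable P (\<lambda>\<omega>. (?x \<omega>)\<^sup>2)"
    by (rule integrable_bounded[where b="c\<^sup>2"]) (use \<xi>_sq_bound in auto)
  have "(\<integral>\<omega>. (incr n (Suc m) \<omega>)\<^sup>2 \<partial>P) = (\<integral>\<omega>. (?D \<omega>)\<^sup>2 + (2 * ?D \<omega>) * ?x \<omega> + (?x \<omega>)\<^sup>2 \<partial>P)"
    by (simp add: incr_Suc power2_sum algebra_simps)
  also have "\<dots> = (\<integral>\<omega>. (?D \<omega>)\<^sup>2 \<partial>P) + (\<integral>\<omega>. (2 * ?D \<omega>) * ?x \<omega> \<partial>P) + (\<integral>\<omega>. (?x \<omega>)\<^sup>2 \<partial>P)"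
    using i1 i2 i3 by simp
  also have "(\<integral>\<omega>. (2 * ?D \<omega>) * ?x \<omega> \<partial>P) = 0"
    by (rule \<xi>_mean_real[where b="2 * (c * real m)"])
       (use incr_bound in \<open>auto simp: abs_mult intro!: determined_by_compose[OF D]\<close>)
  finally show ?case using Suc by (simp add: integral_\<xi>_sq algebra_simps)
qed simp

text \<open>In the expansion of (d + x)^4 the term 4 d^3 x has mean 0, and 4 d x^3 is absorbed by 2
  d x <= d^2 + x^2, which turns the coefficients 6 and 1 into 8 and 3. The moment thus grows by at
  most (8 m + 3) c^4 in one step, while 4 c^4 m^2 grows by (8 m + 4) c^4.\<close>

lemma integral_incr_fourth: "(\<integral>\<omega>. (incr n m \<omega>) ^ 4 \<partial>P) \<le> 4 * c ^ 4 * (real m)\<^sup>2"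
proof (induction m)
  case (Suc m)
  let ?D = "incr n m" and ?x = "\<xi> (n + m)"
  have D: "determined_by P (H (n + m)) ?D" by (rule incr_determined)
  have i1: "integrable P (\<lambda>\<omega>. (?D \<omega>) ^ 4)"
    by (rule integrable_bounded[where b="(c * real m) ^ 4"]) (use incr_power_bound incr_power_le in auto)
  have i2: "integrable P (\<lambda>\<omega>. (4 * ?D \<omega> ^ 3) * ?x \<omega>)"
  proof (rule integrable_bounded[where b="4 * (c * real m) ^ 3 * c"])
    fix \<omega> assume "\<omega> \<in> space P"
    then show "norm ((4 * ?D \<omega> ^ 3) * ?x \<omega>) \<le> 4 * (c * real m) ^ 3 * c"
      unfolding real_norm_def abs_mult using incr_power_bound[of \<omega> n m 3] \<xi>_bound c_nonneg
      by (intro mult_mono) auto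
  qed measurable
  have i3: "integrable P (\<lambda>\<omega>. (?D \<omega>)\<^sup>2)"
    by (rule integrable_bounded[where b="(c * real m)\<^sup>2"]) (use incr_power_bound incr_power_le in auto)
  have le: "(incr n (Suc m) \<omega>) ^ 4 \<le> ?D \<omega> ^ 4 + (4 * ?D \<omega> ^ 3) * ?x \<omega> + 8 * c\<^sup>2 * (?D \<omega>)\<^sup>2 + 3 * c ^ 4"
    if "\<omega> \<in> space P" for \<omega>
  proof -
    define d x where "d = ?D \<omega>" and "x = ?x \<omega>"
    have x: "x\<^sup>2 \<le> c\<^sup>2" using \<xi>_sq_bound[OF that] by (simp add: x_def)
    have x4: "x\<^sup>2 * x\<^sup>2 \<le> c\<^sup>2 * c\<^sup>2" using x by (intro mult_mono) auto
    have xd: "d\<^sup>2 * x\<^sup>2 \<le> d\<^sup>2 * c\<^sup>2" using x by (intro mult_left_mono) auto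
    have "4 * d * x ^ 3 = 2 * x\<^sup>2 * (2 * (d * x))" by (simp add: power2_eq_square power3_eq_cube)
    also have "\<dots> \<le> 2 * x\<^sup>2 * (d\<^sup>2 + x\<^sup>2)"
      using sum_squares_bound[of d x] by (intro mult_left_mono) auto
    finally have "4 * d * x ^ 3 \<le> 2 * (d\<^sup>2 * x\<^sup>2) + 2 * (x\<^sup>2 * x\<^sup>2)" by (simp add: algebra_simps)
    moreover have "(d + x) ^ 4 = d ^ 4 + (4 * d ^ 3) * x + 6 * (d\<^sup>2 * x\<^sup>2) + 4 * d * x ^ 3 + x\<^sup>2 * x\<^sup>2"
      by (simp add: power4_eq_xxxx power2_eq_square power3_eq_cube algebra_simps)
    ultimately have "(d + x) ^ 4 \<le> d ^ 4 + (4 * d ^ 3) * x + 8 * (d\<^sup>2 * c\<^sup>2) + 3 * (c\<^sup>2 * c\<^sup>2)"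
      using x4 xd by linarith
    then show ?thesis by (simp add: incr_Suc d_def x_def power4_eq_xxxx power2_eq_square mult_ac)
  qed
  have "(\<integral>\<omega>. (incr n (Suc m) \<omega>) ^ 4 \<partial>P) \<le>
      (\<integral>\<omega>. ?D \<omega> ^ 4 + (4 * ?D \<omega> ^ 3) * ?x \<omega> + 8 * c\<^sup>2 * (?D \<omega>)\<^sup>2 + 3 * c ^ 4 \<partial>P)"
  proof (rule integral_mono)
    show "integrable P (\<lambda>\<omega>. (incr n (Suc m) \<omega>) ^ 4)"
      by (rule integrable_bounded[where b="(c * real (Suc m)) ^ 4"])
        (use incr_power_bound incr_power_le in \<open>auto simp del: of_nat_Suc\<close>)
    show "integrable P (\<lambda>\<omega>. ?D \<omega> ^ 4 + (4 * ?D \<omega> ^ 3) * ?x \<omega> + 8 * c\<^sup>2 * (?D \<omega>)\<^sup>2 + 3 * c ^ 4)"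
      using i1 i2 i3 by simp
  qed (rule le)
  also have "\<dots> = (\<integral>\<omega>. ?D \<omega> ^ 4 \<partial>P) + (\<integral>\<omega>. (4 * ?D \<omega> ^ 3) * ?x \<omega> \<partial>P) + 8 * c\<^sup>2 * (v * real m) + 3 * c ^ 4"
    using i1 i2 i3 by (simp add: integral_incr_sq prob_space)
  also have "(\<integral>\<omega>. (4 * ?D \<omega> ^ 3) * ?x \<omega> \<partial>P) = 0"
    by (rule \<xi>_mean_real[where b="4 * (c * real m) ^ 3"])
       (use incr_power_bound[of _ n m 3] in \<open>auto simp: abs_mult intro!: determined_by_compose[OF D]\<close>)
  also have "8 * c\<^sup>2 * (v * real m) \<le> 8 * c\<^sup>2 * (c\<^sup>2 * real m)"
    using v_le by (intro mult_left_mono mult_right_mono) auto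
  finally have "(\<integral>\<omega>. (incr n (Suc m) \<omega>) ^ 4 \<partial>P) \<le> 4 * c ^ 4 * (real m)\<^sup>2 + 8 * c\<^sup>2 * (c\<^sup>2 * real m) + 3 * c ^ 4"
    using Suc by simp
  moreover have "c ^ 4 \<ge> 0" by simp
  then have "4 * c ^ 4 * (real m)\<^sup>2 + 8 * c\<^sup>2 * (c\<^sup>2 * real m) + 3 * c ^ 4 \<le> 4 * c ^ 4 * (real (Suc m))\<^sup>2"
    by (simp add: power4_eq_xxxx power2_eq_square algebra_simps)
  ultimately show ?case by linarith
qed simp

text \<open>Doob's argument for the submartingale formed by the fourth powers, run as an induction
  on m. The quantity carried along is the integral of the fourth power over the event that the level
  r has been reached; it dominates r^4 times the probability of that event.\<close>

lemma maximal_inequality: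
  assumes "r > 0"
  shows "prob {\<omega> \<in> space P. \<exists>j\<le>m. r \<le> \<bar>incr n j \<omega>\<bar>} \<le> 4 * c ^ 4 * (real m)\<^sup>2 / r ^ 4"
proof -
  define B where "B m = {\<omega> \<in> space P. \<exists>j\<le>m. r \<le> \<bar>incr n j \<omega>\<bar>}" for m
  have B_meas [measurable]: "B m \<in> events" for m
    unfolding B_def by measurable
  have int: "integrable P (\<lambda>\<omega>. indicator A \<omega> * incr n m \<omega> ^ 4)" if "A \<in> events" for A m
    by (rule integrable_bounded[where b="(c * real m) ^ 4"])
       (use that incr_power_bound incr_power_le in \<open>auto simp: indicator_def c_nonneg\<close>)
  have "r ^ 4 * prob (B m) \<le> (\<integral>\<omega>. indicator (B m) \<omega> * incr n m \<omega> ^ 4 \<partial>P)" for m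
  proof (induction m)
    case 0
    have "B 0 = {}" using assms by (auto simp: B_def)
    then show ?case by simp
  next
    case (Suc m)
    let ?D = "incr n m" and ?x = "\<xi> (n + m)"
    \<comment> \<open>The event that the level r is reached at index m + 1 but not earlier.\<close>
    define A where "A = {\<omega> \<in> space P. r \<le> \<bar>incr n (Suc m) \<omega>\<bar>} - B m"
    have A [measurable]: "A \<in> events" unfolding A_def by measurable
    have BS: "B (Suc m) = B m \<union> A" and disj: "B m \<inter> A = {}"
      by (auto simp: B_def A_def le_Suc_eq)
    have ind: "indicator (B (Suc m)) \<omega> = (indicator (B m) \<omega> + indicator A \<omega> :: real)" for \<omega>
      unfolding BS using disj by (auto simp: indicator_def)
    have "r ^ 4 * prob A = (\<integral>\<omega>. indicator A \<omega> * r ^ 4 \<partial>P)" by simp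
    also have "\<dots> \<le> (\<integral>\<omega>. indicator A \<omega> * incr n (Suc m) \<omega> ^ 4 \<partial>P)"
    proof (rule integral_mono)
      show "integrable P (\<lambda>\<omega>. indicator A \<omega> * r ^ 4)"
        by (rule integrable_bounded[where b="r ^ 4"]) (auto simp: indicator_def)
    next
      fix \<omega> assume "\<omega> \<in> space P"
      show "indicator A \<omega> * r ^ 4 \<le> indicator A \<omega> * incr n (Suc m) \<omega> ^ 4"
      proof (cases "\<omega> \<in> A")
        case True
        then have "r ^ 4 \<le> \<bar>incr n (Suc m) \<omega>\<bar> ^ 4"
          using assms by (intro power_mono) (auto simp: A_def)
        then show ?thesis using True by simp
      qed simp
    qed (rule int[OF A])
    finally have 1: "r ^ 4 * prob A \<le> (\<integral>\<omega>. indicator A \<omega> * incr n (Suc m) \<omega> ^ 4 \<partial>P)" .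
    \<comment> \<open>The coefficient of the first-order term of (d + x)^4 in x, restricted to
      \<open>B m\<close>. It depends on the past of x only, so its product with x has mean
      0.\<close>
    let ?Z = "\<lambda>\<omega>. indicator (B m) \<omega> * (4 * ?D \<omega> ^ 3)"
    have Z_bound: "\<bar>?Z \<omega>\<bar> \<le> 4 * (c * real m) ^ 3" if "\<omega> \<in> space P" for \<omega>
      using incr_power_bound[OF that, of n m 3] c_nonneg by (auto simp: indicator_def abs_mult)
    have detB: "determined_by P (H (n + m)) (\<lambda>\<omega>. indicator (B m) \<omega> :: real)"
    proof -
      have *: "determined_by P (H (n + m)) (incr n j)" if "j \<le> m" for j
        using determined_mono[OF _ incr_determined[of n j]] that by simp
      show ?thesis
        unfolding determined_by_def
      proof (intro ballI impI)
        fix \<omega> \<omega>' assume \<omega>: "\<omega> \<in> space P" "\<omega>' \<in> space P" "H (n + m) \<omega> = H (n + m) \<omega>'"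
        have "incr n j \<omega> = incr n j \<omega>'" if "j \<le> m" for j
          by (rule determined_byD[OF *[OF that] \<omega>])
        then have "\<omega> \<in> B m \<longleftrightarrow> \<omega>' \<in> B m" using \<omega> by (auto simp: B_def)
        then show "(indicator (B m) \<omega> :: real) = indicator (B m) \<omega>'" by (simp add: indicator_def)
      qed
    qed
    have iZ: "integrable P (\<lambda>\<omega>. ?Z \<omega> * ?x \<omega>)"
    proof (rule integrable_bounded[where b="4 * (c * real m) ^ 3 * c"])
      fix \<omega> assume "\<omega> \<in> space P"
      then show "norm (?Z \<omega> * ?x \<omega>) \<le> 4 * (c * real m) ^ 3 * c"
        unfolding real_norm_def abs_mult[of "?Z \<omega>"]
        using Z_bound \<xi>_bound c_nonneg by (intro mult_mono) auto
    qed measurable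
    have "(\<integral>\<omega>. ?Z \<omega> * ?x \<omega> \<partial>P) = 0"
      by (rule \<xi>_mean_real[OF _ Z_bound]) (intro determined_by_compose2[OF detB incr_determined])
    then have "(\<integral>\<omega>. indicator (B m) \<omega> * ?D \<omega> ^ 4 \<partial>P) =
        (\<integral>\<omega>. indicator (B m) \<omega> * ?D \<omega> ^ 4 + ?Z \<omega> * ?x \<omega> \<partial>P)"
      using int[OF B_meas, of m m] iZ by simp
    also have "\<dots> \<le> (\<integral>\<omega>. indicator (B m) \<omega> * incr n (Suc m) \<omega> ^ 4 \<partial>P)"
    proof (rule integral_mono)
      fix \<omega>
      \<comment> \<open>The convexity of the fourth power, (d + x)^4 >= d^4 + 4 d^3 x, with the
        difference written as a sum of squares.\<close>
      have "0 \<le> (?x \<omega>)\<^sup>2 * (2 * (?D \<omega>)\<^sup>2 + (2 * ?D \<omega> + ?x \<omega>)\<^sup>2)" by simp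
      also have "\<dots> = (?D \<omega> + ?x \<omega>) ^ 4 - (?D \<omega> ^ 4 + 4 * ?D \<omega> ^ 3 * ?x \<omega>)"
        by (simp add: power4_eq_xxxx power2_eq_square power3_eq_cube algebra_simps)
      finally show "indicator (B m) \<omega> * ?D \<omega> ^ 4 + ?Z \<omega> * ?x \<omega> \<le> indicator (B m) \<omega> * incr n (Suc m) \<omega> ^ 4"
        by (simp add: indicator_def incr_Suc)
    qed (use int[OF B_meas] iZ in auto)
    finally have "r ^ 4 * prob (B m) \<le> (\<integral>\<omega>. indicator (B m) \<omega> * incr n (Suc m) \<omega> ^ 4 \<partial>P)"
      using Suc by linarith
    moreover have "prob (B (Suc m)) = prob (B m) + prob A"
      unfolding BS by (rule finite_measure_Union) (use disj in auto)
    moreover have "(\<integral>\<omega>. indicator (B (Suc m)) \<omega> * incr n (Suc m) \<omega> ^ 4 \<partial>P) =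
        (\<integral>\<omega>. indicator (B m) \<omega> * incr n (Suc m) \<omega> ^ 4 \<partial>P) + (\<integral>\<omega>. indicator A \<omega> * incr n (Suc m) \<omega> ^ 4 \<partial>P)"
      unfolding ind distrib_right using int[OF B_meas] int[OF A] by simp
    ultimately show ?case using 1 by (simp add: distrib_left)
  qed
  also have "(\<integral>\<omega>. indicator (B m) \<omega> * incr n m \<omega> ^ 4 \<partial>P) \<le> (\<integral>\<omega>. incr n m \<omega> ^ 4 \<partial>P)"
    by (intro integral_mono int B_meas integrable_bounded[where b="(c * real m) ^ 4"])
       (use incr_power_bound incr_power_le in \<open>auto simp: indicator_def\<close>)
  also have "\<dots> \<le> 4 * c ^ 4 * (real m)\<^sup>2" by (rule integral_incr_fourth)
  finally show ?thesis
    using assms by (simp add: B_def pos_le_divide_eq mult.commute)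
qed

text \<open>With q = u^2 v / 2, each step multiplies the integral by 1 - q, because the conditional
  mean and variance are constants. The Taylor remainder costs |u|^3 c^3 / 6 and replacing 1 - q by
  exp (- q) costs q^2; these errors add up over the steps since exp (- q) <= 1. The bound is
  proportional to the integral of |Z|, so that for the indicator of an event it is relative to the
  probability of the event.\<close>

lemma char_incr:
  fixes Z :: "'a \<Rightarrow> complex"
  assumes Z: "determined_by P (H n) Z" and Zb: "\<And>\<omega>. \<omega> \<in> space P \<Longrightarrow> cmod (Z \<omega>) \<le> b"
  shows "cmod ((\<integral>\<omega>. Z \<omega> * iexp (u * incr n m \<omega>) \<partial>P) - complex_of_real (exp (- (real m * (u\<^sup>2 * v / 2)))) * (\<integral>\<omega>. Z \<omega> \<partial>P)) \<le>
    real m * (\<bar>u\<bar> ^ 3 * c ^ 3 / 6 + (u\<^sup>2 * v / 2)\<^sup>2) * (\<integral>\<omega>. cmod (Z \<omega>) \<partial>P)"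
proof (induction m)
  case 0
  then show ?case by simp
next
  case (Suc m)
  define q where "q = u\<^sup>2 * v / 2"
  define E where "E = (\<integral>\<omega>. cmod (Z \<omega>) \<partial>P)"
  define F where "F m = (\<integral>\<omega>. Z \<omega> * iexp (u * incr n m \<omega>) \<partial>P)" for m
  let ?x = "\<xi> (n + m)"
  \<comment> \<open>The factors of the earlier steps are moved into the test variable: Z' has the
    modulus of Z and belongs to the past of step n + m.\<close>
  define Z' where "Z' \<omega> = Z \<omega> * iexp (u * incr n m \<omega>)" for \<omega>
  define R where "R \<omega> = iexp (u * ?x \<omega>) - (1 + \<i> * (u * ?x \<omega>) - (u * ?x \<omega>)\<^sup>2 / 2)" for \<omega>
  have q: "0 \<le> q" using v_nonneg by (simp add: q_def)
  have Z'd: "determined_by P (H (n + m)) Z'"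
    unfolding Z'_def[abs_def]
    by (rule determined_by_compose2[OF determined_mono[OF _ Z] incr_determined]) simp
  have Z'm [measurable]: "Z' \<in> borel_measurable P" by (rule measurable_determined[OF Z'd])
  have Z_m [measurable]: "Z \<in> borel_measurable P" by (rule measurable_determined[OF Z])
  have Z'n: "cmod (Z' \<omega>) = cmod (Z \<omega>)" for \<omega> by (simp add: Z'_def norm_mult)
  have R_m [measurable]: "R \<in> borel_measurable P" unfolding R_def by measurable
  have R: "cmod (R \<omega>) \<le> \<bar>u\<bar> ^ 3 * c ^ 3 / 6" if "\<omega> \<in> space P" for \<omega>
  proof -
    have "cmod (R \<omega>) \<le> \<bar>u * ?x \<omega>\<bar> ^ 3 / 6"
      unfolding R_def using cmod_iexp_second_order[of "u * ?x \<omega>"] by simp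
    also have "\<dots> \<le> \<bar>u\<bar> ^ 3 * c ^ 3 / 6"
      using \<xi>_bound[OF that] by (auto simp: abs_mult power_mult_distrib intro!: mult_left_mono power_mono)
    finally show ?thesis .
  qed
  have b0: "0 \<le> b"
    using not_empty Zb by (metis ex_in_conv norm_ge_zero order_trans)
  have i0: "integrable P Z'" "integrable P (\<lambda>\<omega>. cmod (Z \<omega>))"
    using Zb by (auto intro!: integrable_bounded[where b=b] simp: Z'n)
  have i1: "integrable P (\<lambda>\<omega>. Z' \<omega> * ?x \<omega>)"
    by (rule integrable_bounded[where b="b * c"])
       (use Zb \<xi>_bound b0 in \<open>auto simp: norm_mult Z'n intro!: mult_mono\<close>)
  have i2: "integrable P (\<lambda>\<omega>. Z' \<omega> * (?x \<omega>)\<^sup>2)"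
    by (rule integrable_bounded[where b="b * c\<^sup>2"])
       (use Zb \<xi>_sq_bound b0 in \<open>auto simp: norm_mult norm_power Z'n intro!: mult_mono\<close>)
  have i3: "integrable P (\<lambda>\<omega>. Z' \<omega> * R \<omega>)"
  proof (rule integrable_bounded[where b="b * (\<bar>u\<bar> ^ 3 * c ^ 3 / 6)"])
    fix \<omega> assume "\<omega> \<in> space P"
    then show "cmod (Z' \<omega> * R \<omega>) \<le> b * (\<bar>u\<bar> ^ 3 * c ^ 3 / 6)"
      unfolding norm_mult Z'n using Zb R b0 by (intro mult_mono) auto
  qed measurable
  have "F (Suc m) = (\<integral>\<omega>. Z' \<omega> * iexp (u * ?x \<omega>) \<partial>P)"
    unfolding F_def Z'_def by (simp add: incr_Suc distrib_left exp_add mult.assoc)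
  also have "\<dots> = (\<integral>\<omega>. Z' \<omega> + (\<i> * u) * (Z' \<omega> * ?x \<omega>) - (u\<^sup>2 / 2) * (Z' \<omega> * (?x \<omega>)\<^sup>2) + Z' \<omega> * R \<omega> \<partial>P)"
    unfolding R_def by (rule Bochner_Integration.integral_cong) (auto simp: algebra_simps power2_eq_square)
  also have "\<dots> = (\<integral>\<omega>. Z' \<omega> \<partial>P) + (\<i> * u) * (\<integral>\<omega>. Z' \<omega> * ?x \<omega> \<partial>P) -
      (u\<^sup>2 / 2) * (\<integral>\<omega>. Z' \<omega> * (?x \<omega>)\<^sup>2 \<partial>P) + (\<integral>\<omega>. Z' \<omega> * R \<omega> \<partial>P)"
    using i0 i1 i2 i3 by simp
  also have "(\<integral>\<omega>. Z' \<omega> * ?x \<omega> \<partial>P) = 0"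
    by (rule \<xi>_mean[OF Z'd, where b=b]) (simp add: Z'n Zb)
  also have "(\<integral>\<omega>. Z' \<omega> * (?x \<omega>)\<^sup>2 \<partial>P) = v * (\<integral>\<omega>. Z' \<omega> \<partial>P)"
    by (rule \<xi>_variance[OF Z'd, where b=b]) (simp add: Z'n Zb)
  also have "(\<integral>\<omega>. Z' \<omega> \<partial>P) = F m" by (simp add: F_def Z'_def)
  finally have FS: "F (Suc m) = (1 - q) * F m + (\<integral>\<omega>. Z' \<omega> * R \<omega> \<partial>P)"
    by (simp add: q_def algebra_simps)
  have "cmod (\<integral>\<omega>. Z' \<omega> * R \<omega> \<partial>P) \<le> (\<integral>\<omega>. cmod (Z' \<omega> * R \<omega>) \<partial>P)" by simp
  also have "\<dots> \<le> (\<integral>\<omega>. (\<bar>u\<bar> ^ 3 * c ^ 3 / 6) * cmod (Z \<omega>) \<partial>P)"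
  proof (rule integral_mono)
    fix \<omega> assume "\<omega> \<in> space P"
    then show "cmod (Z' \<omega> * R \<omega>) \<le> (\<bar>u\<bar> ^ 3 * c ^ 3 / 6) * cmod (Z \<omega>)"
      using mult_right_mono[OF R, of \<omega> "cmod (Z \<omega>)"] by (simp add: norm_mult Z'n mult.commute)
  qed (use i0 i3 in auto)
  finally have r1: "cmod (\<integral>\<omega>. Z' \<omega> * R \<omega> \<partial>P) \<le> (\<bar>u\<bar> ^ 3 * c ^ 3 / 6) * E"
    by (simp add: E_def)
  have Fm: "cmod (F m) \<le> E"
  proof -
    have "cmod (F m) \<le> (\<integral>\<omega>. cmod (Z' \<omega>) \<partial>P)"
      unfolding F_def Z'_def by (rule integral_norm_bound)
    then show ?thesis by (simp add: Z'n E_def)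
  qed
  have r2: "cmod (of_real ((1 - q) - exp (- q)) * F m) \<le> q\<^sup>2 * E"
    unfolding norm_mult norm_of_real using abs_exp_minus_linear_le[OF q] Fm
    by (intro mult_mono) (auto simp: abs_minus_commute)
  have r3: "cmod (of_real (exp (- q)) * (F m - complex_of_real (exp (- (real m * q))) * (\<integral>\<omega>. Z \<omega> \<partial>P))) \<le>
      1 * (real m * (\<bar>u\<bar> ^ 3 * c ^ 3 / 6 + q\<^sup>2) * E)"
    unfolding norm_mult norm_of_real using Suc q
    by (intro mult_mono) (auto simp: F_def q_def E_def)
  have exp_Suc: "exp (- (real (Suc m) * q)) = exp (- q) * exp (- (real m * q))"
    by (simp add: exp_add[symmetric] algebra_simps)
  \<comment> \<open>Three errors: the Taylor remainder of the new step, the exchange of 1 - q for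
    exp (- q), and the error of the induction hypothesis damped by exp (- q).\<close>
  have "F (Suc m) - complex_of_real (exp (- (real (Suc m) * q))) * (\<integral>\<omega>. Z \<omega> \<partial>P) =
      (\<integral>\<omega>. Z' \<omega> * R \<omega> \<partial>P) + of_real ((1 - q) - exp (- q)) * F m +
      of_real (exp (- q)) * (F m - complex_of_real (exp (- (real m * q))) * (\<integral>\<omega>. Z \<omega> \<partial>P))"
    unfolding FS exp_Suc of_real_mult by (simp add: algebra_simps)
  then have "cmod (F (Suc m) - complex_of_real (exp (- (real (Suc m) * q))) * (\<integral>\<omega>. Z \<omega> \<partial>P)) \<le>
      (\<bar>u\<bar> ^ 3 * c ^ 3 / 6) * E + q\<^sup>2 * E + 1 * (real m * (\<bar>u\<bar> ^ 3 * c ^ 3 / 6 + q\<^sup>2) * E)"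
    using r1 r2 r3 by (auto intro!: order_trans[OF norm_triangle_ineq] add_mono)
  also have "\<dots> = real (Suc m) * (\<bar>u\<bar> ^ 3 * c ^ 3 / 6 + q\<^sup>2) * E" by (simp add: algebra_simps)
  finally show ?case by (simp add: F_def q_def E_def)
qed

end

section \<open>Asymptotics of a single block increment\<close>

context bounded_martingale
begin

text \<open>A step of size s contributes errors of order s^3 and s^4, while m s^2 stays bounded;
  factoring out m s^2 leaves terms that vanish with s.\<close>

lemma char_error_tendsto:
  fixes s :: "nat \<Rightarrow> real" and m :: "nat \<Rightarrow> nat"
  assumes s: "\<And>k. 0 \<le> s k" "s \<longlonglongrightarrow> 0" "(\<lambda>k. real (m k) * (s k)\<^sup>2) \<longlonglongrightarrow> \<tau>"
  shows "(\<lambda>k. real (m k) * (\<bar>\<theta> * s k\<bar> ^ 3 * c ^ 3 / 6 + ((\<theta> * s k)\<^sup>2 * v / 2)\<^sup>2)) \<longlonglongrightarrow> 0"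
proof -
  have "(\<lambda>k. real (m k) * (s k)\<^sup>2 * (\<bar>\<theta>\<bar> ^ 3 * c ^ 3 / 6 * s k + (\<theta>\<^sup>2 * v / 2)\<^sup>2 * (s k)\<^sup>2))
      \<longlonglongrightarrow> \<tau> * (\<bar>\<theta>\<bar> ^ 3 * c ^ 3 / 6 * 0 + (\<theta>\<^sup>2 * v / 2)\<^sup>2 * 0\<^sup>2)"
    by (intro tendsto_intros s)
  then have "(\<lambda>k. real (m k) * (s k)\<^sup>2 * (\<bar>\<theta>\<bar> ^ 3 * c ^ 3 / 6 * s k + (\<theta>\<^sup>2 * v / 2)\<^sup>2 * (s k)\<^sup>2)) \<longlonglongrightarrow> 0"
    by simp
  moreover have "real (m k) * (s k)\<^sup>2 * (\<bar>\<theta>\<bar> ^ 3 * c ^ 3 / 6 * s k + (\<theta>\<^sup>2 * v / 2)\<^sup>2 * (s k)\<^sup>2) =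
      real (m k) * (\<bar>\<theta> * s k\<bar> ^ 3 * c ^ 3 / 6 + ((\<theta> * s k)\<^sup>2 * v / 2)\<^sup>2)" for k
    using s(1)[of k] by (simp add: abs_mult power_mult_distrib power2_eq_square power3_eq_cube algebra_simps)
  ultimately show ?thesis by (simp only:)
qed

lemma char_limit_tendsto:
  fixes s :: "nat \<Rightarrow> real" and m :: "nat \<Rightarrow> nat"
  assumes s: "(\<lambda>k. real (m k) * (s k)\<^sup>2) \<longlonglongrightarrow> \<tau>"
  shows "(\<lambda>k. complex_of_real (exp (- (real (m k) * ((\<theta> * s k)\<^sup>2 * v / 2))))) \<longlonglongrightarrow>
    char (centred_gaussian (sqrt (v * \<tau>))) \<theta>"
proof -
  have "0 \<le> \<tau>" by (rule LIMSEQ_le_const[OF s]) auto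
  then have sq: "(sqrt (v * \<tau>))\<^sup>2 = v * \<tau>" using v_nonneg by simp
  have "(\<lambda>k. complex_of_real (exp (- (\<theta>\<^sup>2 * v / 2 * (real (m k) * (s k)\<^sup>2))))) \<longlonglongrightarrow>
      complex_of_real (exp (- (\<theta>\<^sup>2 * v / 2 * \<tau>)))"
    by (intro tendsto_of_real tendsto_exp tendsto_minus tendsto_mult tendsto_const s)
  then show ?thesis
    unfolding char_centred_gaussian sq by (simp add: power_mult_distrib mult_ac)
qed

text \<open>\<open>char_incr\<close> for the indicator of A, divided by the probability of A. The
  resulting bound does not mention A, which provides the uniformity over atoms in
  \<open>martingale_step\<close>.\<close>

lemma char_incr_event:
  assumes A: "determined_by P (H n) (\<lambda>\<omega>. \<omega> \<in> A)" "A \<in> events" "prob A > 0"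
  shows "cmod (char (distr (uniform_measure P A) borel (\<lambda>\<omega>. r * incr n m \<omega>)) \<theta> -
      exp (- (real m * ((\<theta> * r)\<^sup>2 * v / 2)))) \<le>
    real m * (\<bar>\<theta> * r\<bar> ^ 3 * c ^ 3 / 6 + ((\<theta> * r)\<^sup>2 * v / 2)\<^sup>2)"
    (is "cmod (?char - complex_of_real ?e) \<le> ?err")
proof -
  let ?Z = "\<lambda>\<omega>. indicator A \<omega> :: complex"
  have "determined_by P (H n) ?Z"
    unfolding indicator_def by (rule determined_by_compose[OF A(1)])
  from char_incr[OF this, of 1 "\<theta> * r" m]
  have "cmod ((\<integral>\<omega>. ?Z \<omega> * iexp (\<theta> * r * incr n m \<omega>) \<partial>P) - complex_of_real ?e * (\<integral>\<omega>. ?Z \<omega> \<partial>P)) \<le>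
      ?err * (\<integral>\<omega>. cmod (?Z \<omega>) \<partial>P)"
    by (simp add: indicator_def)
  moreover have "(\<integral>\<omega>. ?Z \<omega> \<partial>P) = prob A"
  proof -
    have "?Z = (\<lambda>\<omega>. complex_of_real (indicator A \<omega>))" by (auto simp: indicator_def)
    then show ?thesis using A(2) by simp
  qed
  moreover have "(\<integral>\<omega>. cmod (?Z \<omega>) \<partial>P) = prob A"
  proof -
    have "(\<lambda>\<omega>. cmod (?Z \<omega>)) = indicator A" by (auto simp: indicator_def)
    then show ?thesis using A(2) by simp
  qed
  moreover have "(\<integral>\<omega>. ?Z \<omega> * iexp (\<theta> * r * incr n m \<omega>) \<partial>P) = prob A * ?char"
  proof -
    have "?char = (\<integral>\<omega>. iexp (\<theta> * (r * incr n m \<omega>)) \<partial>uniform_measure P A)"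
      unfolding char_def by (subst integral_distr) auto
    also have "\<dots> = (1 / prob A) *\<^sub>R (\<integral>\<omega>. indicator A \<omega> *\<^sub>R iexp (\<theta> * (r * incr n m \<omega>)) \<partial>P)"
      by (rule integral_uniform_measure[OF A(2,3)]) simp
    also have "(\<integral>\<omega>. indicator A \<omega> *\<^sub>R iexp (\<theta> * (r * incr n m \<omega>)) \<partial>P) = (\<integral>\<omega>. ?Z \<omega> * iexp (\<theta> * r * incr n m \<omega>) \<partial>P)"
      by (rule Bochner_Integration.integral_cong) (auto simp: indicator_def mult_ac)
    finally show ?thesis using A(3) by (simp add: scaleR_conv_of_real)
  qed
  ultimately have "cmod (prob A * (?char - complex_of_real ?e)) \<le> ?err * prob A"
    by (simp add: algebra_simps)
  then have "prob A * cmod (?char - complex_of_real ?e) \<le> prob A * ?err"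
    by (simp add: norm_mult mult.commute)
  then show ?thesis using A(3) by (simp add: mult_le_cancel_left_pos)
qed

text \<open>
  Conditioning on an atom of the history turns \<open>F k\<close> into a fixed function. The convergence has to
  be uniform over the atoms, so for each \<open>k\<close> a worst atom is chosen and the weak convergence is
  applied to the resulting sequence.
\<close>
lemma martingale_step:
  fixes s :: "nat \<Rightarrow> real" and a m :: "nat \<Rightarrow> nat" and F :: "nat \<Rightarrow> 'a \<Rightarrow> real \<Rightarrow> real"
  assumes s: "\<And>k. 0 \<le> s k" "s \<longlonglongrightarrow> 0" "(\<lambda>k. real (m k) * (s k)\<^sup>2) \<longlonglongrightarrow> \<tau>"
    and det: "\<And>k. determined_by P (H (a k)) (F k)"
    and bound: "\<And>k \<omega> y. \<bar>F k \<omega> y\<bar> \<le> B"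
    and lip: "\<And>k \<omega> x y. \<bar>F k \<omega> x - F k \<omega> y\<bar> \<le> L * \<bar>x - y\<bar>"
  shows "(\<lambda>k. (\<integral>\<omega>. F k \<omega> (s k * incr (a k) (m k) \<omega>) \<partial>P) -
      (\<integral>\<omega>. (\<integral>y. F k \<omega> y \<partial>centred_gaussian (sqrt (v * \<tau>))) \<partial>P)) \<longlonglongrightarrow> 0"
proof -
  define \<gamma> where "\<gamma> = centred_gaussian (sqrt (v * \<tau>))"
  interpret \<gamma>: real_distribution \<gamma> unfolding \<gamma>_def by (rule real_distribution_centred_gaussian)
  define D where "D k \<omega> = s k * incr (a k) (m k) \<omega>" for k \<omega>
  define I where "I k \<omega> = (\<integral>y. F k \<omega> y \<partial>\<gamma>)" for k \<omega>
  define G where "G k \<omega> = F k \<omega> (D k \<omega>) - I k \<omega>" for k \<omega>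
  define A where "A k h = {\<omega> \<in> space P. H (a k) \<omega> = h}" for k h
  have F_meas [measurable]: "F k \<omega> \<in> borel_measurable borel" for k \<omega>
    by (rule lipschitz_imp_borel_measurable[OF lip])
  have D_meas [measurable]: "D k \<in> borel_measurable P" for k unfolding D_def by measurable
  have Fint: "integrable \<gamma> (F k \<omega>)" for k \<omega>
    using bound by (intro \<gamma>.integrable_const_bound[of _ B]) auto
  have I_bound: "\<bar>I k \<omega>\<bar> \<le> B" for k \<omega>
  proof -
    have "\<bar>I k \<omega>\<bar> \<le> (\<integral>y. \<bar>F k \<omega> y\<bar> \<partial>\<gamma>)" unfolding I_def by (rule integral_abs_bound)
    also have "\<dots> \<le> (\<integral>y. B \<partial>\<gamma>)" using Fint bound by (intro integral_mono) auto
    finally show ?thesis using \<gamma>.prob_space by simp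
  qed
  have FD_det: "determined_by P (H (a k + m k)) (\<lambda>\<omega>. F k \<omega> (D k \<omega>))" for k
    unfolding D_def by (rule determined_by_compose2[OF determined_mono[OF _ det] incr_determined]) simp
  have FD_int: "integrable P (\<lambda>\<omega>. F k \<omega> (D k \<omega>))" for k
    by (rule integrable_bounded[OF measurable_determined[OF FD_det], where b=B]) (use bound in auto)
  have I_det: "determined_by P (H (a k)) (I k)" for k
    unfolding I_def[abs_def] by (rule determined_by_compose[OF det])
  have I_int: "integrable P (I k)" for k
    by (rule integrable_bounded[OF measurable_determined[OF I_det], where b=B]) (use I_bound in auto)
  have G_int: "integrable P (G k)" for k
    unfolding G_def[abs_def] using FD_int I_int by simp
  have A_events [measurable]: "A k h \<in> events" for k h
  proof -
    have "A k h = H (a k) -` {h} \<inter> space P" by (auto simp: A_def)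
    then show ?thesis using measurable_sets[OF H_measurable[of "a k"], of "{h}"] by simp
  qed
  have A_det: "determined_by P (H (a k)) (\<lambda>\<omega>. \<omega> \<in> A k h)" for k h
    by (auto simp: determined_by_def A_def)
  have main: "\<forall>\<^sub>F k in sequentially. \<forall>h. \<bar>\<integral>\<omega>. indicator (A k h) \<omega> * G k \<omega> \<partial>P\<bar> \<le> \<epsilon> * prob (A k h)"
    if "\<epsilon> > 0" for \<epsilon>
  proof -
    define bad where "bad k h \<longleftrightarrow> \<epsilon> * prob (A k h) < \<bar>\<integral>\<omega>. indicator (A k h) \<omega> * G k \<omega> \<partial>P\<bar>" for k h
    \<comment> \<open>The inequality in \<open>bad\<close> is strict and both of its sides vanish on
      a null atom, so conditioning on a bad atom makes sense.\<close>
    have bad_pos: "prob (A k h) > 0" if "bad k h" for k h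
    proof (rule ccontr)
      assume "\<not> prob (A k h) > 0"
      then have p0: "prob (A k h) = 0" using measure_nonneg[of P "A k h"] by simp
      then have "A k h \<in> null_sets P" by (auto simp: emeasure_eq_measure)
      then have "AE \<omega> in P. \<omega> \<notin> A k h" by (rule AE_not_in)
      then have "(\<integral>\<omega>. indicator (A k h) \<omega> * G k \<omega> \<partial>P) = 0"
        by (intro integral_eq_zero_AE) (auto elim!: eventually_mono)
      with that p0 show False by (simp add: bad_def)
    qed
    define h0 where "h0 k = (SOME h. bad k h)" for k
    define w where "w k = (SOME \<omega>. \<omega> \<in> A k (h0 k))" for k
    \<comment> \<open>When no atom is bad at index k, the limit law and the zero function fill the
      gap: they keep the sequence convergent and contribute a difference of 0.\<close>
    define \<mu> where "\<mu> k = (if \<exists>h. bad k h then distr (uniform_measure P (A k (h0 k))) borel (D k) else \<gamma>)" for k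
    define \<phi> where "\<phi> k = (if \<exists>h. bad k h then F k (w k) else (\<lambda>_. 0))" for k
    have bad_h0: "bad k (h0 k)" if "\<exists>h. bad k h" for k
      unfolding h0_def by (rule someI_ex[OF that])
    have w: "w k \<in> A k (h0 k)" if "\<exists>h. bad k h" for k
    proof -
      have "A k (h0 k) \<noteq> {}" using bad_pos[OF bad_h0[OF that]] by auto
      then show ?thesis unfolding w_def by (rule some_in_eq[THEN iffD2])
    qed
    have L0: "0 \<le> L" using lip[of 0 undefined 1 0] by simp
    have B0: "0 \<le> B" using bound[of 0 undefined 0] by linarith
    have "(\<lambda>k. (\<integral>x. \<phi> k x \<partial>\<mu> k) - (\<integral>x. \<phi> k x \<partial>\<gamma>)) \<longlonglongrightarrow> 0"
    proof (rule char_tendsto_imp_bounded_lipschitz_tendsto)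
      show "real_distribution \<gamma>" by unfold_locales
      show "real_distribution (\<mu> k)" for k
      proof (cases "\<exists>h. bad k h")
        case True
        have "emeasure P (A k (h0 k)) \<noteq> 0"
          using bad_pos[OF bad_h0[OF True]] by (simp add: emeasure_eq_measure)
        then interpret U: prob_space "uniform_measure P (A k (h0 k))"
          by (intro prob_space_uniform_measure) auto
        show ?thesis unfolding \<mu>_def using True by (auto intro!: U.real_distribution_distr)
      next
        case False
        then show ?thesis
          using \<gamma>.real_distribution_axioms unfolding \<mu>_def by presburger
      qed
      show "\<bar>\<phi> k x\<bar> \<le> B" for k x using bound B0 by (simp add: \<phi>_def)
      show "\<bar>\<phi> k x - \<phi> k y\<bar> \<le> L * \<bar>x - y\<bar>" for k x y using lip L0 by (simp add: \<phi>_def)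
      fix \<theta>
      define err where "err k = real (m k) * (\<bar>\<theta> * s k\<bar> ^ 3 * c ^ 3 / 6 + ((\<theta> * s k)\<^sup>2 * v / 2)\<^sup>2)" for k
      define e where "e k = complex_of_real (exp (- (real (m k) * ((\<theta> * s k)\<^sup>2 * v / 2))))" for k
      have err: "err \<longlonglongrightarrow> 0" unfolding err_def[abs_def] by (rule char_error_tendsto[OF s])
      have e: "e \<longlonglongrightarrow> char \<gamma> \<theta>" unfolding e_def[abs_def] \<gamma>_def by (rule char_limit_tendsto[OF s(3)])
      have err0: "0 \<le> err k" for k unfolding err_def using c_nonneg by simp
      have "cmod (char (\<mu> k) \<theta> - char \<gamma> \<theta>) \<le> err k + cmod (e k - char \<gamma> \<theta>)" for k
      proof (cases "\<exists>h. bad k h")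
        case True
        have "cmod (char (\<mu> k) \<theta> - e k) \<le> err k"
          unfolding \<mu>_def e_def err_def D_def[abs_def] using True
          by (simp only: if_True) (rule char_incr_event[OF A_det A_events bad_pos[OF bad_h0[OF True]]])
        then show ?thesis using norm_triangle_ineq[of "char (\<mu> k) \<theta> - e k" "e k - char \<gamma> \<theta>"] by simp
      next
        case False
        then show ?thesis using err0[of k] by (simp add: \<mu>_def)
      qed
      then have "\<forall>\<^sub>F k in sequentially. norm (char (\<mu> k) \<theta> - char \<gamma> \<theta>) \<le> err k + cmod (e k - char \<gamma> \<theta>)"
        by simp
      moreover have "(\<lambda>k. err k + cmod (e k - char \<gamma> \<theta>)) \<longlonglongrightarrow> 0 + cmod (char \<gamma> \<theta> - char \<gamma> \<theta>)"
        by (intro tendsto_intros err e)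
      then have "(\<lambda>k. err k + cmod (e k - char \<gamma> \<theta>)) \<longlonglongrightarrow> 0" by simp
      ultimately have "(\<lambda>k. char (\<mu> k) \<theta> - char \<gamma> \<theta>) \<longlonglongrightarrow> 0" by (rule Lim_null_comparison)
      then show "(\<lambda>k. char (\<mu> k) \<theta>) \<longlonglongrightarrow> char \<gamma> \<theta>" by (rule LIM_zero_cancel)
    qed
    from tendstoD[OF this \<open>\<epsilon> > 0\<close>]
    have "\<forall>\<^sub>F k in sequentially. \<bar>(\<integral>x. \<phi> k x \<partial>\<mu> k) - (\<integral>x. \<phi> k x \<partial>\<gamma>)\<bar> < \<epsilon>"
      by (simp add: dist_real_def)
    then show ?thesis
    proof eventually_elim
      case (elim k)
      \<comment> \<open>On the chosen atom C, the difference of the two integrals of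
        \<open>\<phi> k\<close> is the integral of \<open>G k\<close> over C divided by the
        probability of C. Badness would make it larger than \<epsilon>, against the weak
        convergence.\<close>
      have "\<not> (\<exists>h. bad k h)"
      proof
        assume ex: "\<exists>h. bad k h"
        define C where "C = A k (h0 k)"
        have C [measurable]: "C \<in> events" and p: "prob C > 0" and wC: "w k \<in> C"
          unfolding C_def using bad_pos[OF bad_h0[OF ex]] w[OF ex] by auto
        \<comment> \<open>All points of an atom share one history, so \<open>F k\<close> may be
          frozen at the representative \<open>w k\<close>.\<close>
        have eq: "F k \<omega> = F k (w k)" if "\<omega> \<in> C" for \<omega>
          by (rule determined_byD[OF det]) (use that wC in \<open>auto simp: C_def A_def\<close>)
        have 1: "(\<integral>x. \<phi> k x \<partial>\<mu> k) = (1 / prob C) * (\<integral>\<omega>. indicator C \<omega> * F k \<omega> (D k \<omega>) \<partial>P)"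
        proof -
          have "(\<integral>x. \<phi> k x \<partial>\<mu> k) = (\<integral>\<omega>. F k (w k) (D k \<omega>) \<partial>uniform_measure P C)"
            unfolding \<phi>_def \<mu>_def C_def using ex by (simp add: integral_distr)
          also have "\<dots> = (1 / prob C) *\<^sub>R (\<integral>\<omega>. indicator C \<omega> *\<^sub>R F k (w k) (D k \<omega>) \<partial>P)"
            by (rule integral_uniform_measure[OF C p]) simp
          also have "(\<integral>\<omega>. indicator C \<omega> *\<^sub>R F k (w k) (D k \<omega>) \<partial>P) = (\<integral>\<omega>. indicator C \<omega> * F k \<omega> (D k \<omega>) \<partial>P)"
            by (rule Bochner_Integration.integral_cong) (auto simp: indicator_def eq)
          finally show ?thesis by simp
        qed
        have 2: "(\<integral>x. \<phi> k x \<partial>\<gamma>) = (1 / prob C) * (\<integral>\<omega>. indicator C \<omega> * I k \<omega> \<partial>P)"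
        proof -
          have "(\<integral>\<omega>. indicator C \<omega> * I k \<omega> \<partial>P) = (\<integral>\<omega>. indicator C \<omega> * I k (w k) \<partial>P)"
            by (rule Bochner_Integration.integral_cong) (auto simp: indicator_def I_def eq)
          then show ?thesis using p ex by (simp add: \<phi>_def I_def)
        qed
        have "(\<integral>\<omega>. indicator C \<omega> * G k \<omega> \<partial>P) =
            (\<integral>\<omega>. indicator C \<omega> * F k \<omega> (D k \<omega>) - indicator C \<omega> * I k \<omega> \<partial>P)"
          by (simp add: G_def algebra_simps)
        also have "\<dots> = (\<integral>\<omega>. indicator C \<omega> * F k \<omega> (D k \<omega>) \<partial>P) - (\<integral>\<omega>. indicator C \<omega> * I k \<omega> \<partial>P)"
          using integrable_mult_indicator[OF C FD_int[of k]] integrable_mult_indicator[OF C I_int[of k]] by simp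
        finally have "(\<integral>x. \<phi> k x \<partial>\<mu> k) - (\<integral>x. \<phi> k x \<partial>\<gamma>) = (\<integral>\<omega>. indicator C \<omega> * G k \<omega> \<partial>P) / prob C"
          unfolding 1 2 by (simp add: diff_divide_distrib)
        then have "\<bar>\<integral>\<omega>. indicator C \<omega> * G k \<omega> \<partial>P\<bar> < \<epsilon> * prob C"
          using elim p by (simp add: pos_divide_less_eq)
        with bad_h0[OF ex] show False by (simp add: bad_def C_def)
      qed
      then show ?case by (auto simp: bad_def not_less)
    qed
  qed
  have "(\<lambda>k. \<integral>\<omega>. G k \<omega> \<partial>P) \<longlonglongrightarrow> 0"
  proof (rule LIMSEQ_I)
    fix \<epsilon> :: real assume "\<epsilon> > 0"
    then have "\<epsilon> / 2 > 0" by simp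
    from main[OF this] obtain k0 where k0: "\<And>k h. k \<ge> k0 \<Longrightarrow>
        \<bar>\<integral>\<omega>. indicator (A k h) \<omega> * G k \<omega> \<partial>P\<bar> \<le> \<epsilon> / 2 * prob (A k h)"
      unfolding eventually_sequentially by blast
    have "\<bar>\<integral>\<omega>. G k \<omega> \<partial>P\<bar> \<le> \<epsilon> / 2" if "k \<ge> k0" for k
      using k0[OF that] unfolding A_def
      by (intro norm_integral_le_of_atoms[OF H_measurable[of "a k"] G_int])
    then show "\<exists>no. \<forall>k\<ge>no. norm ((\<integral>\<omega>. G k \<omega> \<partial>P) - 0) < \<epsilon>"
      using \<open>\<epsilon> > 0\<close> by (intro exI[of _ k0]) fastforce
  qed
  moreover have "(\<integral>\<omega>. G k \<omega> \<partial>P) = (\<integral>\<omega>. F k \<omega> (D k \<omega>) \<partial>P) - (\<integral>\<omega>. I k \<omega> \<partial>P)" for k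
    unfolding G_def using FD_int I_int by simp
  ultimately show ?thesis by (simp add: D_def I_def \<gamma>_def)
qed

end

text \<open>Vectors of every length are kept as sequences in one type. The test functions are
  Lipschitz in finitely many coordinates only, hence blind to the tail, and any default may stand
  there.\<close>

definition extend_at :: "nat \<Rightarrow> (nat \<Rightarrow> real) \<Rightarrow> real \<Rightarrow> nat \<Rightarrow> real" where
  "extend_at m x y = (\<lambda>i. if i < m then x i else if i = m then y else 0)"

lemma coordinate_lipschitz_imp_borel_measurable:
  fixes h :: "(nat \<Rightarrow> real) \<Rightarrow> real"
  assumes lip: "\<And>x y. \<bar>h x - h y\<bar> \<le> L * (\<Sum>i<m. \<bar>x i - y i\<bar>)"
  shows "h \<in> borel_measurable borel"
proof (rule borel_measurable_continuous_onI, rule continuous_at_imp_continuous_on, intro ballI)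
  fix x :: "nat \<Rightarrow> real"
  have c: "((\<lambda>y. y i) \<longlongrightarrow> x i) (at x)" for i
  proof -
    have "continuous_on UNIV (\<lambda>y :: nat \<Rightarrow> real. y i)" by (rule continuous_on_product_coordinates)
    then show ?thesis by (simp add: continuous_on_def)
  qed
  have "((\<lambda>y. h y - h x) \<longlongrightarrow> 0) (at x)"
  proof (rule Lim_null_comparison)
    show "\<forall>\<^sub>F y in at x. norm (h y - h x) \<le> L * (\<Sum>i<m. \<bar>y i - x i\<bar>)" using lip by simp
    have "((\<lambda>y. L * (\<Sum>i<m. \<bar>y i - x i\<bar>)) \<longlongrightarrow> L * (\<Sum>i<m. \<bar>x i - x i\<bar>)) (at x)"
      by (intro tendsto_mult tendsto_const tendsto_sum tendsto_rabs tendsto_diff c)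
    then show "((\<lambda>y. L * (\<Sum>i<m. \<bar>y i - x i\<bar>)) \<longlongrightarrow> 0) (at x)" by simp
  qed
  then show "isCont h x" unfolding isCont_def by (rule LIM_zero_cancel)
qed

text \<open>Fubini's theorem for the last of m + 1 independent variables. On the Gaussian side this
  does what \<open>martingale_step\<close> does for the chain: the last coordinate is replaced by
  integration against its law.\<close>

lemma (in prob_space) integral_indep_last:
  fixes h :: "(nat \<Rightarrow> real) \<Rightarrow> real"
  assumes ind: "indep_vars (\<lambda>_. borel) G {..<Suc m}" and dist: "distr M borel (G m) = \<gamma>"
    and bound: "\<And>x. \<bar>h x\<bar> \<le> B"
    and lip: "\<And>x y. \<bar>h x - h y\<bar> \<le> L * (\<Sum>i<Suc m. \<bar>x i - y i\<bar>)"
  shows "(\<integral>\<omega>. h (\<lambda>i. G i \<omega>) \<partial>M) = (\<integral>\<omega>. (\<integral>y. h (extend_at m (\<lambda>i. G i \<omega>) y) \<partial>\<gamma>) \<partial>M)"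
proof -
  let ?N = "PiM {..<m} (\<lambda>_. borel :: real measure)"
  let ?V = "\<lambda>\<omega>. restrict (\<lambda>i. G i \<omega>) {..<m}"
  let ?N' = "PiM {m} (\<lambda>_. borel :: real measure)"
  let ?W = "\<lambda>\<omega>. restrict (\<lambda>i. G i \<omega>) {m}"
  let ?f = "\<lambda>(x, w). h (extend_at m x (w m))"
  have hm [measurable]: "h \<in> borel_measurable borel"
    by (rule coordinate_lipschitz_imp_borel_measurable[OF lip])
  have "indep_var ?N ?V ?N' ?W"
    by (rule indep_var_restrict[OF ind]) auto
  then have V [measurable]: "?V \<in> measurable M ?N" and W [measurable]: "?W \<in> measurable M ?N'"
    and joint: "distr M ?N ?V \<Otimes>\<^sub>M distr M ?N' ?W = distr M (?N \<Otimes>\<^sub>M ?N') (\<lambda>\<omega>. (?V \<omega>, ?W \<omega>))"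
    using indep_var_distribution_eq by blast+
  have Gm [measurable]: "G m \<in> borel_measurable M"
    using ind by (auto simp: indep_vars_def)
  interpret V: prob_space "distr M ?N ?V" by (rule prob_space_distr[OF V])
  interpret W: prob_space "distr M ?N' ?W" by (rule prob_space_distr[OF W])
  interpret VW: pair_prob_space "distr M ?N ?V" "distr M ?N' ?W" ..
  have coord: "(\<lambda>w. w m) \<in> borel_measurable ?N'"
    by (rule measurable_component_singleton) simp
  have ext: "(\<lambda>p. extend_at m (fst p) (snd p m)) \<in> measurable (?N \<Otimes>\<^sub>M ?N') borel"
  proof (rule measurable_coordinatewise_then_product)
    fix i
    have "(\<lambda>p. fst p i) \<in> borel_measurable (?N \<Otimes>\<^sub>M ?N')" if "i < m"
      by (rule measurable_compose[OF measurable_fst measurable_component_singleton]) (use that in simp)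
    moreover have "(\<lambda>p. snd p m) \<in> borel_measurable (?N \<Otimes>\<^sub>M ?N')"
      by (rule measurable_compose[OF measurable_snd coord])
    ultimately show "(\<lambda>p. extend_at m (fst p) (snd p m) i) \<in> borel_measurable (?N \<Otimes>\<^sub>M ?N')"
      by (cases "i < m"; cases "i = m") (auto simp: extend_at_def)
  qed
  have f [measurable]: "?f \<in> borel_measurable (?N \<Otimes>\<^sub>M ?N')"
    using measurable_compose[OF ext hm] by (simp add: case_prod_beta')
  have eq0: "h x = h y" if "\<And>i. i < Suc m \<Longrightarrow> x i = y i" for x y
    using lip[of x y] that by simp
  have ext_lip: "\<bar>h (extend_at m x y) - h (extend_at m x y')\<bar> \<le> L * \<bar>y - y'\<bar>" for x y y'
    using lip[of "extend_at m x y" "extend_at m x y'"] by (simp add: extend_at_def)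
  have m_ext [measurable]: "(\<lambda>y. h (extend_at m x y)) \<in> borel_measurable borel" for x
    by (rule lipschitz_imp_borel_measurable[OF ext_lip])
  have inner: "(\<integral>w. ?f (x, w) \<partial>distr M ?N' ?W) = (\<integral>y. h (extend_at m x y) \<partial>\<gamma>)" for x
  proof -
    have "(\<integral>w. ?f (x, w) \<partial>distr M ?N' ?W) = (\<integral>\<omega>. ?f (x, ?W \<omega>) \<partial>M)"
      by (rule integral_distr[OF W]) (use measurable_compose[OF coord m_ext] in simp)
    also have "\<dots> = (\<integral>\<omega>. h (extend_at m x (G m \<omega>)) \<partial>M)" by simp
    also have "\<dots> = (\<integral>y. h (extend_at m x y) \<partial>distr M borel (G m))"
      by (rule integral_distr[symmetric]) measurable
    finally show ?thesis by (simp only: dist)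
  qed
  have "(\<integral>\<omega>. h (\<lambda>i. G i \<omega>) \<partial>M) = (\<integral>\<omega>. ?f (?V \<omega>, ?W \<omega>) \<partial>M)"
    by (rule Bochner_Integration.integral_cong) (auto intro!: eq0 simp: extend_at_def less_Suc_eq)
  also have "\<dots> = integral\<^sup>L (distr M (?N \<Otimes>\<^sub>M ?N') (\<lambda>\<omega>. (?V \<omega>, ?W \<omega>))) ?f"
    by (rule integral_distr[symmetric, OF measurable_Pair[OF V W] f])
  also have "\<dots> = integral\<^sup>L (distr M ?N ?V \<Otimes>\<^sub>M distr M ?N' ?W) ?f"
    by (simp only: joint)
  also have "\<dots> = (\<integral>x. (\<integral>w. ?f (x, w) \<partial>distr M ?N' ?W) \<partial>distr M ?N ?V)"
  proof (rule VW.integral_fst'[symmetric])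
    have "?f \<in> borel_measurable (distr M ?N ?V \<Otimes>\<^sub>M distr M ?N' ?W)"
      using f by (simp cong: measurable_cong_sets sets_pair_measure_cong)
    then show "integrable (distr M ?N ?V \<Otimes>\<^sub>M distr M ?N' ?W) ?f"
      using bound by (intro VW.integrable_const_bound[of _ B]) auto
  qed
  also have "\<dots> = (\<integral>\<omega>. (\<integral>w. ?f (?V \<omega>, w) \<partial>distr M ?N' ?W) \<partial>M)"
  proof (rule integral_distr[OF V])
    have "case_prod (\<lambda>x w. ?f (x, w)) \<in> borel_measurable (?N \<Otimes>\<^sub>M distr M ?N' ?W)"
      using f by (simp cong: measurable_cong_sets sets_pair_measure_cong)
    then show "(\<lambda>x. \<integral>w. ?f (x, w) \<partial>distr M ?N' ?W) \<in> borel_measurable ?N"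
      by (rule W.borel_measurable_lebesgue_integral)
  qed
  also have "\<dots> = (\<integral>\<omega>. (\<integral>y. h (extend_at m (\<lambda>i. G i \<omega>) y) \<partial>\<gamma>) \<partial>M)"
  proof -
    have "extend_at m (?V \<omega>) y = extend_at m (\<lambda>i. G i \<omega>) y" for \<omega> y
      by (auto simp: extend_at_def)
    then show ?thesis by (simp only: inner)
  qed
  finally show ?thesis .
qed

context bounded_martingale
begin

text \<open>Induction on the number of blocks. Integrating the last coordinate against the Gaussian
  law turns h into h', which is again bounded by B and Lipschitz with the same L, in one coordinate
  fewer. The chain is reduced from h to h' by \<open>martingale_step\<close>, the Gaussian variables
  by \<open>integral_indep_last\<close>.\<close>

lemma finite_dimensional_convergence:
  fixes s :: "nat \<Rightarrow> real" and t :: "nat \<Rightarrow> nat \<Rightarrow> nat" and h :: "(nat \<Rightarrow> real) \<Rightarrow> real"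
    and G :: "nat \<Rightarrow> 'q \<Rightarrow> real"
  assumes Q: "prob_space Q"
    and s: "\<And>k. 0 \<le> s k" "s \<longlonglongrightarrow> 0"
    and t: "\<And>k i. t k i \<le> t k (Suc i)" "\<And>i. (\<lambda>k. real (t k (Suc i) - t k i) * (s k)\<^sup>2) \<longlonglongrightarrow> \<tau>"
    and G: "prob_space.indep_vars Q (\<lambda>_. borel) G {..<m}"
      "\<And>i. i < m \<Longrightarrow> distr Q borel (G i) = centred_gaussian (sqrt (v * \<tau>))"
    and bound: "\<And>x. \<bar>h x\<bar> \<le> B"
    and lip: "\<And>x y. \<bar>h x - h y\<bar> \<le> L * (\<Sum>i<m. \<bar>x i - y i\<bar>)"
  shows "(\<lambda>k. \<integral>\<omega>. h (\<lambda>i. s k * incr (t k i) (t k (Suc i) - t k i) \<omega>) \<partial>P) \<longlonglongrightarrow> (\<integral>\<omega>. h (\<lambda>i. G i \<omega>) \<partial>Q)"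
  using G bound lip
proof (induction m arbitrary: h)
  case 0
  interpret Q: prob_space Q by fact
  have "h x = h (\<lambda>_. 0)" for x using 0(4)[of x "\<lambda>_. 0"] by simp
  then have "h = (\<lambda>_. h (\<lambda>_. 0))" by blast
  then have "\<exists>c. h = (\<lambda>_. c)" by blast
  then show ?case by (auto simp: prob_space Q.prob_space)
next
  case (Suc m)
  interpret Q: prob_space Q by fact
  define \<gamma> where "\<gamma> = centred_gaussian (sqrt (v * \<tau>))"
  interpret \<gamma>: real_distribution \<gamma> unfolding \<gamma>_def by (rule real_distribution_centred_gaussian)
  define D where "D k \<omega> i = s k * incr (t k i) (t k (Suc i) - t k i) \<omega>" for k \<omega> i
  define h' where "h' x = (\<integral>y. h (extend_at m x y) \<partial>\<gamma>)" for x
  note lip = Suc.prems(4) and bound = Suc.prems(3)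
  have eq0: "h x = h y" if "\<And>i. i < Suc m \<Longrightarrow> x i = y i" for x y
    using lip[of x y] that by simp
  have ext_lip: "\<bar>h (extend_at m x y) - h (extend_at m x y')\<bar> \<le> L * \<bar>y - y'\<bar>" for x y y'
    using lip[of "extend_at m x y" "extend_at m x y'"] by (simp add: extend_at_def)
  have ext_lip': "\<bar>h (extend_at m x y) - h (extend_at m x' y)\<bar> \<le> L * (\<Sum>i<m. \<bar>x i - x' i\<bar>)" for x x' y
    using lip[of "extend_at m x y" "extend_at m x' y"] by (simp add: extend_at_def)
  have m_ext [measurable]: "(\<lambda>y. h (extend_at m x y)) \<in> borel_measurable borel" for x
    by (rule lipschitz_imp_borel_measurable[OF ext_lip])
  have int: "integrable \<gamma> (\<lambda>y. h (extend_at m x y))" for x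
    using bound by (intro \<gamma>.integrable_const_bound[of _ B]) auto
  have h'_bound: "\<bar>h' x\<bar> \<le> B" for x
  proof -
    have "\<bar>h' x\<bar> \<le> (\<integral>y. \<bar>h (extend_at m x y)\<bar> \<partial>\<gamma>)" unfolding h'_def by (rule integral_abs_bound)
    also have "\<dots> \<le> (\<integral>y. B \<partial>\<gamma>)" using int bound by (intro integral_mono) auto
    finally show ?thesis using \<gamma>.prob_space by simp
  qed
  have h'_lip: "\<bar>h' x - h' x'\<bar> \<le> L * (\<Sum>i<m. \<bar>x i - x' i\<bar>)" for x x'
  proof -
    have "h' x - h' x' = (\<integral>y. h (extend_at m x y) - h (extend_at m x' y) \<partial>\<gamma>)"
      unfolding h'_def using int by simp
    also have "\<bar>\<dots>\<bar> \<le> (\<integral>y. \<bar>h (extend_at m x y) - h (extend_at m x' y)\<bar> \<partial>\<gamma>)" by (rule integral_abs_bound)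
    also have "\<dots> \<le> (\<integral>y. L * (\<Sum>i<m. \<bar>x i - x' i\<bar>) \<partial>\<gamma>)"
      using int ext_lip' by (intro integral_mono) auto
    finally show ?thesis using \<gamma>.prob_space by simp
  qed
  have t_mono: "t k i \<le> t k j" if "i \<le> j" for k i j
    by (rule lift_Suc_mono_le[of "t k", OF t(1) that])
  have D_det: "determined_by P (H (t k m)) (\<lambda>\<omega>. D k \<omega> i)" if "i < m" for k i
  proof -
    have "t k i + (t k (Suc i) - t k i) \<le> t k m"
      using t(1)[of k i] t_mono[of "Suc i" m k] that by simp
    then show ?thesis
      unfolding D_def by (rule determined_mono[OF _ determined_by_compose[OF incr_determined]])
  qed
  have "(\<lambda>k. (\<integral>\<omega>. h (extend_at m (D k \<omega>) (s k * incr (t k m) (t k (Suc m) - t k m) \<omega>)) \<partial>P) -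
      (\<integral>\<omega>. (\<integral>y. h (extend_at m (D k \<omega>) y) \<partial>centred_gaussian (sqrt (v * \<tau>))) \<partial>P)) \<longlonglongrightarrow> 0"
  proof (rule martingale_step[OF s t(2)])
    show "determined_by P (H (t k m)) (\<lambda>\<omega> y. h (extend_at m (D k \<omega>) y))" for k
    proof -
      \<comment> \<open>Only the blocks before m belong to the past of \<open>t k m\<close>; the
        later coordinates of \<open>D k\<close> are cut off, which \<open>extend_at\<close> does not
        notice.\<close>
      have "determined_by P (H (t k m)) (\<lambda>\<omega> i. if i < m then D k \<omega> i else 0)"
      proof (rule determined_by_fun)
        fix i show "determined_by P (H (t k m)) (\<lambda>\<omega>. if i < m then D k \<omega> i else 0)"
          using D_det[of i k] by (cases "i < m") (auto simp: determined_by_const)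
      qed
      from determined_by_compose[OF this, of "\<lambda>x y. h (extend_at m x y)"]
      show ?thesis by (simp add: extend_at_def cong: if_cong)
    qed
  qed (rule bound, rule ext_lip)
  moreover have "h (extend_at m (D k \<omega>) (s k * incr (t k m) (t k (Suc m) - t k m) \<omega>)) = h (D k \<omega>)" for k \<omega>
    by (rule eq0) (auto simp: extend_at_def D_def less_Suc_eq)
  ultimately have "(\<lambda>k. (\<integral>\<omega>. h (D k \<omega>) \<partial>P) - (\<integral>\<omega>. h' (D k \<omega>) \<partial>P)) \<longlonglongrightarrow> 0"
    by (simp add: h'_def \<gamma>_def)
  moreover have "(\<lambda>k. \<integral>\<omega>. h' (D k \<omega>) \<partial>P) \<longlonglongrightarrow> (\<integral>\<omega>. h' (\<lambda>i. G i \<omega>) \<partial>Q)"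
    unfolding D_def
  proof (rule Suc.IH[OF _ _ h'_bound h'_lip])
    show "Q.indep_vars (\<lambda>_. borel) G {..<m}"
      by (rule Q.indep_vars_subset[OF Suc.prems(1)]) auto
  qed (use Suc.prems(2) in auto)
  ultimately have "(\<lambda>k. (\<integral>\<omega>. h (D k \<omega>) \<partial>P) - (\<integral>\<omega>. h' (D k \<omega>) \<partial>P) + (\<integral>\<omega>. h' (D k \<omega>) \<partial>P)) \<longlonglongrightarrow>
      0 + (\<integral>\<omega>. h' (\<lambda>i. G i \<omega>) \<partial>Q)"
    by (rule tendsto_add)
  moreover have "(\<integral>\<omega>. h' (\<lambda>i. G i \<omega>) \<partial>Q) = (\<integral>\<omega>. h (\<lambda>i. G i \<omega>) \<partial>Q)"
    unfolding h'_def \<gamma>_def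
    by (rule Q.integral_indep_last[OF Suc.prems(1) _ bound lip, symmetric]) (use Suc.prems(2) in simp)
  ultimately show ?case by (simp add: D_def[abs_def])
qed

end

section \<open>The invariance principle\<close>

lemma distr_centred_gaussian_scale:
  "distr (centred_gaussian \<sigma>) borel (\<lambda>x. r * x) = centred_gaussian (r * \<sigma>)"
  unfolding centred_gaussian_def by (subst distr_distr) (auto simp: comp_def mult.assoc[symmetric])

lemma floor_quotient_tendsto:
  fixes M :: "nat \<Rightarrow> real"
  assumes M: "filterlim M at_top sequentially" "\<And>k. 1 \<le> M k" and "0 \<le> x"
  shows "(\<lambda>k. real (nat \<lfloor>M k * x\<rfloor>) / M k) \<longlonglongrightarrow> x"
proof (rule tendsto_sandwich)
  have pos: "0 < M k" for k using M(2)[of k] by linarith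
  have inv: "(\<lambda>k. 1 / M k) \<longlonglongrightarrow> 0"
    using tendsto_inverse_0_at_top[OF M(1)] by (simp add: inverse_eq_divide)
  have "(\<lambda>k. x - 1 / M k) \<longlonglongrightarrow> x - 0" by (intro tendsto_intros inv)
  then show "(\<lambda>k. x - 1 / M k) \<longlonglongrightarrow> x" by simp
  have nn: "0 \<le> M k * x" for k using pos[of k] \<open>0 \<le> x\<close> by simp
  show "\<forall>\<^sub>F k in sequentially. x - 1 / M k \<le> real (nat \<lfloor>M k * x\<rfloor>) / M k"
  proof (rule always_eventually, rule allI)
    fix k
    have "M k * x - 1 \<le> real (nat \<lfloor>M k * x\<rfloor>)" using nn[of k] by linarith
    then have "(M k * x - 1) / M k \<le> real (nat \<lfloor>M k * x\<rfloor>) / M k"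
      using pos[of k] by (intro divide_right_mono) auto
    then show "x - 1 / M k \<le> real (nat \<lfloor>M k * x\<rfloor>) / M k"
      using pos[of k] by (simp add: diff_divide_distrib)
  qed
  show "\<forall>\<^sub>F k in sequentially. real (nat \<lfloor>M k * x\<rfloor>) / M k \<le> x"
  proof (rule always_eventually, rule allI)
    fix k
    have "real (nat \<lfloor>M k * x\<rfloor>) \<le> M k * x" using nn[of k] by linarith
    then show "real (nat \<lfloor>M k * x\<rfloor>) / M k \<le> x" using pos[of k] by (simp add: divide_le_eq mult.commute)
  qed
qed simp

text \<open>R is finite at every point, so its indicators tend to 0 pointwise. This is what handles
  a bound that depends on an initial state of arbitrary law.\<close>

lemma (in prob_space) prob_exceeds_tendsto_0:
  fixes R :: "'a \<Rightarrow> real" and r :: "nat \<Rightarrow> real"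
  assumes [measurable]: "R \<in> borel_measurable M" and r: "filterlim r at_top sequentially"
  shows "(\<lambda>k. prob {\<omega> \<in> space M. r k < R \<omega>}) \<longlonglongrightarrow> 0"
proof -
  have "(\<lambda>k. \<integral>\<omega>. indicator {\<omega> \<in> space M. r k < R \<omega>} \<omega> \<partial>M) \<longlonglongrightarrow> (\<integral>\<omega>. 0 \<partial>M :: real)"
  proof (rule integral_dominated_convergence[where w="\<lambda>_. 1"])
    show "AE \<omega> in M. (\<lambda>k. indicator {\<omega> \<in> space M. r k < R \<omega>} \<omega> :: real) \<longlonglongrightarrow> 0"
    proof (rule AE_I2)
      fix \<omega>
      have "\<forall>\<^sub>F k in sequentially. R \<omega> \<le> r k" using r by (simp add: filterlim_at_top)
      then have "\<forall>\<^sub>F k in sequentially. (indicator {\<omega> \<in> space M. r k < R \<omega>} \<omega> :: real) = 0"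
        by eventually_elim (auto simp: indicator_def)
      then show "(\<lambda>k. indicator {\<omega> \<in> space M. r k < R \<omega>} \<omega> :: real) \<longlonglongrightarrow> 0" by (rule tendsto_eventually)
    qed
  qed (auto simp: indicator_def)
  then show ?thesis by simp
qed

text \<open>The common discretisation of the two processes: a path on the mesh 1 / K that depends on
  its increments alone, so that a path functional becomes a function of finitely many
  numbers.\<close>

definition increments_path :: "nat \<Rightarrow> (nat \<Rightarrow> real) \<Rightarrow> real \<Rightarrow> real" where
  "increments_path K d = step_path (real K) (\<lambda>j. \<Sum>i<j. d i)"

lemma increments_path_cadlag: "0 < K \<Longrightarrow> increments_path K d \<in> cadlag"
  unfolding increments_path_def by (rule step_path_cadlag) simp

lemma grid_index_le:
  fixes t :: real
  assumes "t \<in> {0..real T}"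
  shows "nat \<lfloor>real K * t\<rfloor> \<le> K * T"
proof -
  have "real K * t \<le> real K * real T" using assms by (intro mult_left_mono) auto
  then have "\<lfloor>real K * t\<rfloor> \<le> int (K * T)" by (simp add: floor_le_iff)
  then show ?thesis by linarith
qed

text \<open>Consequently a functional that is Lipschitz for the uniform distance on [0, T] is
  Lipschitz in the K * T increments, the form required by
  \<open>finite_dimensional_convergence\<close>.\<close>

lemma increments_path_close:
  "unif_close (real T) (\<Sum>i<K * T. \<bar>d i - d' i\<bar>) (increments_path K d) (increments_path K d')"
  unfolding unif_close_def
proof
  fix t assume t: "t \<in> {0..real T}"
  let ?j = "nat \<lfloor>real K * t\<rfloor>"
  have "\<bar>increments_path K d t - increments_path K d' t\<bar> = \<bar>\<Sum>i<?j. d i - d' i\<bar>"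
    using t by (simp add: increments_path_def step_path_eq sum_subtractf)
  also have "\<dots> \<le> (\<Sum>i<?j. \<bar>d i - d' i\<bar>)" by (rule sum_abs)
  also have "\<dots> \<le> (\<Sum>i<K * T. \<bar>d i - d' i\<bar>)"
    by (rule sum_mono2) (use grid_index_le[OF t, of K] in auto)
  finally show "\<bar>increments_path K d t - increments_path K d' t\<bar> \<le> (\<Sum>i<K * T. \<bar>d i - d' i\<bar>)" .
qed

section \<open>Brownian motion and its discretisation\<close>

locale scaled_brownian_motion = Q: prob_space Q for Q :: "'q measure" +
  fixes W :: "real \<Rightarrow> 'q \<Rightarrow> real" and v :: real
  assumes BM: "standard_brownian_motion Q W" and v0: "0 \<le> v"
begin

definition path :: "'q \<Rightarrow> real \<Rightarrow> real" where
  "path \<omega> = (\<lambda>t\<in>{0..}. sqrt v * W t \<omega>)"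

definition gap :: "nat \<Rightarrow> nat \<Rightarrow> 'q \<Rightarrow> real" where
  "gap K i \<omega> = sqrt v * (W (real (Suc i) / real K) \<omega> - W (real i / real K) \<omega>)"

lemma W_measurable [measurable]: "0 \<le> t \<Longrightarrow> W t \<in> borel_measurable Q"
  using BM by (simp add: standard_brownian_motion_def)

lemma W_0: "\<omega> \<in> space Q \<Longrightarrow> W 0 \<omega> = 0"
  using BM by (simp add: standard_brownian_motion_def)

lemma W_continuous: "\<omega> \<in> space Q \<Longrightarrow> continuous_on {0..} (\<lambda>t. W t \<omega>)"
  using BM by (simp add: standard_brownian_motion_def)

lemma path_cadlag: "\<omega> \<in> space Q \<Longrightarrow> path \<omega> \<in> cadlag"
  unfolding path_def by (intro continuous_path_cadlag continuous_intros W_continuous)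

lemma path_preimage: "locally_uniformly_open U \<Longrightarrow> {\<omega> \<in> space Q. path \<omega> \<in> U} \<in> sets Q"
  unfolding path_def
  by (rule measurable_continuous_path_preimage) (auto intro!: continuous_intros W_continuous)

lemma gap_measurable [measurable]: "gap K i \<in> borel_measurable Q"
  unfolding gap_def by measurable

lemma gap_indep:
  assumes "0 < K"
  shows "Q.indep_vars (\<lambda>_. borel) (gap K) {..<n}"
proof -
  have "Q.indep_vars (\<lambda>_. borel) (\<lambda>k \<omega>. W (real (Suc k) / real K) \<omega> - W (real k / real K) \<omega>) {..<n}"
    using BM assms unfolding standard_brownian_motion_def
    by (auto elim!: allE[of _ "n::nat"] allE[of _ "\<lambda>i. real i / real K"] simp: divide_strict_right_mono)
  then have "Q.indep_vars (\<lambda>_. borel)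
      (\<lambda>k \<omega>. (\<lambda>x. sqrt v * x) (W (real (Suc k) / real K) \<omega> - W (real k / real K) \<omega>)) {..<n}"
    by (rule Q.indep_vars_compose2) simp
  then show ?thesis by (simp add: gap_def[abs_def])
qed

lemma gap_distr:
  assumes "0 < K"
  shows "distr Q borel (gap K i) = centred_gaussian (sqrt (v * (1 / real K)))"
proof -
  let ?D = "\<lambda>\<omega>. W (real (Suc i) / real K) \<omega> - W (real i / real K) \<omega>"
  have d: "real (Suc i) / real K - real i / real K = 1 / real K"
    by (simp add: diff_divide_distrib[symmetric])
  have "distributed Q lborel ?D (normal_density 0 (sqrt (real (Suc i) / real K - real i / real K)))"
    using BM assms unfolding standard_brownian_motion_def by (simp add: divide_strict_right_mono)
  then have "distr Q lborel ?D = centred_gaussian (sqrt (1 / real K))"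
    using assms unfolding d by (simp add: distributed_def centred_gaussian_eq_density)
  moreover have "distr Q lborel ?D = distr Q borel ?D" by (rule distr_cong) auto
  ultimately have "distr Q borel ?D = centred_gaussian (sqrt (1 / real K))" by simp
  then have "distr (distr Q borel ?D) borel (\<lambda>x. sqrt v * x) = centred_gaussian (sqrt v * sqrt (1 / real K))"
    by (simp only: distr_centred_gaussian_scale)
  moreover have "distr (distr Q borel ?D) borel (\<lambda>x. sqrt v * x) = distr Q borel (gap K i)"
    by (subst distr_distr) (auto simp: comp_def gap_def[abs_def])
  ultimately show ?thesis by (simp add: real_sqrt_mult[symmetric])
qed

lemma increments_path_gap:
  assumes "\<omega> \<in> space Q" "0 < K" "0 \<le> t"
  shows "increments_path K (\<lambda>i. gap K i \<omega>) t = sqrt v * W (real (nat \<lfloor>real K * t\<rfloor>) / real K) \<omega>"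
proof -
  have "(\<Sum>i<j. gap K i \<omega>) = sqrt v * W (real j / real K) \<omega>" for j
    by (induction j) (use W_0[OF assms(1)] in \<open>simp_all add: gap_def algebra_simps\<close>)
  then show ?thesis using assms by (simp add: increments_path_def step_path_eq)
qed

text \<open>Each path is uniformly continuous on [0, T], and the discretised path takes at t the
  value at the grid point just before t. The meshes are indexed by successors so that they are never
  0.\<close>

lemma increments_path_gap_tendsto:
  assumes \<omega>: "\<omega> \<in> space Q" and g: "locally_uniformly_continuous g"
  shows "(\<lambda>n. g (increments_path (Suc n) (\<lambda>i. gap (Suc n) i \<omega>))) \<longlonglongrightarrow> g (path \<omega>)"
proof (rule LIMSEQ_I)
  fix e :: real assume "e > 0"
  then obtain T \<delta> where *: "\<delta> > 0" "\<And>y. y \<in> cadlag \<Longrightarrow> unif_close T \<delta> (path \<omega>) y \<Longrightarrow> \<bar>g (path \<omega>) - g y\<bar> < e"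
    using g path_cadlag[OF \<omega>] unfolding locally_uniformly_continuous_def by metis
  have "continuous_on {0..T} (\<lambda>t. sqrt v * W t \<omega>)"
    by (intro continuous_intros continuous_on_subset[OF W_continuous[OF \<omega>]]) auto
  then have "uniformly_continuous_on {0..T} (\<lambda>t. sqrt v * W t \<omega>)"
    by (rule compact_uniformly_continuous) auto
  then obtain d where d: "d > 0" "\<And>s t. s \<in> {0..T} \<Longrightarrow> t \<in> {0..T} \<Longrightarrow> \<bar>s - t\<bar> < d \<Longrightarrow>
      \<bar>sqrt v * W s \<omega> - sqrt v * W t \<omega>\<bar> < \<delta>"
    unfolding uniformly_continuous_on_def dist_real_def using *(1) by metis
  obtain n0 where n0: "1 / real (Suc n0) < d"
    using reals_Archimedean[OF d(1)] by (auto simp: inverse_eq_divide)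
  have "norm (g (increments_path (Suc n) (\<lambda>i. gap (Suc n) i \<omega>)) - g (path \<omega>)) < e" if n: "n0 \<le> n" for n
  proof -
    have small: "1 / real (Suc n) < d"
    proof -
      have "1 / real (Suc n) \<le> 1 / real (Suc n0)" using n by (intro divide_left_mono) auto
      then show ?thesis using n0 by linarith
    qed
    have "unif_close T \<delta> (path \<omega>) (increments_path (Suc n) (\<lambda>i. gap (Suc n) i \<omega>))"
      unfolding unif_close_def
    proof
      fix t assume t: "t \<in> {0..T}"
      define j where "j = nat \<lfloor>real (Suc n) * t\<rfloor>"
      have nn: "0 \<le> real (Suc n) * t" using t by simp
      have j: "real j \<le> real (Suc n) * t" "real (Suc n) * t < real j + 1"
        unfolding j_def using nn by linarith+
      have 1: "real j / real (Suc n) \<le> t" using j(1) by (simp add: divide_le_eq mult.commute)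
      have "t < (real j + 1) / real (Suc n)" using j(2) by (simp add: pos_less_divide_eq mult.commute)
      then have 2: "t - real j / real (Suc n) < d" using small by (simp add: add_divide_distrib)
      have "\<bar>sqrt v * W t \<omega> - sqrt v * W (real j / real (Suc n)) \<omega>\<bar> < \<delta>"
        by (rule d(2)) (use t 1 2 in auto)
      then show "\<bar>path \<omega> t - increments_path (Suc n) (\<lambda>i. gap (Suc n) i \<omega>) t\<bar> \<le> \<delta>"
        using t increments_path_gap[OF \<omega>, of "Suc n" t] by (simp add: path_def j_def)
    qed
    from *(2)[OF increments_path_cadlag this] show ?thesis by (simp add: abs_minus_commute)
  qed
  then show "\<exists>no. \<forall>n\<ge>no. norm (g (increments_path (Suc n) (\<lambda>i. gap (Suc n) i \<omega>)) - g (path \<omega>)) < e" by blast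
qed

end

text \<open>The bound R is uniform in time but random, as it will contain the initial position. It
  is required almost everywhere only, because a transition of probability 0 may still occur at some
  sample points.\<close>

locale near_martingale = bounded_martingale P H \<xi> c v
  for P :: "'a measure" and H :: "nat \<Rightarrow> 'a \<Rightarrow> 'h::countable" and \<xi> c v +
  fixes X :: "nat \<Rightarrow> 'a \<Rightarrow> int" and R :: "'a \<Rightarrow> real"
  assumes X_measurable: "\<And>n. X n \<in> measurable P (count_space UNIV)"
    and R_measurable [measurable]: "R \<in> borel_measurable P"
    and X_near_S: "AE \<omega> in P. \<forall>n. \<bar>real_of_int (X n \<omega>) - S n \<omega>\<bar> \<le> R \<omega>"
begin

lemma rescaled_measurable [measurable]: "rescaled X \<kappa> t \<in> borel_measurable P"
  unfolding rescaled_def[abs_def]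
  by (rule measurable_compose[OF X_measurable, where g="\<lambda>x. real_of_int x / sqrt \<kappa>"]) simp

text \<open>For the sum S this is \<open>char_incr\<close> started at time 0 with the test variable
  1. Exchanging S for X changes the integrand by at most |\<theta>| s R, which vanishes pointwise
  although R may be unbounded; dominated convergence with the constant 2 concludes.\<close>

lemma marginal_char_tendsto:
  fixes M :: "nat \<Rightarrow> real"
  assumes M: "filterlim M at_top sequentially" "\<And>k. 1 \<le> M k" and t: "0 \<le> t"
  shows "(\<lambda>k. char (distr P borel (rescaled X (M k) t)) \<theta>) \<longlonglongrightarrow> char (centred_gaussian (sqrt (v * t))) \<theta>"
proof -
  define n where "n k = nat \<lfloor>M k * t\<rfloor>" for k
  define s where "s k = 1 / sqrt (M k)" for k
  have pos: "0 < M k" for k using M(2)[of k] by linarith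
  have s0: "0 \<le> s k" for k using pos[of k] by (simp add: s_def)
  have "filterlim (\<lambda>k. sqrt (M k)) at_top sequentially"
    by (rule filterlim_compose[OF sqrt_at_top M(1)])
  then have s: "s \<longlonglongrightarrow> 0"
    unfolding s_def[abs_def] using tendsto_inverse_0_at_top by (simp add: inverse_eq_divide[symmetric])
  have ns: "(\<lambda>k. real (n k) * (s k)\<^sup>2) \<longlonglongrightarrow> t"
  proof -
    have "real (n k) * (s k)\<^sup>2 = real (nat \<lfloor>M k * t\<rfloor>) / M k" for k
      using pos[of k] by (simp add: n_def s_def power_divide)
    then show ?thesis using floor_quotient_tendsto[OF M t] by simp
  qed
  define F where "F k = (\<integral>\<omega>. iexp (\<theta> * s k * S (n k) \<omega>) \<partial>P)" for k
  define e where "e k = complex_of_real (exp (- (real (n k) * ((\<theta> * s k)\<^sup>2 * v / 2))))" for k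
  have "norm (F k - e k) \<le> real (n k) * (\<bar>\<theta> * s k\<bar> ^ 3 * c ^ 3 / 6 + ((\<theta> * s k)\<^sup>2 * v / 2)\<^sup>2)" for k
    using char_incr[of 0 "\<lambda>_. 1" 1 "\<theta> * s k" "n k"]
    by (simp add: determined_by_const F_def e_def incr_def S_def[of 0] prob_space)
  then have "\<forall>\<^sub>F k in sequentially. norm (F k - e k) \<le>
      real (n k) * (\<bar>\<theta> * s k\<bar> ^ 3 * c ^ 3 / 6 + ((\<theta> * s k)\<^sup>2 * v / 2)\<^sup>2)"
    by simp
  then have Fe: "(\<lambda>k. F k - e k) \<longlonglongrightarrow> 0"
    by (rule Lim_null_comparison[OF _ char_error_tendsto[OF s0 s ns]])
  have e: "e \<longlonglongrightarrow> char (centred_gaussian (sqrt (v * t))) \<theta>"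
    unfolding e_def[abs_def] by (rule char_limit_tendsto[OF ns])
  define f where "f k \<omega> = iexp (\<theta> * rescaled X (M k) t \<omega>) - iexp (\<theta> * s k * S (n k) \<omega>)" for k \<omega>
  have "(\<lambda>k. \<integral>\<omega>. f k \<omega> \<partial>P) \<longlonglongrightarrow> (\<integral>\<omega>. 0 \<partial>P)"
  proof (rule integral_dominated_convergence[where w="\<lambda>_. 2"])
    show "AE \<omega> in P. (\<lambda>k. f k \<omega>) \<longlonglongrightarrow> 0"
      using X_near_S
    proof (rule AE_mp, intro AE_I2 impI)
      fix \<omega> assume near: "\<forall>n. \<bar>real_of_int (X n \<omega>) - S n \<omega>\<bar> \<le> R \<omega>"
      have "norm (f k \<omega>) \<le> \<bar>\<theta>\<bar> * s k * R \<omega>" for k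
      proof -
        let ?x = "\<theta> * rescaled X (M k) t \<omega>" and ?y = "\<theta> * s k * S (n k) \<omega>"
        \<comment> \<open>Extracting a factor of modulus 1 leaves |iexp z - 1| <= |z| for the
          difference z of the two phases.\<close>
        have "f k \<omega> = iexp ?y * (iexp (?x - ?y) - 1)"
          by (simp add: f_def algebra_simps flip: exp_add)
        then have "norm (f k \<omega>) = cmod (iexp (?x - ?y) - 1)" by (simp add: norm_mult)
        also have "\<dots> \<le> \<bar>?x - ?y\<bar>" using iexp_approx1[of "?x - ?y" 0] by simp
        also have "?x - ?y = \<theta> * s k * (real_of_int (X (n k) \<omega>) - S (n k) \<omega>)"
          by (simp add: rescaled_def n_def s_def algebra_simps)
        also have "\<bar>\<dots>\<bar> \<le> \<bar>\<theta>\<bar> * s k * R \<omega>"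
          unfolding abs_mult using near s0[of k] by (auto intro!: mult_mono)
        finally show ?thesis .
      qed
      then have "\<forall>\<^sub>F k in sequentially. norm (f k \<omega>) \<le> \<bar>\<theta>\<bar> * s k * R \<omega>" by simp
      moreover have "(\<lambda>k. \<bar>\<theta>\<bar> * s k * R \<omega>) \<longlonglongrightarrow> \<bar>\<theta>\<bar> * 0 * R \<omega>" by (intro tendsto_intros s)
      then have "(\<lambda>k. \<bar>\<theta>\<bar> * s k * R \<omega>) \<longlonglongrightarrow> 0" by simp
      ultimately show "(\<lambda>k. f k \<omega>) \<longlonglongrightarrow> 0" by (rule Lim_null_comparison)
    qed
    show "AE \<omega> in P. norm (f k \<omega>) \<le> 2" for k
      unfolding f_def by (intro AE_I2 order_trans[OF norm_triangle_ineq4]) simp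
    show "f k \<in> borel_measurable P" for k unfolding f_def by measurable
  qed simp_all
  moreover have "(\<integral>\<omega>. f k \<omega> \<partial>P) = char (distr P borel (rescaled X (M k) t)) \<theta> - F k" for k
  proof -
    have "integrable P (\<lambda>\<omega>. iexp (\<theta> * rescaled X (M k) t \<omega>))" "integrable P (\<lambda>\<omega>. iexp (\<theta> * s k * S (n k) \<omega>))"
      by (rule integrable_bounded[where b=1]; simp)+
    then have "(\<integral>\<omega>. f k \<omega> \<partial>P) = (\<integral>\<omega>. iexp (\<theta> * rescaled X (M k) t \<omega>) \<partial>P) - F k"
      unfolding f_def F_def by (rule Bochner_Integration.integral_diff)
    moreover have "char (distr P borel (rescaled X (M k) t)) \<theta> = (\<integral>\<omega>. iexp (\<theta> * rescaled X (M k) t \<omega>) \<partial>P)"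
      unfolding char_def by (rule integral_distr) auto
    ultimately show ?thesis by simp
  qed
  ultimately have "(\<lambda>k. char (distr P borel (rescaled X (M k) t)) \<theta> - F k) \<longlonglongrightarrow> 0" by simp
  from tendsto_add[OF tendsto_add[OF this Fe] e] show ?thesis by simp
qed

lemma marginal_convergence:
  fixes M :: "nat \<Rightarrow> real"
  assumes M: "filterlim M at_top sequentially" and t: "0 \<le> t"
  shows "weak_conv_m (\<lambda>k. distr P borel (rescaled X (M k) t)) (centred_gaussian (sqrt (v * t)))"
proof (rule levy_continuity)
  show "real_distribution (distr P borel (rescaled X (M k) t))" for k
    by (rule real_distribution_distr) simp
  show "real_distribution (centred_gaussian (sqrt (v * t)))"
    by (rule real_distribution_centred_gaussian)
  fix \<theta>
  \<comment> \<open>The scales are at least 1 only eventually; truncating them from below changes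
    finitely many terms.\<close>
  have ev: "\<forall>\<^sub>F k in sequentially. max 1 (M k) = M k"
    using M unfolding filterlim_at_top by (auto elim!: allE[of _ 1] eventually_mono)
  then have "filterlim (\<lambda>k. max 1 (M k)) at_top sequentially"
    using M by (subst filterlim_cong[OF refl refl ev])
  then have "(\<lambda>k. char (distr P borel (rescaled X (max 1 (M k)) t)) \<theta>) \<longlonglongrightarrow> char (centred_gaussian (sqrt (v * t))) \<theta>"
    by (rule marginal_char_tendsto) (use t in auto)
  then show "(\<lambda>k. char (distr P borel (rescaled X (M k) t)) \<theta>) \<longlonglongrightarrow> char (centred_gaussian (sqrt (v * t))) \<theta>"
    by (rule Lim_transform_eventually) (use ev in eventually_elim, simp)
qed

end

section \<open>Comparison of the scaled walk with its grid increments\<close>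

locale martingale_fclt = near_martingale P H \<xi> c v X R + scaled_brownian_motion Q W v
  for P :: "'a measure" and H :: "nat \<Rightarrow> 'a \<Rightarrow> 'h::countable" and \<xi> c v X R
    and Q :: "'q measure" and W
begin

definition scaled_path :: "real \<Rightarrow> 'a \<Rightarrow> real \<Rightarrow> real" where
  "scaled_path \<kappa> \<omega> = step_path \<kappa> (\<lambda>n. real_of_int (X n \<omega>) / sqrt \<kappa>)"

lemma scaled_path_cadlag: "0 < \<kappa> \<Longrightarrow> scaled_path \<kappa> \<omega> \<in> cadlag"
  unfolding scaled_path_def by (rule step_path_cadlag)

lemma scaled_path_preimage:
  "0 < \<kappa> \<Longrightarrow> locally_uniformly_open U \<Longrightarrow> {\<omega> \<in> space P. scaled_path \<kappa> \<omega> \<in> U} \<in> sets P"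
  unfolding scaled_path_def
  by (rule measurable_step_path_preimage[OF X_measurable, where c="\<lambda>x. real_of_int x / sqrt \<kappa>"])

definition grid :: "real \<Rightarrow> nat \<Rightarrow> nat \<Rightarrow> nat" where
  "grid \<kappa> K i = nat \<lfloor>\<kappa> * (real i / real K)\<rfloor>"

definition scaled_incr :: "real \<Rightarrow> nat \<Rightarrow> nat \<Rightarrow> 'a \<Rightarrow> real" where
  "scaled_incr \<kappa> K i \<omega> = 1 / sqrt \<kappa> * incr (grid \<kappa> K i) (grid \<kappa> K (Suc i) - grid \<kappa> K i) \<omega>"

lemma grid_mono:
  assumes "0 < \<kappa>" "i \<le> j"
  shows "grid \<kappa> K i \<le> grid \<kappa> K j"
  unfolding grid_def using assms by (intro nat_mono floor_mono mult_left_mono divide_right_mono) auto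

lemma grid_0 [simp]: "grid \<kappa> K 0 = 0"
  by (simp add: grid_def)

lemma sum_scaled_incr:
  assumes "0 < \<kappa>"
  shows "(\<Sum>i<j. scaled_incr \<kappa> K i \<omega>) = S (grid \<kappa> K j) \<omega> / sqrt \<kappa>"
proof (induction j)
  case 0
  then show ?case by (simp add: S_def)
next
  case (Suc j)
  have "grid \<kappa> K j \<le> grid \<kappa> K (Suc j)" by (rule grid_mono[OF assms]) simp
  then have "scaled_incr \<kappa> K j \<omega> = S (grid \<kappa> K (Suc j)) \<omega> / sqrt \<kappa> - S (grid \<kappa> K j) \<omega> / sqrt \<kappa>"
    by (simp add: scaled_incr_def incr_def diff_divide_distrib)
  then show ?case using Suc by simp
qed

lemma grid_diff_le:
  assumes "0 < \<kappa>" "0 < K"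
  shows "real (grid \<kappa> K (Suc j) - grid \<kappa> K j) \<le> \<kappa> / real K + 1"
proof -
  have "0 \<le> \<kappa> * (real j / real K)" using assms by simp
  then have 1: "\<kappa> * (real j / real K) - 1 < real (grid \<kappa> K j)" unfolding grid_def by linarith
  have "0 \<le> \<kappa> * (real (Suc j) / real K)" using assms by (simp del: of_nat_Suc)
  then have 2: "real (grid \<kappa> K (Suc j)) \<le> \<kappa> * (real (Suc j) / real K)" unfolding grid_def by linarith
  have "\<kappa> * (real (Suc j) / real K) = \<kappa> * (real j / real K) + \<kappa> / real K"
    by (simp add: add_divide_distrib algebra_simps)
  then show ?thesis using 1 2 grid_mono[OF assms(1), of j "Suc j" K] by (simp add: of_nat_diff)
qed

text \<open>Outside this event the walk is close to its discretisation up to time T. The cell j = K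
  * T is included because the time T itself lies in it.\<close>

definition bad :: "nat \<Rightarrow> nat \<Rightarrow> real \<Rightarrow> real \<Rightarrow> 'a set" where
  "bad T K \<delta> \<kappa> = {\<omega> \<in> space P. \<delta> * sqrt \<kappa> < R \<omega>} \<union>
     (\<Union>j\<le>K * T. {\<omega> \<in> space P. \<exists>i\<le>grid \<kappa> K (Suc j) - grid \<kappa> K j. \<delta> * sqrt \<kappa> \<le> \<bar>incr (grid \<kappa> K j) i \<omega>\<bar>})"

lemma bad_events [measurable]: "bad T K \<delta> \<kappa> \<in> events"
  unfolding bad_def by measurable

text \<open>The fourth moment pays off here: each block contributes order K^-2 and there are about K
  T of them, so the sum is of order T / K. A second moment bound would give K^-1 per block, and the
  sum would not vanish. The summand 1 / \<kappa> comes from rounding the grid times to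
  integers.\<close>

lemma prob_bad_le:
  assumes "0 < \<kappa>" "0 < K" "0 < \<delta>"
  shows "prob (bad T K \<delta> \<kappa>) \<le> prob {\<omega> \<in> space P. \<delta> * sqrt \<kappa> < R \<omega>} +
    real (K * T + 1) * (4 * c ^ 4 * (1 / real K + 1 / \<kappa>)\<^sup>2 / \<delta> ^ 4)"
proof -
  let ?E = "\<lambda>j. {\<omega> \<in> space P. \<exists>i\<le>grid \<kappa> K (Suc j) - grid \<kappa> K j. \<delta> * sqrt \<kappa> \<le> \<bar>incr (grid \<kappa> K j) i \<omega>\<bar>}"
  have E: "prob (?E j) \<le> 4 * c ^ 4 * (1 / real K + 1 / \<kappa>)\<^sup>2 / \<delta> ^ 4" for j
  proof -
    have "prob (?E j) \<le> 4 * c ^ 4 * (real (grid \<kappa> K (Suc j) - grid \<kappa> K j))\<^sup>2 / (\<delta> * sqrt \<kappa>) ^ 4"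
      by (rule maximal_inequality) (use assms in simp)
    also have "\<dots> \<le> 4 * c ^ 4 * (\<kappa> / real K + 1)\<^sup>2 / (\<delta> * sqrt \<kappa>) ^ 4"
      using grid_diff_le[OF assms(1,2), of j] by (intro divide_right_mono mult_left_mono power_mono) auto
    also have "(\<delta> * sqrt \<kappa>) ^ 4 = \<delta> ^ 4 * \<kappa>\<^sup>2"
    proof -
      have "sqrt \<kappa> ^ 4 = ((sqrt \<kappa>)\<^sup>2)\<^sup>2" by (simp only: power_mult[symmetric]) simp
      then show ?thesis using assms by (simp add: power_mult_distrib)
    qed
    also have "(\<kappa> / real K + 1)\<^sup>2 = \<kappa>\<^sup>2 * (1 / real K + 1 / \<kappa>)\<^sup>2"
      using assms by (simp add: power_mult_distrib[symmetric] distrib_left)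
    also have "4 * c ^ 4 * (\<kappa>\<^sup>2 * (1 / real K + 1 / \<kappa>)\<^sup>2) / (\<delta> ^ 4 * \<kappa>\<^sup>2) = 4 * c ^ 4 * (1 / real K + 1 / \<kappa>)\<^sup>2 / \<delta> ^ 4"
      using assms by simp
    finally show ?thesis .
  qed
  have "prob (\<Union>j\<le>K * T. ?E j) \<le> (\<Sum>j\<le>K * T. prob (?E j))"
    by (rule finite_measure_subadditive_finite) auto
  also have "\<dots> \<le> (\<Sum>j\<le>K * T. 4 * c ^ 4 * (1 / real K + 1 / \<kappa>)\<^sup>2 / \<delta> ^ 4)"
    by (rule sum_mono) (rule E)
  also have "\<dots> = real (K * T + 1) * (4 * c ^ 4 * (1 / real K + 1 / \<kappa>)\<^sup>2 / \<delta> ^ 4)" by simp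
  finally have "prob (\<Union>j\<le>K * T. ?E j) \<le> real (K * T + 1) * (4 * c ^ 4 * (1 / real K + 1 / \<kappa>)\<^sup>2 / \<delta> ^ 4)" .
  moreover have "prob (bad T K \<delta> \<kappa>) \<le> prob {\<omega> \<in> space P. \<delta> * sqrt \<kappa> < R \<omega>} + prob (\<Union>j\<le>K * T. ?E j)"
    unfolding bad_def by (rule measure_Un_le) measurable
  ultimately show ?thesis by linarith
qed

text \<open>One \<delta> pays for the distance between X and S, the other for the motion of S since
  the last grid point.\<close>

lemma scaled_path_close:
  assumes "0 < \<kappa>" "0 < K" "0 < \<delta>" and \<omega>: "\<omega> \<in> space P" "\<omega> \<notin> bad T K \<delta> \<kappa>"
    and near: "\<forall>n. \<bar>real_of_int (X n \<omega>) - S n \<omega>\<bar> \<le> R \<omega>"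
  shows "unif_close (real T) (2 * \<delta>) (scaled_path \<kappa> \<omega>) (increments_path K (\<lambda>i. scaled_incr \<kappa> K i \<omega>))"
  unfolding unif_close_def
proof
  fix t assume t: "t \<in> {0..real T}"
  define j where "j = nat \<lfloor>real K * t\<rfloor>"
  define n where "n = nat \<lfloor>\<kappa> * t\<rfloor>"
  have jT: "j \<le> K * T" unfolding j_def by (rule grid_index_le[OF t])
  have nn: "0 \<le> real K * t" using t by simp
  have j: "real j \<le> real K * t" "real K * t < real (Suc j)"
    unfolding j_def using nn by linarith+
  have "real j / real K \<le> t" "t \<le> real (Suc j) / real K"
    using j assms(2) by (simp_all add: divide_le_eq le_divide_eq mult.commute del: of_nat_Suc)
  then have "\<kappa> * (real j / real K) \<le> \<kappa> * t" "\<kappa> * t \<le> \<kappa> * (real (Suc j) / real K)"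
    using assms(1) by (auto intro!: mult_left_mono simp del: of_nat_Suc times_divide_eq_right)
  then have n: "grid \<kappa> K j \<le> n" "n \<le> grid \<kappa> K (Suc j)"
    unfolding grid_def n_def by (auto intro!: nat_mono floor_mono)
  have "\<bar>incr (grid \<kappa> K j) (n - grid \<kappa> K j) \<omega>\<bar> < \<delta> * sqrt \<kappa>"
  proof (rule ccontr)
    assume "\<not> ?thesis"
    then have "\<omega> \<in> bad T K \<delta> \<kappa>"
      unfolding bad_def using \<omega>(1) jT n by (auto intro!: bexI[of _ j] exI[of _ "n - grid \<kappa> K j"])
    with \<omega>(2) show False by simp
  qed
  then have 1: "\<bar>S n \<omega> - S (grid \<kappa> K j) \<omega>\<bar> < \<delta> * sqrt \<kappa>" using n by (simp add: incr_def)
  have "R \<omega> \<le> \<delta> * sqrt \<kappa>" using \<omega> by (auto simp: bad_def)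
  with near have "\<bar>real_of_int (X n \<omega>) - S n \<omega>\<bar> \<le> \<delta> * sqrt \<kappa>" by (meson order_trans)
  with 1 have "\<bar>real_of_int (X n \<omega>) - S (grid \<kappa> K j) \<omega>\<bar> \<le> 2 * \<delta> * sqrt \<kappa>" by linarith
  then have "\<bar>real_of_int (X n \<omega>) - S (grid \<kappa> K j) \<omega>\<bar> / sqrt \<kappa> \<le> 2 * \<delta>"
    using assms(1) by (simp add: divide_le_eq)
  moreover have "scaled_path \<kappa> \<omega> t = real_of_int (X n \<omega>) / sqrt \<kappa>"
    using t by (simp add: scaled_path_def step_path_eq n_def)
  moreover have "increments_path K (\<lambda>i. scaled_incr \<kappa> K i \<omega>) t = S (grid \<kappa> K j) \<omega> / sqrt \<kappa>"
    using t sum_scaled_incr[OF assms(1)] by (simp add: increments_path_def step_path_eq j_def)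
  ultimately show "\<bar>scaled_path \<kappa> \<omega> t - increments_path K (\<lambda>i. scaled_incr \<kappa> K i \<omega>) t\<bar> \<le> 2 * \<delta>"
    using assms(1) by (simp add: diff_divide_distrib[symmetric] abs_divide)
qed

section \<open>Convergence for Lipschitz functionals\<close>

context
  fixes g :: "(real \<Rightarrow> real) \<Rightarrow> real" and B L :: real and T :: nat
  assumes g_nonneg: "\<And>x. x \<in> cadlag \<Longrightarrow> 0 \<le> g x"
    and g_le: "\<And>x. x \<in> cadlag \<Longrightarrow> g x \<le> B"
    and g_cont: "locally_uniformly_continuous g"
    and g_lip: "\<And>x y \<delta>. x \<in> cadlag \<Longrightarrow> y \<in> cadlag \<Longrightarrow> 0 \<le> \<delta> \<Longrightarrow> unif_close (real T) \<delta> x y \<Longrightarrow>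
        \<bar>g x - g y\<bar> \<le> L * \<delta>"
    and L0: "0 \<le> L"
begin

lemma g_abs: "x \<in> cadlag \<Longrightarrow> \<bar>g x\<bar> \<le> B"
  using g_nonneg[of x] g_le[of x] by simp

lemma g_increments_bound: "0 < K \<Longrightarrow> \<bar>g (increments_path K d)\<bar> \<le> B"
  by (rule g_abs[OF increments_path_cadlag])

lemma g_increments_lipschitz:
  assumes "0 < K"
  shows "\<bar>g (increments_path K d) - g (increments_path K d')\<bar> \<le> L * (\<Sum>i<K * T. \<bar>d i - d' i\<bar>)"
  by (rule g_lip) (use assms increments_path_cadlag increments_path_close in \<open>auto intro: sum_nonneg\<close>)

lemma g_increments_measurable:
  assumes "0 < K"
  shows "(\<lambda>d. g (increments_path K d)) \<in> borel_measurable borel"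
  by (rule coordinate_lipschitz_imp_borel_measurable[OF g_increments_lipschitz[OF assms]])

lemma g_path_measurable: "(\<lambda>\<omega>. g (path \<omega>)) \<in> borel_measurable Q"
  by (rule borel_measurable_locally_uniformly_continuous[OF path_cadlag path_preimage g_cont])

lemma g_scaled_measurable: "0 < \<kappa> \<Longrightarrow> (\<lambda>\<omega>. g (scaled_path \<kappa> \<omega>)) \<in> borel_measurable P"
  by (rule borel_measurable_locally_uniformly_continuous[OF scaled_path_cadlag scaled_path_preimage g_cont])

lemma g_scaled_increments_diff:
  assumes "0 < \<kappa>" "0 < K" "0 < \<delta>"
  shows "\<bar>(\<integral>\<omega>. g (scaled_path \<kappa> \<omega>) \<partial>P) - (\<integral>\<omega>. g (increments_path K (\<lambda>i. scaled_incr \<kappa> K i \<omega>)) \<partial>P)\<bar> \<le>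
    2 * L * \<delta> + B * prob (bad T K \<delta> \<kappa>)"
proof -
  let ?a = "\<lambda>\<omega>. g (scaled_path \<kappa> \<omega>)" and ?b = "\<lambda>\<omega>. g (increments_path K (\<lambda>i. scaled_incr \<kappa> K i \<omega>))"
  have B0: "0 \<le> B" using g_abs[OF increments_path_cadlag[OF assms(2)]] by (meson abs_ge_zero order_trans)
  have a: "integrable P ?a"
    by (rule integrable_bounded[OF g_scaled_measurable[OF assms(1)], where b=B])
       (use g_abs scaled_path_cadlag assms in auto)
  have "(\<lambda>\<omega> i. scaled_incr \<kappa> K i \<omega>) \<in> measurable P borel"
    by (rule measurable_coordinatewise_then_product) (simp add: scaled_incr_def)
  from measurable_compose[OF this g_increments_measurable[OF assms(2)]]
  have b: "integrable P ?b"
    by (rule integrable_bounded[where b=B]) (use g_increments_bound assms in auto)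
  have "\<bar>(\<integral>\<omega>. ?a \<omega> \<partial>P) - (\<integral>\<omega>. ?b \<omega> \<partial>P)\<bar> = \<bar>\<integral>\<omega>. ?a \<omega> - ?b \<omega> \<partial>P\<bar>" using a b by simp
  also have "\<dots> \<le> (\<integral>\<omega>. \<bar>?a \<omega> - ?b \<omega>\<bar> \<partial>P)" by (rule integral_abs_bound)
  also have "\<dots> \<le> (\<integral>\<omega>. 2 * L * \<delta> + B * indicator (bad T K \<delta> \<kappa>) \<omega> \<partial>P)"
  proof (rule integral_mono_AE)
    show "AE \<omega> in P. \<bar>?a \<omega> - ?b \<omega>\<bar> \<le> 2 * L * \<delta> + B * indicator (bad T K \<delta> \<kappa>) \<omega>"
      using X_near_S
    proof (rule AE_mp, intro AE_I2 impI)
      fix \<omega> assume \<omega>: "\<omega> \<in> space P" and near: "\<forall>n. \<bar>real_of_int (X n \<omega>) - S n \<omega>\<bar> \<le> R \<omega>"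
      show "\<bar>?a \<omega> - ?b \<omega>\<bar> \<le> 2 * L * \<delta> + B * indicator (bad T K \<delta> \<kappa>) \<omega>"
      proof (cases "\<omega> \<in> bad T K \<delta> \<kappa>")
        case True
        \<comment> \<open>On the bad event only the range counts: both values lie between 0 and
          B.\<close>
        have "\<bar>?a \<omega> - ?b \<omega>\<bar> \<le> B"
          using g_nonneg[OF scaled_path_cadlag[OF assms(1)], of \<omega>] g_le[OF scaled_path_cadlag[OF assms(1)], of \<omega>]
            g_nonneg[OF increments_path_cadlag[OF assms(2)], of "\<lambda>i. scaled_incr \<kappa> K i \<omega>"]
            g_le[OF increments_path_cadlag[OF assms(2)], of "\<lambda>i. scaled_incr \<kappa> K i \<omega>"] by linarith
        then show ?thesis using True L0 assms(3) by (simp add: add_increasing)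
      next
        case False
        have "\<bar>?a \<omega> - ?b \<omega>\<bar> \<le> L * (2 * \<delta>)"
          using scaled_path_close[OF assms \<omega> False near] assms(3)
          by (intro g_lip scaled_path_cadlag increments_path_cadlag assms) auto
        then show ?thesis using False by simp
      qed
    qed
  qed (use a b bad_events in \<open>auto simp: less_top[symmetric]\<close>)
  also have "\<dots> = 2 * L * \<delta> + B * prob (bad T K \<delta> \<kappa>)"
    using bad_events by (simp add: prob_space less_top[symmetric])
  finally show ?thesis .
qed

lemma g_fdd:
  fixes M :: "nat \<Rightarrow> real"
  assumes M: "filterlim M at_top sequentially" "\<And>k. 1 \<le> M k" and K: "0 < K"
  shows "(\<lambda>k. \<integral>\<omega>. g (increments_path K (\<lambda>i. scaled_incr (M k) K i \<omega>)) \<partial>P) \<longlonglongrightarrow>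
    (\<integral>\<omega>. g (increments_path K (\<lambda>i. gap K i \<omega>)) \<partial>Q)"
  unfolding scaled_incr_def
proof (rule finite_dimensional_convergence[where m="K * T" and \<tau>="1 / real K", OF Q.prob_space_axioms])
  have pos: "0 < M k" for k using M(2)[of k] by linarith
  show "0 \<le> 1 / sqrt (M k)" for k using pos[of k] by simp
  have "filterlim (\<lambda>k. sqrt (M k)) at_top sequentially"
    by (rule filterlim_compose[OF sqrt_at_top M(1)])
  then show "(\<lambda>k. 1 / sqrt (M k)) \<longlonglongrightarrow> 0"
    using tendsto_inverse_0_at_top by (simp add: inverse_eq_divide[symmetric])
  show gm: "grid (M k) K i \<le> grid (M k) K (Suc i)" for k i
    by (rule grid_mono[OF pos]) simp
  show "(\<lambda>k. real (grid (M k) K (Suc i) - grid (M k) K i) * (1 / sqrt (M k))\<^sup>2) \<longlonglongrightarrow> 1 / real K" for i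
  proof -
    have "(\<lambda>k. real (grid (M k) K (Suc i)) / M k - real (grid (M k) K i) / M k) \<longlonglongrightarrow>
        real (Suc i) / real K - real i / real K"
      unfolding grid_def by (intro tendsto_diff floor_quotient_tendsto[OF M]) auto
    moreover have "real (Suc i) / real K - real i / real K = 1 / real K"
      by (simp add: diff_divide_distrib[symmetric])
    moreover have "real (grid (M k) K (Suc i) - grid (M k) K i) * (1 / sqrt (M k))\<^sup>2 =
        real (grid (M k) K (Suc i)) / M k - real (grid (M k) K i) / M k" for k
      using pos[of k] gm[of k i] by (simp add: power_divide of_nat_diff diff_divide_distrib)
    ultimately show ?thesis by simp
  qed
  show "Q.indep_vars (\<lambda>_. borel) (gap K) {..<K * T}" by (rule gap_indep[OF K])
  show "distr Q borel (gap K i) = centred_gaussian (sqrt (v * (1 / real K)))" for i by (rule gap_distr[OF K])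
qed (rule g_increments_bound[OF K], rule g_increments_lipschitz[OF K])

lemma g_gap_tendsto:
  "(\<lambda>n. \<integral>\<omega>. g (increments_path (Suc n) (\<lambda>i. gap (Suc n) i \<omega>)) \<partial>Q) \<longlonglongrightarrow> (\<integral>\<omega>. g (path \<omega>) \<partial>Q)"
proof (rule integral_dominated_convergence[where w="\<lambda>_. B"])
  show "(\<lambda>\<omega>. g (path \<omega>)) \<in> borel_measurable Q" by (rule g_path_measurable)
  show "(\<lambda>\<omega>. g (increments_path (Suc n) (\<lambda>i. gap (Suc n) i \<omega>))) \<in> borel_measurable Q" for n
    by (rule measurable_compose[OF _ g_increments_measurable])
       (auto intro: measurable_coordinatewise_then_product)
qed (auto intro!: increments_path_gap_tendsto g_cont g_increments_bound)

text \<open>The order of choices matters: \<delta> depends on L and e, the mesh K on \<delta>, and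
  only then does k grow with K fixed. Of the error e, one half goes to discretising the walk, a
  quarter to the finite-dimensional limit and a quarter to discretising Brownian motion.\<close>

lemma lipschitz_functional_convergence:
  fixes M :: "nat \<Rightarrow> real"
  assumes M: "filterlim M at_top sequentially" "\<And>k. 1 \<le> M k"
  shows "(\<lambda>k. \<integral>\<omega>. g (scaled_path (M k) \<omega>) \<partial>P) \<longlonglongrightarrow> (\<integral>\<omega>. g (path \<omega>) \<partial>Q)"
proof (rule LIMSEQ_I)
  fix e :: real assume e: "e > 0"
  have pos: "0 < M k" for k using M(2)[of k] by linarith
  \<comment> \<open>This makes 2 * L * \<delta> at most e / 8; adding 1 to L covers L = 0.\<close>
  define \<delta> where "\<delta> = e / (16 * (L + 1))"
  have \<delta>: "0 < \<delta>" "2 * L * \<delta> < e / 4"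
  proof -
    show "0 < \<delta>" using e L0 by (simp add: \<delta>_def)
    have "8 * (L + 1) * \<delta> = 8 * ((L + 1) * (e / (16 * (L + 1))))" by (simp add: \<delta>_def)
    also have "(L + 1) * (e / (16 * (L + 1))) = e / 16"
      using L0 nonzero_mult_divide_mult_cancel_left[of "L + 1" e 16] by (simp add: mult.commute)
    finally have "8 * (L + 1) * \<delta> = e / 2" by simp
    moreover have "2 * L * \<delta> \<le> 2 * (L + 1) * \<delta>" using \<open>0 < \<delta>\<close> by (intro mult_right_mono) auto
    ultimately show "2 * L * \<delta> < e / 4" using e by linarith
  qed
  \<comment> \<open>B times the union bound of \<open>prob_bad_le\<close> in the limit \<kappa> to
    infinity, where the rounding term and the probability involving R disappear. It is of order T /
    K + 1 / K^2.\<close>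
  define b where "b K = B * (real (K * T + 1) * (4 * c ^ 4 * (1 / real K)\<^sup>2 / \<delta> ^ 4))" for K :: nat
  have b_lim: "(\<lambda>n. b (Suc n)) \<longlonglongrightarrow> 0"
  proof -
    let ?i = "\<lambda>n. 1 / real (Suc n)"
    have i: "?i \<longlonglongrightarrow> 0" using LIMSEQ_inverse_real_of_nat by (simp only: inverse_eq_divide)
    have "(\<lambda>n. B * (4 * c ^ 4 / \<delta> ^ 4) * (real T * ?i n + ?i n * ?i n)) \<longlonglongrightarrow> B * (4 * c ^ 4 / \<delta> ^ 4) * (real T * 0 + 0 * 0)"
      by (intro tendsto_intros i)
    moreover have "b (Suc n) = B * (4 * c ^ 4 / \<delta> ^ 4) * (real T * ?i n + ?i n * ?i n)" for n
    proof -
      have "real (Suc n * T + 1) * (?i n)\<^sup>2 = real T * ?i n + ?i n * ?i n"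
      proof -
        have "(N * x + 1) * (1 / N)\<^sup>2 = x * (1 / N) + 1 / N * (1 / N)" if "N \<noteq> 0" for N x :: real
          using that by (simp add: power2_eq_square field_simps)
        moreover have "real (Suc n * T + 1) = real (Suc n) * real T + 1"
          by (simp only: of_nat_add of_nat_mult of_nat_1)
        ultimately show ?thesis using of_nat_neq_0 by metis
      qed
      then have "B * (4 * c ^ 4 / \<delta> ^ 4) * (real (Suc n * T + 1) * (?i n)\<^sup>2) =
          B * (4 * c ^ 4 / \<delta> ^ 4) * (real T * ?i n + ?i n * ?i n)" by (simp only:)
      then show ?thesis by (simp only: b_def times_divide_eq_left times_divide_eq_right mult_ac)
    qed
    ultimately show ?thesis by simp
  qed
  have "\<forall>\<^sub>F n in sequentially. b (Suc n) < e / 4"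
    using b_lim e by (intro order_tendstoD(2)) auto
  moreover have "\<forall>\<^sub>F n in sequentially.
      \<bar>(\<integral>\<omega>. g (increments_path (Suc n) (\<lambda>i. gap (Suc n) i \<omega>)) \<partial>Q) - (\<integral>\<omega>. g (path \<omega>) \<partial>Q)\<bar> < e / 4"
    using tendstoD[OF g_gap_tendsto, of "e / 4"] e by (simp add: dist_real_def)
  ultimately have "\<forall>\<^sub>F n in sequentially. b (Suc n) < e / 4 \<and>
      \<bar>(\<integral>\<omega>. g (increments_path (Suc n) (\<lambda>i. gap (Suc n) i \<omega>)) \<partial>Q) - (\<integral>\<omega>. g (path \<omega>) \<partial>Q)\<bar> < e / 4"
    by eventually_elim simp
  then obtain n where n: "b (Suc n) < e / 4"
      "\<bar>(\<integral>\<omega>. g (increments_path (Suc n) (\<lambda>i. gap (Suc n) i \<omega>)) \<partial>Q) - (\<integral>\<omega>. g (path \<omega>) \<partial>Q)\<bar> < e / 4"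
    unfolding eventually_sequentially by blast
  define K where "K = Suc n"
  have K: "0 < K" "b K < e / 4"
      "\<bar>(\<integral>\<omega>. g (increments_path K (\<lambda>i. gap K i \<omega>)) \<partial>Q) - (\<integral>\<omega>. g (path \<omega>) \<partial>Q)\<bar> < e / 4"
    using n by (auto simp: K_def)
  define u where "u k = 2 * L * \<delta> + B * (prob {\<omega> \<in> space P. \<delta> * sqrt (M k) < R \<omega>} +
    real (K * T + 1) * (4 * c ^ 4 * (1 / real K + 1 / M k)\<^sup>2 / \<delta> ^ 4))" for k
  have "u \<longlonglongrightarrow> 2 * L * \<delta> + B * (0 + real (K * T + 1) * (4 * c ^ 4 * (1 / real K + 0)\<^sup>2 / \<delta> ^ 4))"
    unfolding u_def
  proof (intro tendsto_add tendsto_mult tendsto_const tendsto_power tendsto_divide prob_exceeds_tendsto_0 R_measurable)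
    have "filterlim (\<lambda>k. sqrt (M k)) at_top sequentially"
      by (rule filterlim_compose[OF sqrt_at_top M(1)])
    then show "filterlim (\<lambda>k. \<delta> * sqrt (M k)) at_top sequentially"
      using \<delta>(1) by (intro filterlim_tendsto_pos_mult_at_top[OF tendsto_const])
    show "(\<lambda>k. 1 / M k) \<longlonglongrightarrow> 0"
      using tendsto_inverse_0_at_top[OF M(1)] by (simp add: inverse_eq_divide)
  qed (use \<delta>(1) in auto)
  then have "u \<longlonglongrightarrow> 2 * L * \<delta> + b K" by (simp add: b_def)
  then have "\<forall>\<^sub>F k in sequentially. u k < e / 2"
    using \<delta>(2) K(2) by (intro order_tendstoD(2)[of u "2 * L * \<delta> + b K"]) auto
  moreover have "\<forall>\<^sub>F k in sequentially. \<bar>(\<integral>\<omega>. g (increments_path K (\<lambda>i. scaled_incr (M k) K i \<omega>)) \<partial>P) -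
      (\<integral>\<omega>. g (increments_path K (\<lambda>i. gap K i \<omega>)) \<partial>Q)\<bar> < e / 4"
    using tendstoD[OF g_fdd[OF M K(1)], of "e / 4"] e by (simp add: dist_real_def)
  ultimately have "\<forall>\<^sub>F k in sequentially. norm ((\<integral>\<omega>. g (scaled_path (M k) \<omega>) \<partial>P) - (\<integral>\<omega>. g (path \<omega>) \<partial>Q)) < e"
  proof eventually_elim
    case (elim k)
    have B0: "0 \<le> B" using g_abs[OF increments_path_cadlag[OF K(1)]] by (meson abs_ge_zero order_trans)
    have "\<bar>(\<integral>\<omega>. g (scaled_path (M k) \<omega>) \<partial>P) - (\<integral>\<omega>. g (increments_path K (\<lambda>i. scaled_incr (M k) K i \<omega>)) \<partial>P)\<bar> \<le>
        2 * L * \<delta> + B * prob (bad T K \<delta> (M k))"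
      by (rule g_scaled_increments_diff[OF pos K(1) \<delta>(1)])
    also have "\<dots> \<le> u k"
      unfolding u_def using prob_bad_le[OF pos K(1) \<delta>(1), of T k] B0 by (intro add_left_mono mult_left_mono) auto
    finally show ?case using elim K(3) unfolding real_norm_def by linarith
  qed
  then show "\<exists>no. \<forall>k\<ge>no. norm ((\<integral>\<omega>. g (scaled_path (M k) \<omega>) \<partial>P) - (\<integral>\<omega>. g (path \<omega>) \<partial>Q)) < e"
    by (simp add: eventually_sequentially)
qed

end

text \<open>Dominated convergence selects a single n for which the Lipschitz minorant loses at most
  e / 2 under the Brownian law. On the side of the walk, being a minorant is enough, so the quality
  of the approximation there never enters; the price is a one-sided estimate.\<close>

lemma functional_liminf:
  fixes M :: "nat \<Rightarrow> real" and f :: "(real \<Rightarrow> real) \<Rightarrow> real"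
  assumes M: "filterlim M at_top sequentially" "\<And>k. 1 \<le> M k"
    and f: "locally_uniformly_continuous f" "\<And>x. x \<in> cadlag \<Longrightarrow> 0 \<le> f x" "\<And>x. x \<in> cadlag \<Longrightarrow> f x \<le> B"
    and e: "0 < e"
  shows "\<forall>\<^sub>F k in sequentially. (\<integral>\<omega>. f (path \<omega>) \<partial>Q) - e < (\<integral>\<omega>. f (scaled_path (M k) \<omega>) \<partial>P)"
proof -
  have pos: "0 < M k" for k using M(2)[of k] by linarith
  note lcont = lip_approx_locally_uniformly_continuous[where f=f, OF f(2)]
  have le: "lip_approx f n x \<le> B" if "x \<in> cadlag" for n x
    using lip_approx_le[where f=f, OF f(2) that, of n] f(3)[OF that] by linarith
  have nn: "0 \<le> lip_approx f n x" if "x \<in> cadlag" for n x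
    by (rule lip_approx_nonneg[where f=f, OF f(2) that])
  have "(\<lambda>n. \<integral>\<omega>. lip_approx f n (path \<omega>) \<partial>Q) \<longlonglongrightarrow> (\<integral>\<omega>. f (path \<omega>) \<partial>Q)"
  proof (rule integral_dominated_convergence[where w="\<lambda>_. B"])
    show "(\<lambda>\<omega>. f (path \<omega>)) \<in> borel_measurable Q"
      by (rule borel_measurable_locally_uniformly_continuous[OF path_cadlag path_preimage f(1)])
    show "(\<lambda>\<omega>. lip_approx f n (path \<omega>)) \<in> borel_measurable Q" for n
      by (rule borel_measurable_locally_uniformly_continuous[OF path_cadlag path_preimage lcont])
    show "AE \<omega> in Q. norm (lip_approx f n (path \<omega>)) \<le> B" for n
      using le nn path_cadlag by (intro AE_I2) (simp add: abs_of_nonneg)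
    show "AE \<omega> in Q. (\<lambda>n. lip_approx f n (path \<omega>)) \<longlonglongrightarrow> f (path \<omega>)"
      by (intro AE_I2 lip_approx_tendsto[where f=f, OF f(2,1)] path_cadlag)
  qed simp
  then have "\<forall>\<^sub>F n in sequentially. (\<integral>\<omega>. f (path \<omega>) \<partial>Q) - e / 2 < (\<integral>\<omega>. lip_approx f n (path \<omega>) \<partial>Q)"
    by (rule order_tendstoD) (use e in simp)
  then obtain n where n: "(\<integral>\<omega>. f (path \<omega>) \<partial>Q) - e / 2 < (\<integral>\<omega>. lip_approx f n (path \<omega>) \<partial>Q)"
    unfolding eventually_sequentially by blast
  have "(\<lambda>k. \<integral>\<omega>. lip_approx f n (scaled_path (M k) \<omega>) \<partial>P) \<longlonglongrightarrow> (\<integral>\<omega>. lip_approx f n (path \<omega>) \<partial>Q)"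
    by (rule lipschitz_functional_convergence[OF nn le lcont lip_approx_lipschitz[where f=f, OF f(2)] _ M]) auto
  then have "\<forall>\<^sub>F k in sequentially. (\<integral>\<omega>. lip_approx f n (path \<omega>) \<partial>Q) - e / 2 <
      (\<integral>\<omega>. lip_approx f n (scaled_path (M k) \<omega>) \<partial>P)"
    by (rule order_tendstoD) (use e in simp)
  then show ?thesis
  proof eventually_elim
    case (elim k)
    have c: "scaled_path (M k) \<omega> \<in> cadlag" for \<omega> by (rule scaled_path_cadlag[OF pos])
    have "(\<integral>\<omega>. lip_approx f n (scaled_path (M k) \<omega>) \<partial>P) \<le> (\<integral>\<omega>. f (scaled_path (M k) \<omega>) \<partial>P)"
    proof (rule integral_mono)
      show "integrable P (\<lambda>\<omega>. lip_approx f n (scaled_path (M k) \<omega>))"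
        by (rule integrable_bounded[where b=B],
            rule borel_measurable_locally_uniformly_continuous[OF c scaled_path_preimage[OF pos] lcont])
           (simp_all add: abs_of_nonneg nn le c)
      show "integrable P (\<lambda>\<omega>. f (scaled_path (M k) \<omega>))"
        by (rule integrable_bounded[where b=B],
            rule borel_measurable_locally_uniformly_continuous[OF c scaled_path_preimage[OF pos] f(1)])
           (simp_all add: abs_of_nonneg f c)
    qed (rule lip_approx_le[where f=f, OF f(2) c])
    with elim n show ?case by linarith
  qed
qed

text \<open>The one-sided estimate is applied to b + f and to b - f, which both take values in
  [0, 2 b]; together they bound the integral from both sides.\<close>

lemma functional_convergence:
  fixes M :: "nat \<Rightarrow> real" and f :: "(real \<Rightarrow> real) \<Rightarrow> real"
  assumes M: "filterlim M at_top sequentially" "\<And>k. 1 \<le> M k"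
    and f: "locally_uniformly_continuous f" and bound: "\<And>x. x \<in> cadlag \<Longrightarrow> \<bar>f x\<bar> \<le> b"
  shows "(\<lambda>k. \<integral>\<omega>. f (scaled_path (M k) \<omega>) \<partial>P) \<longlonglongrightarrow> (\<integral>\<omega>. f (path \<omega>) \<partial>Q)"
proof (rule LIMSEQ_I)
  fix e :: real assume e: "e > 0"
  have pos: "0 < M k" for k using M(2)[of k] by linarith
  have c: "scaled_path (M k) \<omega> \<in> cadlag" for k \<omega> by (rule scaled_path_cadlag[OF pos])
  have fP: "integrable P (\<lambda>\<omega>. f (scaled_path (M k) \<omega>))" for k
    by (rule integrable_bounded[where b=b],
        rule borel_measurable_locally_uniformly_continuous[OF c scaled_path_preimage[OF pos] f])
       (use bound[OF c] in simp_all)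
  have fQ: "integrable Q (\<lambda>\<omega>. f (path \<omega>))"
    by (intro Q.integrable_const_bound[of _ b] AE_I2
        borel_measurable_locally_uniformly_continuous[OF path_cadlag path_preimage f])
       (simp_all add: bound path_cadlag)
  have "locally_uniformly_continuous (\<lambda>x. b + f x)" "locally_uniformly_continuous (\<lambda>x. b - f x)"
    using f by (simp_all add: locally_uniformly_continuous_def abs_minus_commute)
  then have
    "\<forall>\<^sub>F k in sequentially. (\<integral>\<omega>. b + f (path \<omega>) \<partial>Q) - e < (\<integral>\<omega>. b + f (scaled_path (M k) \<omega>) \<partial>P)"
    "\<forall>\<^sub>F k in sequentially. (\<integral>\<omega>. b - f (path \<omega>) \<partial>Q) - e < (\<integral>\<omega>. b - f (scaled_path (M k) \<omega>) \<partial>P)"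
    using bound by (auto intro!: functional_liminf[OF M _ _ _ e, where B="2 * b"] simp: abs_le_iff) (smt (verit))+
  then have "\<forall>\<^sub>F k in sequentially. norm ((\<integral>\<omega>. f (scaled_path (M k) \<omega>) \<partial>P) - (\<integral>\<omega>. f (path \<omega>) \<partial>Q)) < e"
    by eventually_elim (use fP fQ in \<open>simp add: prob_space Q.prob_space abs_less_iff\<close>)
  then show "\<exists>no. \<forall>k\<ge>no. norm ((\<integral>\<omega>. f (scaled_path (M k) \<omega>) \<partial>P) - (\<integral>\<omega>. f (path \<omega>) \<partial>Q)) < e"
    by (simp add: eventually_sequentially)
qed

lemma converges_in_distribution_scaled_path:
  "converges_in_distribution skorokhod P scaled_path Q path at_top"
  unfolding converges_in_distribution_def
proof (intro conjI allI impI)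
  show "\<forall>\<^sub>F \<kappa> in at_top. scaled_path \<kappa> \<in> measurable P (borel_of skorokhod)"
    using eventually_gt_at_top[of 0]
    by eventually_elim (intro measurable_borel_of_skorokhodI scaled_path_cadlag scaled_path_preimage)
  show "path \<in> measurable Q (borel_of skorokhod)"
    by (intro measurable_borel_of_skorokhodI path_cadlag path_preimage)
  fix f assume f: "continuous_map skorokhod euclideanreal f \<and> bounded (f ` topspace skorokhod)"
  then obtain b where b: "\<And>x. x \<in> cadlag \<Longrightarrow> \<bar>f x\<bar> \<le> b"
    by (auto simp: bounded_iff)
  have cont: "locally_uniformly_continuous f"
    using f continuous_map_skorokhod_imp_locally_uniformly_continuous by blast
  show "((\<lambda>\<kappa>. \<integral>\<omega>. f (scaled_path \<kappa> \<omega>) \<partial>P) \<longlongrightarrow> (\<integral>\<omega>. f (path \<omega>) \<partial>Q)) at_top"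
  \<comment> \<open>Levy's theorem and dominated convergence were used along sequences of scales,
    and every sequence tending to infinity suffices for the limit at infinity.\<close>
  proof (rule tendsto_at_topI_sequentially)
    fix M :: "nat \<Rightarrow> real" assume M: "filterlim M at_top sequentially"
    have ev: "\<forall>\<^sub>F k in sequentially. max 1 (M k) = M k"
      using M unfolding filterlim_at_top by (auto elim!: allE[of _ 1] eventually_mono)
    then have "filterlim (\<lambda>k. max 1 (M k)) at_top sequentially"
      using M by (subst filterlim_cong[OF refl refl ev])
    then have "(\<lambda>k. \<integral>\<omega>. f (scaled_path (max 1 (M k)) \<omega>) \<partial>P) \<longlonglongrightarrow> (\<integral>\<omega>. f (path \<omega>) \<partial>Q)"
      by (rule functional_convergence[OF _ _ cont b]) auto
    then show "(\<lambda>k. \<integral>\<omega>. f (scaled_path (M k) \<omega>) \<partial>P) \<longlonglongrightarrow> (\<integral>\<omega>. f (path \<omega>) \<partial>Q)"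
      by (rule Lim_transform_eventually) (use ev in eventually_elim, simp)
  qed
qed

end

section \<open>The two-state walk\<close>

instance sign :: countable
  by countable_datatype

fun sign_val :: "sign \<Rightarrow> real" where
  "sign_val Plus = 1"
| "sign_val Minus = - 1"

fun sign_int :: "sign \<Rightarrow> int" where
  "sign_int Plus = 1"
| "sign_int Minus = - 1"

fun flip :: "sign \<Rightarrow> sign" where
  "flip Plus = Minus"
| "flip Minus = Plus"

lemma of_int_sign_int: "real_of_int (sign_int y) = sign_val y"
  by (cases y) auto

lemma sign_val_flip: "sign_val (flip y) = - sign_val y"
  by (cases y) auto

lemma abs_sign_val: "\<bar>sign_val y\<bar> = 1"
  by (cases y) auto

lemma sign_val_sq: "sign_val y * sign_val y = 1"
  by (cases y) auto

text \<open>The moves are numbered relative to the current sign: along it, against it, and the flip.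
  In this numbering the probabilities are A, B, C in every state, which makes the move independent
  of the past.\<close>

fun target :: "nat \<Rightarrow> int \<times> sign \<Rightarrow> int \<times> sign" where
  "target i (x, y) = (if i = 0 then (x + sign_int y, y) else if i = 1 then (x - sign_int y, y) else (x, flip y))"

text \<open>The value 3 marks a transition that the chain makes with probability 0.\<close>
definition move :: "int \<times> sign \<Rightarrow> int \<times> sign \<Rightarrow> nat" where
  "move s s' = (if s' = target 0 s then 0 else if s' = target 1 s then 1 else if s' = target 2 s then 2 else 3)"

lemma target_neq: "target 0 s \<noteq> target 1 s" "target 0 s \<noteq> target 2 s" "target 1 s \<noteq> target 2 s"
  by (cases s; cases "snd s"; auto)+

lemma move_eq_iff: "i < 3 \<Longrightarrow> move s s' = i \<longleftrightarrow> s' = target i s"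
  using target_neq[of s] by (auto simp: move_def numeral_3_eq_3 numeral_2_eq_2 less_Suc_eq)

lemma move_le: "move s s' < 4"
  by (simp add: move_def)

locale signed_walk =
  fixes A B C :: real and P :: "'a measure" and X :: "nat \<Rightarrow> 'a \<Rightarrow> int" and Y :: "nat \<Rightarrow> 'a \<Rightarrow> sign"
  assumes A0: "A \<ge> 0" and B0: "B \<ge> 0" and C0: "C > 0" and ABC: "A + B + C = 1"
    and chain: "markov_chain P (\<lambda>n \<omega>. (X n \<omega>, Y n \<omega>)) (transition A B C)"

sublocale signed_walk \<subseteq> prob_space P
  using chain by (simp add: markov_chain_def)

context signed_walk
begin

definition state :: "nat \<Rightarrow> 'a \<Rightarrow> int \<times> sign" where
  "state n \<omega> = (X n \<omega>, Y n \<omega>)"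

text \<open>The events \<open>history n \<omega> = h\<close> are exactly those on which
  \<open>markov_chain\<close> conditions, and lists over a countable type form a countable
  type.\<close>

definition history :: "nat \<Rightarrow> 'a \<Rightarrow> (int \<times> sign) list" where
  "history n \<omega> = map (\<lambda>k. state k \<omega>) [0..<Suc n]"

definition innovation :: "nat \<Rightarrow> 'a \<Rightarrow> nat" where
  "innovation n \<omega> = move (state n \<omega>) (state (Suc n) \<omega>)"

definition weight :: "nat \<Rightarrow> real" where
  "weight i = (if i = 0 then A else if i = 1 then B else if i = 2 then C else 0)"

lemma transition_target: "i < 3 \<Longrightarrow> transition A B C s (target i s) = weight i"
  by (cases s; cases "snd s") (auto simp: weight_def numeral_3_eq_3 less_Suc_eq)

lemma state_measurable [measurable]: "state n \<in> measurable P (count_space UNIV)"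
  using chain unfolding markov_chain_def state_def[abs_def] by blast

lemma history_eq_iff: "history n \<omega> = h \<longleftrightarrow> length h = Suc n \<and> (\<forall>k\<le>n. state k \<omega> = h ! k)"
  by (auto simp: history_def list_eq_iff_nth_eq less_Suc_eq_le nth_append simp del: upt_Suc)

lemma history_eq_iff': "history n \<omega> = history n \<omega>' \<longleftrightarrow> (\<forall>k\<le>n. state k \<omega> = state k \<omega>')"
  unfolding history_eq_iff[of n \<omega> "history n \<omega>'"]
  by (auto simp: history_def less_Suc_eq_le simp del: upt_Suc)

lemma history_event [measurable]: "{\<omega> \<in> space P. history n \<omega> = h} \<in> events"
proof -
  have "{\<omega> \<in> space P. state k \<omega> = s} \<in> events" for k s
    using measurable_sets[OF state_measurable, of "{s}" k] by (simp add: vimage_def Int_def conj_commute)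
  then have "{\<omega> \<in> space P. \<forall>k\<in>{..n}. state k \<omega> = h ! k} \<in> events"
    by (intro sets.sets_Collect_finite_All) auto
  then show ?thesis
    unfolding history_eq_iff by (cases "length h = Suc n") (simp_all add: Ball_def)
qed

lemma history_measurable: "history n \<in> measurable P (count_space UNIV)"
proof (subst measurable_count_space_eq_countable)
  show "history n \<in> space P \<rightarrow> UNIV \<and> (\<forall>a\<in>UNIV. history n -` {a} \<inter> space P \<in> events)"
    using history_event[of n] by (auto simp: vimage_def Int_def conj_commute)
qed (rule countableI_type)

lemma innovation_measurable: "innovation n \<in> measurable P (count_space UNIV)"
proof -
  have "(\<lambda>\<omega>. (state n \<omega>, state (Suc n) \<omega>)) \<in> measurable P (count_space UNIV \<Otimes>\<^sub>M count_space UNIV)"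
    by measurable
  then have "(\<lambda>\<omega>. (state n \<omega>, state (Suc n) \<omega>)) \<in> measurable P (count_space UNIV)"
    by (simp add: pair_measure_countable[OF countableI_type countableI_type])
  from measurable_compose[OF this, of "\<lambda>(s, s'). move s s'" "count_space UNIV"]
  show ?thesis by (simp add: innovation_def[abs_def])
qed

text \<open>In product form the Markov property extends to histories of probability 0 and to lists
  of the wrong length, where both sides vanish.\<close>

lemma prob_history_step:
  "prob {\<omega> \<in> space P. history n \<omega> = h \<and> state (Suc n) \<omega> = j} =
    transition A B C (last h) j * prob {\<omega> \<in> space P. history n \<omega> = h}"
proof (cases "length h = Suc n \<and> prob {\<omega> \<in> space P. history n \<omega> = h} > 0")
  case True
  then have h: "history n \<omega> = h \<longleftrightarrow> (\<forall>k\<le>n. state k \<omega> = h ! k)" for \<omega>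
    by (simp add: history_eq_iff)
  have "prob {\<omega> \<in> space P. \<forall>k\<le>n. state k \<omega> = h ! k} > 0" using True h by simp
  then have "\<P>(\<omega> in P. state (Suc n) \<omega> = j \<bar> \<forall>k\<le>n. state k \<omega> = h ! k) = transition A B C (h ! n) j"
    using chain unfolding markov_chain_def state_def by blast
  moreover have "last h = h ! n" using True by (subst last_conv_nth) auto
  ultimately show ?thesis
    using True unfolding cond_prob_def h[symmetric] by (simp add: field_simps conj_commute)
next
  case False
  then have "prob {\<omega> \<in> space P. history n \<omega> = h} = 0"
  proof (cases "length h = Suc n")
    case False
    then have empty: "{\<omega> \<in> space P. history n \<omega> = h} = {}" by (auto simp: history_eq_iff)
    show ?thesis unfolding empty by simp
  qed (use False measure_nonneg[of P "{\<omega> \<in> space P. history n \<omega> = h}"] in simp)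
  moreover have "prob {\<omega> \<in> space P. history n \<omega> = h \<and> state (Suc n) \<omega> = j} \<le> prob {\<omega> \<in> space P. history n \<omega> = h}"
    by (rule finite_measure_mono) auto
  ultimately show ?thesis using measure_nonneg[of P "{\<omega> \<in> space P. history n \<omega> = h \<and> state (Suc n) \<omega> = j}"] by simp
qed

lemma innovation_event [measurable]: "{\<omega> \<in> space P. history n \<omega> = h \<and> innovation n \<omega> = i} \<in> events"
proof -
  have "{\<omega> \<in> space P. innovation n \<omega> = i} \<in> events"
    using measurable_sets[OF innovation_measurable, of "{i}" n] by (simp add: vimage_def Int_def conj_commute)
  then show ?thesis by measurable
qed

text \<open>For the three regular moves this is the Markov property at the target state. Since A + B
  + C = 1, they exhaust the probability of the history, and any other code is left with 0.\<close>

lemma prob_history_innovation: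
  "prob {\<omega> \<in> space P. history n \<omega> = h \<and> innovation n \<omega> = i} = weight i * prob {\<omega> \<in> space P. history n \<omega> = h}"
proof -
  let ?E = "\<lambda>i. {\<omega> \<in> space P. history n \<omega> = h \<and> innovation n \<omega> = i}"
  have small: "prob (?E i) = weight i * prob {\<omega> \<in> space P. history n \<omega> = h}" if "i < 3" for i
  proof -
    have "last h = state n \<omega>" if "history n \<omega> = h" for \<omega>
      using that by (auto simp: history_def)
    then have "?E i = {\<omega> \<in> space P. history n \<omega> = h \<and> state (Suc n) \<omega> = target i (last h)}"
      using \<open>i < 3\<close> by (auto simp: innovation_def move_eq_iff)
    then show ?thesis by (simp add: prob_history_step transition_target[OF that])
  qed
  show ?thesis
  proof (cases "i < 3")
    case False
    have "prob (\<Union>j\<in>{0, 1, 2, i}. ?E j) = (\<Sum>j\<in>{0, 1, 2, i}. prob (?E j))"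
      by (rule finite_measure_finite_Union) (auto simp: disjoint_family_on_def)
    also have "\<dots> = (A + B + C) * prob {\<omega> \<in> space P. history n \<omega> = h} + prob (?E i)"
      using False small[of 0] small[of 1] small[of 2] by (simp add: weight_def algebra_simps)
    finally have "prob {\<omega> \<in> space P. history n \<omega> = h} + prob (?E i) = prob (\<Union>j\<in>{0, 1, 2, i}. ?E j)"
      by (simp add: ABC)
    also have "\<dots> \<le> prob {\<omega> \<in> space P. history n \<omega> = h}" by (rule finite_measure_mono) auto
    finally show ?thesis using False measure_nonneg[of P "?E i"] by (simp add: weight_def)
  qed (rule small)
qed

lemma prob_history_sums:
  assumes "\<And>h. {\<omega> \<in> space P. history n \<omega> = h \<and> Q \<omega>} \<in> events"
  shows "(\<lambda>k. prob {\<omega> \<in> space P. to_nat (history n \<omega>) = k \<and> Q \<omega>}) sums prob {\<omega> \<in> space P. Q \<omega>}"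
proof -
  let ?E = "\<lambda>k. {\<omega> \<in> space P. to_nat (history n \<omega>) = k \<and> Q \<omega>}"
  have "?E k \<in> events" for k
  proof (cases "\<exists>h :: (int \<times> sign) list. to_nat h = k")
    case True
    then obtain h :: "(int \<times> sign) list" where "to_nat h = k" by blast
    then have "?E k = {\<omega> \<in> space P. history n \<omega> = h \<and> Q \<omega>}" by auto
    then show ?thesis using assms by simp
  next
    case False
    then have empty: "?E k = {}" by auto
    show ?thesis unfolding empty by simp
  qed
  then have "(\<lambda>k. prob (?E k)) sums prob (\<Union>k. ?E k)"
    by (intro finite_measure_UNION) (auto simp: disjoint_family_on_def)
  moreover have "(\<Union>k. ?E k) = {\<omega> \<in> space P. Q \<omega>}" by auto
  ultimately show ?thesis by simp
qed

lemma prob_code_innovation: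
  "prob {\<omega> \<in> space P. to_nat (history n \<omega>) = k \<and> innovation n \<omega> = i} =
    weight i * prob {\<omega> \<in> space P. to_nat (history n \<omega>) = k}"
proof (cases "\<exists>h :: (int \<times> sign) list. to_nat h = k")
  case True
  then obtain h :: "(int \<times> sign) list" where "to_nat h = k" by blast
  then show ?thesis using prob_history_innovation[of n h i] by auto
next
  case False
  then have empty: "{\<omega> \<in> space P. to_nat (history n \<omega>) = k \<and> innovation n \<omega> = i} = {}"
    "{\<omega> \<in> space P. to_nat (history n \<omega>) = k} = {}" by auto
  show ?thesis unfolding empty by simp
qed

lemma prob_innovation: "prob {\<omega> \<in> space P. innovation n \<omega> = i} = weight i"
proof -
  have "(\<lambda>k. prob {\<omega> \<in> space P. to_nat (history n \<omega>) = k}) sums 1"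
    using prob_history_sums[of n "\<lambda>_. True"] by (simp add: prob_space)
  from sums_mult[OF this, of "weight i"]
  have "(\<lambda>k. prob {\<omega> \<in> space P. to_nat (history n \<omega>) = k \<and> innovation n \<omega> = i}) sums weight i"
    by (simp add: prob_code_innovation)
  moreover have "(\<lambda>k. prob {\<omega> \<in> space P. to_nat (history n \<omega>) = k \<and> innovation n \<omega> = i}) sums
      prob {\<omega> \<in> space P. innovation n \<omega> = i}"
    by (rule prob_history_sums) measurable
  ultimately show ?thesis using sums_unique2 by blast
qed

text \<open>The joint probabilities factor because the weight of a move does not depend on the
  history. Coding histories by naturals places both variables in a countable discrete space, where
  laws may be compared at single points.\<close>

lemma history_innovation_indep:
  "indep_var (count_space UNIV) (\<lambda>\<omega>. to_nat (history n \<omega>)) (count_space UNIV) (innovation n)"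
  unfolding indep_var_distribution_eq
proof (intro conjI)
  let ?c = "\<lambda>\<omega>. to_nat (history n \<omega>)"
  let ?N = "count_space (UNIV :: nat set)"
  show c: "?c \<in> measurable P ?N"
    by (rule measurable_compose[OF history_measurable]) simp
  show i: "innovation n \<in> measurable P ?N" by (rule innovation_measurable)
  interpret I: prob_space "distr P ?N (innovation n)" by (rule prob_space_distr[OF i])
  show "distr P ?N ?c \<Otimes>\<^sub>M distr P ?N (innovation n) = distr P (?N \<Otimes>\<^sub>M ?N) (\<lambda>\<omega>. (?c \<omega>, innovation n \<omega>))"
  proof (rule measure_eqI_countable)
    have NN: "?N \<Otimes>\<^sub>M ?N = count_space UNIV"
      using pair_measure_countable[of "UNIV :: nat set" "UNIV :: nat set"] by simp
    have "sets (distr P ?N ?c \<Otimes>\<^sub>M distr P ?N (innovation n)) = sets (?N \<Otimes>\<^sub>M ?N)"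
      by (rule sets_pair_measure_cong) simp_all
    then show "sets (distr P ?N ?c \<Otimes>\<^sub>M distr P ?N (innovation n)) = Pow UNIV"
      by (simp only: NN sets_count_space)
    show "sets (distr P (?N \<Otimes>\<^sub>M ?N) (\<lambda>\<omega>. (?c \<omega>, innovation n \<omega>))) = Pow UNIV"
      by (simp only: NN sets_distr sets_count_space)
    show "countable (UNIV :: (nat \<times> nat) set)" by simp
    fix p :: "nat \<times> nat"
    obtain k j where p: "p = (k, j)" by (cases p)
    have "emeasure (distr P ?N ?c \<Otimes>\<^sub>M distr P ?N (innovation n)) {p} =
        emeasure (distr P ?N ?c) {k} * emeasure (distr P ?N (innovation n)) {j}"
      using I.emeasure_pair_measure_Times[of "{k}" "distr P ?N ?c" "{j}"] by (simp add: p)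
    also have "\<dots> = ennreal (prob {\<omega> \<in> space P. ?c \<omega> = k} * prob {\<omega> \<in> space P. innovation n \<omega> = j})"
      using c i by (simp add: emeasure_distr emeasure_eq_measure ennreal_mult vimage_def Int_def conj_commute)
    also have "\<dots> = ennreal (prob {\<omega> \<in> space P. ?c \<omega> = k \<and> innovation n \<omega> = j})"
      by (simp only: prob_code_innovation prob_innovation mult.commute)
    also have "\<dots> = emeasure (distr P (?N \<Otimes>\<^sub>M ?N) (\<lambda>\<omega>. (?c \<omega>, innovation n \<omega>))) {p}"
      using measurable_Pair[OF c i]
      by (simp add: emeasure_distr emeasure_eq_measure NN p vimage_def Int_def conj_commute)
    finally show "emeasure (distr P ?N ?c \<Otimes>\<^sub>M distr P ?N (innovation n)) {p} =
        emeasure (distr P (?N \<Otimes>\<^sub>M ?N) (\<lambda>\<omega>. (?c \<omega>, innovation n \<omega>))) {p}" .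
  qed
qed

text \<open>By independence the integral splits, and the mean of f over the moves is a sum of four
  terms in which the code 3 has weight 0. Both martingale conditions are instances of this
  formula.\<close>

lemma integral_innovation:
  fixes f :: "nat \<Rightarrow> complex"
  assumes Z: "determined_by P (history n) Z" and b: "\<And>\<omega>. \<omega> \<in> space P \<Longrightarrow> cmod (Z \<omega>) \<le> b"
  shows "(\<integral>\<omega>. Z \<omega> * f (innovation n \<omega>) \<partial>P) = (\<integral>\<omega>. Z \<omega> \<partial>P) * (A * f 0 + B * f 1 + C * f 2)"
proof -
  let ?c = "\<lambda>\<omega>. to_nat (history n \<omega>)"
  have Zc: "determined_by P ?c Z" using Z unfolding determined_by_def to_nat_split .
  obtain g where g: "\<And>\<omega>. \<omega> \<in> space P \<Longrightarrow> Z \<omega> = g (?c \<omega>)"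
    by (rule determined_by_factor[OF Zc]) (rule that)
  have ind: "indep_var borel (g \<circ> ?c) borel (f \<circ> innovation n)"
    by (rule indep_var_compose[OF history_innovation_indep]) auto
  have gm: "g \<circ> ?c \<in> borel_measurable P"
    by (rule indep_var_rv1[OF ind])
  have gint: "integrable P (g \<circ> ?c)"
    using gm b g by (intro integrable_const_bound[of _ b]) auto
  have dec: "(f \<circ> innovation n) \<omega> =
      (\<Sum>i<4. indicator {\<omega> \<in> space P. innovation n \<omega> = i} \<omega> *\<^sub>R f i)" if "\<omega> \<in> space P" for \<omega>
  proof -
    have lt: "innovation n \<omega> < 4" by (simp add: innovation_def move_le)
    have "indicator {\<omega> \<in> space P. innovation n \<omega> = i} \<omega> *\<^sub>R f i = (if i = innovation n \<omega> then f i else 0)" for i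
      using that by (simp add: indicator_def)
    then have "(\<Sum>i<4. indicator {\<omega> \<in> space P. innovation n \<omega> = i} \<omega> *\<^sub>R f i) =
        (\<Sum>i<4. if i = innovation n \<omega> then f i else 0)" by (simp only:)
    also have "\<dots> = f (innovation n \<omega>)" using lt by (simp add: sum.delta)
    finally show ?thesis by (simp only: comp_def)
  qed
  have ev: "{\<omega> \<in> space P. innovation n \<omega> = i} \<in> events" for i
    using measurable_sets[OF innovation_measurable, of "{i}" n] by (simp add: vimage_def Int_def conj_commute)
  then have int: "integrable P (\<lambda>\<omega>. indicator {\<omega> \<in> space P. innovation n \<omega> = i} \<omega> *\<^sub>R f i)" for i
    by (intro integrable_scaleR_left) (simp add: less_top[symmetric])
  have fint: "integrable P (f \<circ> innovation n)"
    by (subst Bochner_Integration.integrable_cong[OF refl dec], assumption)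
       (rule Bochner_Integration.integrable_sum, rule int)
  have "(\<integral>\<omega>. (f \<circ> innovation n) \<omega> \<partial>P) = (\<Sum>i<4. weight i *\<^sub>R f i)"
  proof -
    have "(\<integral>\<omega>. (f \<circ> innovation n) \<omega> \<partial>P) =
        (\<integral>\<omega>. (\<Sum>i<4. indicator {\<omega> \<in> space P. innovation n \<omega> = i} \<omega> *\<^sub>R f i) \<partial>P)"
      by (rule Bochner_Integration.integral_cong[OF refl dec])
    also have "\<dots> = (\<Sum>i<4. (\<integral>\<omega>. indicator {\<omega> \<in> space P. innovation n \<omega> = i} \<omega> *\<^sub>R f i \<partial>P))"
      by (rule Bochner_Integration.integral_sum) (rule int)
    also have "\<dots> = (\<Sum>i<4. weight i *\<^sub>R f i)"
      using ev by (intro sum.cong refl) (simp add: prob_innovation less_top[symmetric])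
    finally show ?thesis .
  qed
  also have "\<dots> = A * f 0 + B * f 1 + C * f 2"
    by (simp add: weight_def eval_nat_numeral scaleR_conv_of_real)
  finally have Ef: "(\<integral>\<omega>. (f \<circ> innovation n) \<omega> \<partial>P) = A * f 0 + B * f 1 + C * f 2" .
  have "(\<integral>\<omega>. Z \<omega> * f (innovation n \<omega>) \<partial>P) = (\<integral>\<omega>. (g \<circ> ?c) \<omega> * (f \<circ> innovation n) \<omega> \<partial>P)"
    by (rule Bochner_Integration.integral_cong) (auto simp: g)
  also have "\<dots> = (\<integral>\<omega>. (g \<circ> ?c) \<omega> \<partial>P) * (\<integral>\<omega>. (f \<circ> innovation n) \<omega> \<partial>P)"
    by (rule indep_var_lebesgue_integral[OF ind gint fint])
  also have "(\<integral>\<omega>. (g \<circ> ?c) \<omega> \<partial>P) = (\<integral>\<omega>. Z \<omega> \<partial>P)"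
    by (rule Bochner_Integration.integral_cong) (auto simp: g)
  finally show ?thesis by (simp only: Ef)
qed

definition drift :: real where
  "drift = (A - B) / (2 * C)"

text \<open>
  The multiple of the sign is chosen so that \<open>X n + drift * sign_val (Y n)\<close> is a martingale; relative
  to the current sign, its increments are 1, -1 and \<open>- 2 * drift\<close>.
\<close>
definition jump :: "nat \<Rightarrow> real" where
  "jump i = (if i = 0 then 1 else if i = 1 then - 1 else if i = 2 then - 2 * drift else 0)"

definition mart_incr :: "nat \<Rightarrow> 'a \<Rightarrow> real" where
  "mart_incr n \<omega> = sign_val (Y n \<omega>) * jump (innovation n \<omega>)"

lemma jump_mean: "A * jump 0 + B * jump 1 + C * jump 2 = 0"
  using C0 by (simp add: jump_def drift_def field_simps)

lemma jump_variance:
  "A * (jump 0)\<^sup>2 + B * (jump 1)\<^sup>2 + C * (jump 2)\<^sup>2 = (A - B)\<^sup>2 / C + (A + B)"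
  using C0 by (simp add: jump_def drift_def power2_eq_square field_simps)

lemma sign_determined: "determined_by P (history n) (\<lambda>\<omega>. sign_val (Y n \<omega>))"
  unfolding determined_by_def history_eq_iff' by (auto simp: state_def)

lemma bounded_martingale:
  "bounded_martingale P history mart_incr (1 + 2 * \<bar>drift\<bar>) ((A - B)\<^sup>2 / C + (A + B))"
proof
  show "history n \<in> measurable P (count_space UNIV)" for n by (rule history_measurable)
  show "determined_by P (history n) (history m)" if "m \<le> n" for m n
    unfolding determined_by_def history_eq_iff' using that by auto
  show "determined_by P (history (Suc n)) (mart_incr n)" for n
    unfolding determined_by_def history_eq_iff' mart_incr_def innovation_def by (auto simp: state_def)
  show "\<bar>mart_incr n \<omega>\<bar> \<le> 1 + 2 * \<bar>drift\<bar>" for n \<omega>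
    by (auto simp: mart_incr_def abs_mult abs_sign_val jump_def)
next
  fix n and Z :: "'a \<Rightarrow> complex" and b
  assume Z: "determined_by P (history n) Z" and b: "\<And>\<omega>. \<omega> \<in> space P \<Longrightarrow> cmod (Z \<omega>) \<le> b"
  \<comment> \<open>The sign belongs to the past and has modulus 1: for the mean it is absorbed into
    the test variable, for the variance it squares to 1.\<close>
  have Z': "determined_by P (history n) (\<lambda>\<omega>. Z \<omega> * of_real (sign_val (Y n \<omega>)))"
    by (rule determined_by_compose2[OF Z sign_determined])
  have b': "cmod (Z \<omega> * of_real (sign_val (Y n \<omega>))) \<le> b" if "\<omega> \<in> space P" for \<omega>
    using b[OF that] by (simp add: norm_mult abs_sign_val)
  have "complex_of_real A * jump 0 + B * jump 1 + C * jump 2 = complex_of_real (A * jump 0 + B * jump 1 + C * jump 2)"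
    by simp
  then show "(\<integral>\<omega>. Z \<omega> * mart_incr n \<omega> \<partial>P) = 0"
    using integral_innovation[OF Z' b', of "\<lambda>i. of_real (jump i)"]
    unfolding jump_mean by (simp add: mart_incr_def mult.assoc)
  have "complex_of_real A * (jump 0)\<^sup>2 + B * (jump 1)\<^sup>2 + C * (jump 2)\<^sup>2 =
      complex_of_real (A * (jump 0)\<^sup>2 + B * (jump 1)\<^sup>2 + C * (jump 2)\<^sup>2)"
    by simp
  moreover have "(mart_incr n \<omega>)\<^sup>2 = (jump (innovation n \<omega>))\<^sup>2" for \<omega>
    by (simp add: mart_incr_def power_mult_distrib power2_eq_square[of "sign_val _"] sign_val_sq)
  ultimately show "(\<integral>\<omega>. Z \<omega> * (mart_incr n \<omega>)\<^sup>2 \<partial>P) = ((A - B)\<^sup>2 / C + (A + B)) * (\<integral>\<omega>. Z \<omega> \<partial>P)"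
    using integral_innovation[OF Z b, of "\<lambda>i. of_real ((jump i)\<^sup>2)"]
    unfolding jump_variance by (simp add: mult.commute)
qed

end

sublocale signed_walk \<subseteq> mart: bounded_martingale P history mart_incr "1 + 2 * \<bar>drift\<bar>" "(A - B)\<^sup>2 / C + (A + B)"
  by (rule bounded_martingale)

sublocale signed_walk \<subseteq> near: near_martingale P history mart_incr "1 + 2 * \<bar>drift\<bar>" "(A - B)\<^sup>2 / C + (A + B)"
    X "\<lambda>\<omega>. \<bar>real_of_int (X 0 \<omega>)\<bar> + 2 * \<bar>drift\<bar>"
proof
  show X: "X n \<in> measurable P (count_space UNIV)" for n
    using measurable_compose[OF state_measurable, of fst "count_space UNIV" n] by (simp add: state_def)
  show "(\<lambda>\<omega>. \<bar>real_of_int (X 0 \<omega>)\<bar> + 2 * \<bar>drift\<bar>) \<in> borel_measurable P"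
    by (rule measurable_compose[OF X[of 0]]) simp
  \<comment> \<open>Almost surely no transition of probability 0 ever happens, since there are only
    countably many times at which it could.\<close>
  have "AE \<omega> in P. innovation n \<omega> \<noteq> 3" for n
  proof -
    have "{\<omega> \<in> space P. innovation n \<omega> = 3} \<in> events"
      using measurable_sets[OF innovation_measurable, of "{3}" n] by (simp add: vimage_def Int_def conj_commute)
    then have "{\<omega> \<in> space P. innovation n \<omega> = 3} \<in> null_sets P"
      using prob_innovation[of n 3] by (simp add: null_sets_def emeasure_eq_measure weight_def)
    then have "AE \<omega> in P. \<omega> \<notin> {\<omega> \<in> space P. innovation n \<omega> = 3}" by (rule AE_not_in)
    then show ?thesis by (rule AE_mp) (auto intro!: AE_I2)
  qed
  then have "AE \<omega> in P. \<forall>n. innovation n \<omega> \<noteq> 3" by (simp add: AE_all_countable)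
  then show "AE \<omega> in P. \<forall>n. \<bar>real_of_int (X n \<omega>) - mart.S n \<omega>\<bar> \<le> \<bar>real_of_int (X 0 \<omega>)\<bar> + 2 * \<bar>drift\<bar>"
  proof (rule AE_mp, intro AE_I2 impI allI)
    fix \<omega> n assume no3: "\<forall>n. innovation n \<omega> \<noteq> 3"
    \<comment> \<open>Pathwise identity: along regular moves X plus the multiple of the sign changes
      exactly by \<open>mart_incr\<close>. A move with code 3 would break it.\<close>
    have step: "real_of_int (X (Suc n) \<omega>) + drift * sign_val (Y (Suc n) \<omega>) =
        real_of_int (X n \<omega>) + drift * sign_val (Y n \<omega>) + mart_incr n \<omega>" for n
    proof -
      have lt: "innovation n \<omega> < 3"
        using no3 move_le[of "state n \<omega>" "state (Suc n) \<omega>"] by (auto simp: innovation_def less_Suc_eq eval_nat_numeral)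
      then have t: "state (Suc n) \<omega> = target (innovation n \<omega>) (state n \<omega>)"
        using move_eq_iff[OF lt, of "state n \<omega>" "state (Suc n) \<omega>"] by (simp add: innovation_def)
      consider "innovation n \<omega> = 0" | "innovation n \<omega> = 1" | "innovation n \<omega> = 2"
        using lt by linarith
      then show ?thesis
        using t by cases (auto simp: state_def mart_incr_def jump_def of_int_sign_int sign_val_flip)
    qed
    have "real_of_int (X n \<omega>) + drift * sign_val (Y n \<omega>) =
        real_of_int (X 0 \<omega>) + drift * sign_val (Y 0 \<omega>) + mart.S n \<omega>"
      by (induction n) (simp_all add: mart.S_def step)
    \<comment> \<open>The martingale sum starts at 0, so the initial position and the signs at both
      ends remain; this is where |X 0| + 2 |drift| comes from.\<close>
    then have "real_of_int (X n \<omega>) - mart.S n \<omega> =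
        real_of_int (X 0 \<omega>) + drift * sign_val (Y 0 \<omega>) - drift * sign_val (Y n \<omega>)" by simp
    also have "\<bar>\<dots>\<bar> \<le> \<bar>real_of_int (X 0 \<omega>)\<bar> + \<bar>drift * sign_val (Y 0 \<omega>)\<bar> + \<bar>drift * sign_val (Y n \<omega>)\<bar>"
      by linarith
    finally show "\<bar>real_of_int (X n \<omega>) - mart.S n \<omega>\<bar> \<le> \<bar>real_of_int (X 0 \<omega>)\<bar> + 2 * \<bar>drift\<bar>"
      by (simp add: abs_mult abs_sign_val)
  qed
qed

theorem theorem1:
  fixes A B C v :: real
    and P :: "'a measure"
    and X :: "nat \<Rightarrow> 'a \<Rightarrow> int"
    and Y :: "nat \<Rightarrow> 'a \<Rightarrow> sign"
  assumes "A \<ge> 0" "B \<ge> 0" "C > 0" "A + B + C = 1"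
    and "markov_chain P (\<lambda>n \<omega>. (X n \<omega>, Y n \<omega>)) (transition A B C)"
    and "v = (A - B)\<^sup>2 / C + (A + B)"
  shows "(\<forall>(Q :: 'b measure) W. standard_brownian_motion Q W \<longrightarrow>
            converges_in_distribution skorokhod
              P (\<lambda>M \<omega>. \<lambda>t\<in>{0..}. rescaled X M t \<omega>)
              Q (\<lambda>\<omega>. \<lambda>t\<in>{0..}. sqrt v * W t \<omega>) at_top) \<and>
         (\<forall>t>0. \<forall>M :: nat \<Rightarrow> real. filterlim M at_top sequentially \<longrightarrow>
            weak_conv_m (\<lambda>n. distr P borel (rescaled X (M n) t)) (normal_law 0 (v * t)))"
proof (intro conjI allI impI)
  interpret signed_walk A B C P X Y
    using assms by unfold_locales auto
  note v = assms(6)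
  have v0: "0 \<le> v" using mart.v_nonneg by (simp add: v)
  {
    fix Q :: "'b measure" and W assume BM: "standard_brownian_motion Q W"
    interpret fclt: martingale_fclt P history mart_incr "1 + 2 * \<bar>drift\<bar>" "(A - B)\<^sup>2 / C + (A + B)"
        X "\<lambda>\<omega>. \<bar>real_of_int (X 0 \<omega>)\<bar> + 2 * \<bar>drift\<bar>" Q W
    proof -
      interpret Q: prob_space Q using BM by (simp add: standard_brownian_motion_def)
      show "martingale_fclt P history mart_incr (1 + 2 * \<bar>drift\<bar>) ((A - B)\<^sup>2 / C + (A + B))
          X (\<lambda>\<omega>. \<bar>real_of_int (X 0 \<omega>)\<bar> + 2 * \<bar>drift\<bar>) Q W"
        by unfold_locales (use BM v0 v in auto)
    qed
    have "(\<lambda>M \<omega>. \<lambda>t\<in>{0..}. rescaled X M t \<omega>) = fclt.scaled_path"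
      by (simp add: fun_eq_iff fclt.scaled_path_def step_path_def rescaled_def)
    moreover have "(\<lambda>\<omega>. \<lambda>t\<in>{0..}. sqrt v * W t \<omega>) = fclt.path"
      by (simp add: fun_eq_iff fclt.path_def v)
    ultimately show "converges_in_distribution skorokhod
              P (\<lambda>M \<omega>. \<lambda>t\<in>{0..}. rescaled X M t \<omega>)
              Q (\<lambda>\<omega>. \<lambda>t\<in>{0..}. sqrt v * W t \<omega>) at_top"
      using fclt.converges_in_distribution_scaled_path by simp
  }
  \<comment> \<open>The marginals are obtained from characteristic functions and not from the
    functional limit: the type of Q might carry no Brownian motion, and this half has to hold even
    then.\<close>
  fix t :: real and M :: "nat \<Rightarrow> real" assume "0 < t" "filterlim M at_top sequentially"
  then show "weak_conv_m (\<lambda>n. distr P borel (rescaled X (M n) t)) (normal_law 0 (v * t))"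
    using near.marginal_convergence[of M t] v0 by (simp add: normal_law_eq_centred_gaussian v)
qed

end
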